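(* Assume that the following reverse square function estimate holds: for every $2\le p\le 3$ and every $\epsilon>0$ there is a constant $C_{\epsilon,p}$ such that $$\|EF\|_{L^p(B_R)}\le C_{\epsilon,p}R^{\epsilon}\Big\|\Big(\sum_{q\in\mathcal{Q}_R}|E_qF|^2\Big)^{1/2}\Big\|_{L^p(w_{B_R})}$$ for all $R\ge 1$ with $\sqrt R\in\mathbb{N}$, all balls $B_R\subset\mathbb{R}^3$ of radius $R$ and all integrable $F:[0,1]^2\to\mathbb{C}$. Then for every $2\le p\le 3$ and every $\epsilon>0$ there is a constant $C'_{\epsilon,p}$ such that $$\|EF\|_{L^p(B_R)}\le C'_{\epsilon,p}R^\epsilon \Big(\sum_{i=1}^N\|E_{S_i}F\|_{L^p(w_{B_R})}^2\Big)^{1/2}$$ for all $R\ge 1$ with $\sqrt R\in\mathbb{N}$, all balls $B_R$ of radius $R$, all partitions of $[0,1]^2$ into large ensembles $S_1,\ldots,S_N$ (so $N=O(R)$), and all integrable $F:[0,1]^2\to\mathbb{C}$.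
   Context: Write $e(t)=e^{2\pi i t}$. For measurable $S\subset[0,1]^2$, integrable $F$ and $x\in\mathbb{R}^3$, $E_SF(x)=\int_SF(\xi)e((\xi,|\xi|^2)\cdot x)\,d\xi$, and $EF=E_{[0,1]^2}F$. $\mathcal{Q}_R$ is the collection of the squares $[\frac{j}{\sqrt R},\frac{j+1}{\sqrt R}]\times[\frac{i}{\sqrt R},\frac{i+1}{\sqrt R}]\subset[0,1]^2$, with $i,j$ integers. A large ensemble (at scale $R$) is a nonempty union of squares from $\mathcal{Q}_R$, disjoint up to boundaries; partitions are likewise understood up to boundaries of squares (measure zero). For a ball $B_R$ with center $c$ and radius $R$, $w_{B_R}(x)=(1+|x-c|/R)^{-100}$ is a rapidly decaying approximation of $1_{B_R}$, and $\|f\|_{L^p(w_{B_R})}=(\int|f|^pw_{B_R})^{1/p}$. *)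

theory Defs
  imports "HOL-Analysis.Analysis"
begin

definition e_char :: "real \<Rightarrow> complex" where
  "e_char t = exp (2 * of_real pi * \<i> * of_real t)"

definition unit_square :: "(real^2) set" where
  "unit_square = {\<xi>. \<forall>k. 0 \<le> \<xi> $ k \<and> \<xi> $ k \<le> 1}"

definition paraboloid :: "real^2 \<Rightarrow> real^3" where
  "paraboloid \<xi> = vector [\<xi> $ 1, \<xi> $ 2, (norm \<xi>)\<^sup>2]"

text \<open>The extension operator \<open>E\<^sub>S F\<close>; only used for measurable \<open>S \<subseteq> unit_square\<close> and
  \<open>F\<close> integrable on \<open>unit_square\<close>, so the Bochner integral never takes its default value.\<close>

definition extension :: "(real^2) set \<Rightarrow> (real^2 \<Rightarrow> complex) \<Rightarrow> real^3 \<Rightarrow> complex" where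
  "extension S F x = (LINT \<xi>:S|lebesgue. F \<xi> * e_char (paraboloid \<xi> \<bullet> x))"

definition grid_square :: "real \<Rightarrow> int \<Rightarrow> int \<Rightarrow> (real^2) set" where
  "grid_square R j i =
     {\<xi>. of_int j / sqrt R \<le> \<xi> $ 1 \<and> \<xi> $ 1 \<le> (of_int j + 1) / sqrt R \<and>
         of_int i / sqrt R \<le> \<xi> $ 2 \<and> \<xi> $ 2 \<le> (of_int i + 1) / sqrt R}"

definition grid_squares :: "real \<Rightarrow> (real^2) set set" where
  "grid_squares R = {grid_square R j i | j i. grid_square R j i \<subseteq> unit_square}"

definition large_ensemble :: "real \<Rightarrow> (real^2) set \<Rightarrow> bool" where
  "large_ensemble R S \<longleftrightarrow> (\<exists>\<Q>. \<Q> \<subseteq> grid_squares R \<and> \<Q> \<noteq> {} \<and> S = \<Union>\<Q>)"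

text \<open>The grid squares are closed, so parts may share boundary segments: disjointness is required
  up to measure zero, while the union of the (closed) parts is exactly the unit square.\<close>

definition ensemble_partition :: "real \<Rightarrow> nat \<Rightarrow> (nat \<Rightarrow> (real^2) set) \<Rightarrow> bool" where
  "ensemble_partition R N S \<longleftrightarrow>
     (\<forall>i\<in>{1..N}. large_ensemble R (S i)) \<and>
     (\<forall>i\<in>{1..N}. \<forall>j\<in>{1..N}. i \<noteq> j \<longrightarrow> negligible (S i \<inter> S j)) \<and>
     (\<Union>i\<in>{1..N}. S i) = unit_square"

definition ball_weight :: "real^3 \<Rightarrow> real \<Rightarrow> real^3 \<Rightarrow> real" where
  "ball_weight c R x = (1 + norm (x - c) / R) powr (-100)"

text \<open>Both norms are only applied to bounded continuous functions. Since \<open>ball_weight c R\<close> is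
  integrable over \<open>\<real>\<^sup>3\<close>, the integrals below are finite, and real-valued norms suffice.\<close>

definition Lp_norm_on :: "real \<Rightarrow> (real^3) set \<Rightarrow> (real^3 \<Rightarrow> 'b::real_normed_vector) \<Rightarrow> real" where
  "Lp_norm_on p B f = (LINT x:B|lborel. norm (f x) powr p) powr (1 / p)"

definition Lp_norm_weighted ::
    "real \<Rightarrow> (real^3 \<Rightarrow> real) \<Rightarrow> (real^3 \<Rightarrow> 'b::real_normed_vector) \<Rightarrow> real" where
  "Lp_norm_weighted p w f = (LINT x|lborel. norm (f x) powr p * w x) powr (1 / p)"

definition square_function :: "real \<Rightarrow> (real^2 \<Rightarrow> complex) \<Rightarrow> real^3 \<Rightarrow> real" where
  "square_function R F x = sqrt (\<Sum>q\<in>grid_squares R. (norm (extension q F x))\<^sup>2)"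

end

theory Submission
  imports Defs "HOL-Probability.Levy"
begin

text \<open>
The two estimates differ in how finely \<open>F\<close> is cut. If the norm on the right-hand side of the
reverse square function estimate were built from \<^emph>\<open>smooth\<close> localizations \<open>E(\<chi>\<^sub>k F)\<close>, with \<open>\<chi>\<^sub>k\<close> a
bump adapted to a square of side \<open>1/\<surd>R\<close>, the passage to large ensembles would rest on three facts.

  \<^item> Bessel. \<open>E(\<chi>\<^sub>k f)(x)\<close> is an average of the values of \<open>E f\<close> along horizontal translates of \<open>x\<close> by
    \<open>O(\<surd>R)\<close>, twisted by a character that depends on \<open>k\<close>. Hence \<open>\<Sum>\<^sub>k |E(\<chi>\<^sub>k f)(x)|\<^sup>2\<close> is at most a
    constant times an average of \<open>|E f|\<^sup>2\<close> near \<open>x\<close>, pointwise in \<open>x\<close> (\<open>spline_tensor_bessel\<close>).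
  \<^item> Such averages are bounded on \<open>L\<^sup>q(w)\<close> for \<open>q = p/2 \<ge> 1\<close>, because \<open>w\<close> is almost constant at scale
    \<open>\<surd>R \<le> R\<close> and the averaging kernel decays faster than \<open>w\<close> (\<open>directional_average_weighted\<close>).
  \<^item> Each bump meets at most four ensembles, so \<open>|E(\<chi>\<^sub>k F)|\<^sup>2 \<le> 4 \<Sum>\<^sub>i |E(\<chi>\<^sub>k F 1\<^bsub>S\<^sub>i\<^esub>)|\<^sup>2\<close>
    (\<open>spline_piece_ensemble_bound\<close>); Minkowski's inequality in \<open>L\<^bsup>p/2\<^esup>(w)\<close> then moves the sum over \<open>i\<close>
    outside (\<open>minkowski_finite_sum\<close>).

The sharp cutoffs \<open>E\<^sub>q F\<close> of the hypothesis have slowly decaying kernels, which the weight does not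
tolerate. They are removed by choosing the function to which the hypothesis is applied
(\<open>smooth_reverse_square_function\<close>). Take for \<open>\<chi>\<^sub>k\<close> tensor products of B-splines of a fixed order
\<open>L\<close> on the lattice of spacing \<open>1/(L\<surd>R)\<close>. They form a partition of unity and \<open>\<chi>\<^sub>k\<close> lives on a square
of side exactly \<open>1/\<surd>R\<close>. The indices \<open>k\<close> fall into boundedly many classes such that the supports within a
class are distinct squares of one translate of the grid. For a single class \<open>J\<close> and the translated
function \<open>\<xi> \<mapsto> \<Sum>\<^bsub>k \<in> J\<^esub> (\<chi>\<^sub>k F)(\<xi> + \<tau>)\<close>, a sharp cutoff to a grid square returns a whole smooth
piece or zero. Translating the frequency by \<open>\<tau>\<close> only shears physical space
(\<open>norm_extension_op_translate\<close>), and the shear distorts balls and weights by bounded factors.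

The B-spline of order \<open>m\<close> is a superposition of characters with density \<open>\<sigma>\<^sup>m\<close>, \<open>\<sigma>\<close> being the Fourier
transform of the indicator of \<open>[0,1]\<close> (\<open>spline_pair_exists\<close>). As \<open>\<sigma>(u) = O(1/|u|)\<close>, order
\<open>102 = 100 + 2\<close> gives a kernel that is still integrable against the growth \<open>|u|\<^bsup>100\<^esup>\<close> coming from the
weight.
\<close>

section \<open>Characters and the Fourier transform of the unit interval\<close>

lemma norm_e_char [simp]: "norm (e_char t) = 1"
  by (simp add: e_char_def)

lemma e_char_add: "e_char (s + t) = e_char s * e_char t"
  by (simp add: e_char_def exp_add algebra_simps)

lemma e_char_0 [simp]: "e_char 0 = 1"
  by (simp add: e_char_def)

lemma cnj_e_char: "cnj (e_char t) = e_char (- t)"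
  by (simp add: e_char_def exp_cnj)

lemma e_char_int [simp]: "e_char (of_int k) = 1"
proof -
  have "exp (2 * of_real pi * \<i> * of_real (of_int k)) = exp (of_int (2 * k) * pi * \<i>)"
    by (simp add: mult_ac)
  then show ?thesis
    unfolding e_char_def by (metis exp_integer_2pi Ints_of_int mult.assoc mult.commute of_int_mult of_int_numeral of_real_of_int_eq)
qed

lemma continuous_on_e_char [continuous_intros]:
  "continuous_on S f \<Longrightarrow> continuous_on S (\<lambda>x. e_char (f x))"
  unfolding e_char_def by (intro continuous_intros)

lemma borel_measurable_e_char [measurable]: "e_char \<in> borel_measurable borel"
  by (intro borel_measurable_continuous_onI continuous_intros)

lemma has_vector_derivative_e_char:
  "((\<lambda>x. e_char (c * x)) has_vector_derivative (2 * of_real pi * \<i> * of_real c) * e_char (c * x))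
     (at x within S)"
proof -
  have "((\<lambda>x. exp (2 * of_real pi * \<i> * of_real c * x)) has_field_derivative
     (2 * of_real pi * \<i> * of_real c) * e_char (c * x)) (at (of_real x))"
    unfolding e_char_def
    by (rule derivative_eq_intros refl | simp add: mult_ac)+
  from has_vector_derivative_real_field[OF this] show ?thesis
    by (simp add: e_char_def mult_ac)
qed

lemma integral_e_char:
  assumes "c \<noteq> 0"
  shows "(LINT x:{0..1}|lborel. e_char (c * x)) = (e_char c - 1) / (2 * of_real pi * \<i> * of_real c)"
proof -
  let ?d = "2 * of_real pi * \<i> * of_real c :: complex"
  have "((\<lambda>x. e_char (c * x) / ?d) has_vector_derivative e_char (c * x)) (at x within S)" for x S
    using has_vector_derivative_divide[OF has_vector_derivative_e_char[of c x S], of ?d] assms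
    by simp
  then have "(LINT x|lborel. indicator {0..1} x *\<^sub>R e_char (c * x)) = e_char (c * 1) / ?d - e_char (c * 0) / ?d"
    by (intro integral_FTC_Icc) (auto intro!: continuous_intros)
  then show ?thesis
    by (simp add: set_lebesgue_integral_def diff_divide_distrib)
qed

lemma integral_e_char_int:
  assumes "k \<noteq> (0::int)"
  shows "(LINT x:{0..1}|lborel. e_char (of_int k * x)) = 0"
  using assms by (subst integral_e_char) auto

text \<open>
The Fourier transform of the indicator of \<open>[0,1]\<close>; its modulus is \<open>|sin (\<pi>u) / (\<pi>u)|\<close>.
\<close>

definition unit_interval_ft :: "real \<Rightarrow> complex" where
  "unit_interval_ft u = (LINT x:{0..1}|lborel. e_char (- u * x))"

lemma borel_measurable_unit_interval_ft [measurable]: "unit_interval_ft \<in> borel_measurable borel"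
  unfolding unit_interval_ft_def set_lebesgue_integral_def by measurable

lemma set_integrable_e_char [simp]: "set_integrable lborel {0..1::real} (\<lambda>x. e_char (c * x))"
  by (intro borel_integrable_atLeastAtMost' continuous_intros)

lemma norm_unit_interval_ft_le_1: "norm (unit_interval_ft u) \<le> 1"
proof -
  have "norm (unit_interval_ft u) \<le> (LINT x:{0..1}|lborel. norm (e_char (- u * x)))"
    unfolding unit_interval_ft_def
    by (rule set_integral_norm_bound) (rule set_integrable_e_char)
  also have "\<dots> = 1"
    by (simp add: set_lebesgue_integral_def)
  finally show ?thesis .
qed

text \<open>
The common majorant for all kernels on the line: it is integrable and, up to a constant, unchanged by
shifts of length at most \<open>1\<close>.
\<close>

definition cauchy_density :: "real \<Rightarrow> real" where
  "cauchy_density u = 1 / (1 + u\<^sup>2)"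

lemma cauchy_density_pos: "cauchy_density u > 0"
  by (simp add: cauchy_density_def add_pos_nonneg)

lemma cauchy_density_measurable [measurable]: "cauchy_density \<in> borel_measurable borel"
  unfolding cauchy_density_def by measurable

lemma integrable_cauchy_density: "integrable lborel cauchy_density"
  using integrable_inverse_1_plus_square
  by (simp add: set_integrable_def einterval_def cauchy_density_def[abs_def] field_simps)

lemma norm_unit_interval_ft_sq: "(norm (unit_interval_ft u))\<^sup>2 \<le> 2 * cauchy_density u"
proof (cases "\<bar>u\<bar> \<le> 1")
  case True
  have "(norm (unit_interval_ft u))\<^sup>2 \<le> 1"
    using norm_unit_interval_ft_le_1[of u] by (simp add: power_le_one)
  also have "u\<^sup>2 \<le> 1"
    using True by (simp add: abs_square_le_1)
  then have "1 \<le> 2 * (1 / (1 + u\<^sup>2))"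
    by (simp add: divide_simps add_pos_nonneg)
  finally show ?thesis by (simp add: cauchy_density_def)
next
  case False
  have "unit_interval_ft u = (e_char (-u) - 1) / (2 * of_real pi * \<i> * of_real (-u))"
    unfolding unit_interval_ft_def using False by (subst integral_e_char) auto
  also have "norm \<dots> \<le> 2 / (2 * pi * \<bar>u\<bar>)"
    unfolding norm_divide
    using norm_triangle_ineq4[of "e_char (-u)" 1]
    by (intro frac_le) (use False in \<open>auto simp: norm_mult\<close>)
  also have "\<dots> = 1 / (pi * \<bar>u\<bar>)"
    by simp
  also have "\<dots> \<le> 1 / \<bar>u\<bar>"
    using False pi_ge_two mult_right_mono[of 1 pi "\<bar>u\<bar>"]
    by (intro divide_left_mono) (auto intro!: mult_pos_pos)
  finally have "(norm (unit_interval_ft u))\<^sup>2 \<le> (1 / \<bar>u\<bar>)\<^sup>2"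
    by (intro power_mono) auto
  also have "1 \<le> u\<^sup>2"
    using False one_le_power[of "\<bar>u\<bar>" 2] by simp
  then have "(1 / \<bar>u\<bar>)\<^sup>2 \<le> 2 * (1 / (1 + u\<^sup>2))"
    using False by (simp add: power_divide divide_simps)
  finally show ?thesis by (simp add: cauchy_density_def)
qed

lemma norm_unit_interval_ft_even_power:
  "norm (unit_interval_ft u ^ (2 * n)) \<le> 2 ^ n * cauchy_density u ^ n"
proof -
  have "norm (unit_interval_ft u ^ (2 * n)) = ((norm (unit_interval_ft u))\<^sup>2) ^ n"
    by (simp add: norm_power power_mult)
  also have "\<dots> \<le> (2 * cauchy_density u) ^ n"
    by (intro power_mono norm_unit_interval_ft_sq) auto
  finally show ?thesis by (simp add: power_mult_distrib)
qed

lemma norm_unit_interval_ft_power: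
  assumes "m \<ge> 2"
  shows "norm (unit_interval_ft u ^ m) \<le> 2 * cauchy_density u"
proof -
  have "norm (unit_interval_ft u ^ m) \<le> norm (unit_interval_ft u ^ 2)"
    using assms norm_unit_interval_ft_le_1[of u] by (simp add: norm_power power_decreasing)
  also have "\<dots> \<le> 2 * cauchy_density u"
    using norm_unit_interval_ft_sq[of u] by (simp add: norm_power)
  finally show ?thesis .
qed

lemma integrable_unit_interval_ft_power:
  assumes "m \<ge> 2"
  shows "integrable lborel (\<lambda>u. unit_interval_ft u ^ m)"
  by (rule Bochner_Integration.integrable_bound[OF integrable_mult_right[OF integrable_cauchy_density, of 2]])
     (use norm_unit_interval_ft_power[OF assms] cauchy_density_pos in
       \<open>auto simp: less_imp_le intro!: AE_I2\<close>)


section \<open>B-splines as superpositions of characters\<close>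

text \<open>
\<open>b\<close> is the B-spline of order \<open>m\<close>, that is, the \<open>m\<close>-fold convolution power of the indicator of
\<open>[0,1]\<close>, described by the properties that are used: support, partition of unity under integer translations,
and Fourier inversion. The partition of unity is stated for every finite set \<open>A\<close> of
translations that catches the support, which spares a choice of summation range.
\<close>

definition spline_pair :: "nat \<Rightarrow> (real \<Rightarrow> real) \<Rightarrow> bool" where
  "spline_pair m b \<longleftrightarrow> b \<in> borel_measurable borel \<and> (\<forall>t. 0 \<le> b t \<and> b t \<le> 1) \<and>
     (\<forall>t. b t \<noteq> 0 \<longrightarrow> 0 < t \<and> t < real m) \<and>
     (\<forall>t A. finite A \<and> {k::int. 0 < t - of_int k \<and> t - of_int k < real m} \<subseteq> A \<longrightarrow>
        (\<Sum>k\<in>A. b (t - of_int k)) = 1) \<and>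
     (\<forall>t. of_real (b t) = (LINT u|lborel. unit_interval_ft u ^ m * e_char (u * t)))"

text \<open>
Order \<open>2\<close> is the first order at which the Fourier integral converges absolutely. For the uniform
distribution on \<open>[0,1]\<close>, the function \<open>t \<mapsto> P (t - 1 < X \<le> t)\<close> is this spline, and the Levy inversion
formula for that probability is Fourier inversion: the factor \<open>(e\<^bsup>-iva\<^esup> - e\<^bsup>-ivb\<^esup>)/(iv)\<close> of the formula
contributes a second copy of the characteristic function. The intervals \<open>(t - k - 1, t - k]\<close> tile the line,
whence the partition of unity.
\<close>

lemma spline_pair_2: "\<exists>b. spline_pair 2 b"
proof -
  define U where "U = density lborel (indicator {0..1::real})"
  have U_space [simp]: "space U = UNIV" and U_sets [simp, measurable_cong]: "sets U = sets borel"
    by (auto simp: U_def)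
  have U_emeasure: "emeasure U A = emeasure lborel (A \<inter> {0..1})" if "A \<in> sets borel" for A
    using that by (simp add: U_def emeasure_density indicator_inter_arith[symmetric] Int_commute)
  have U_null: "measure U A = 0" if "A \<in> sets borel" "A \<inter> {0<..<1} = {}" for A
  proof -
    have "A \<inter> {0..1} \<subseteq> {0, 1}"
      using that by (auto simp: set_eq_iff) (metis less_eq_real_def)
    then have "emeasure lborel (A \<inter> {0..1}) \<le> emeasure lborel {0, 1::real}"
      by (intro emeasure_mono) auto
    also have "\<dots> = 0"
      by (intro emeasure_lborel_countable) auto
    finally show ?thesis
      using that by (simp add: measure_def U_emeasure)
  qed
  interpret U: prob_space U
    by (rule prob_spaceI) (simp add: U_emeasure)
  interpret U: real_distribution U
    by unfold_locales auto
  have U_atom: "measure U {a} = 0" for a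
  proof -
    have "emeasure lborel ({a} \<inter> {0..1}) \<le> emeasure lborel {a}"
      by (intro emeasure_mono) auto
    then show ?thesis by (simp add: measure_def U_emeasure)
  qed
  define b where "b t = measure U {t - 1 <.. t}" for t
  have char_U: "char U v = unit_interval_ft (- v / (2 * pi))" for v
  proof -
    have U_eq: "U = density lborel (\<lambda>x. ennreal (indicat_real {0..1} x))"
      by (simp add: U_def ennreal_indicator)
    show ?thesis
      unfolding char_def U_eq unit_interval_ft_def set_lebesgue_integral_def
      by (subst integral_density) (auto simp: e_char_def intro!: Bochner_Integration.integral_cong)
  qed
  have b_ft: "of_real (b t) = (LINT u|lborel. unit_interval_ft u ^ 2 * e_char (u * t))" for t
  proof -
    let ?f = "\<lambda>v. (iexp (-(v * (t - 1))) - iexp (-(v * t))) / (\<i> * v) * char U v"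
    let ?g = "\<lambda>v. unit_interval_ft (- v / (2 * pi)) ^ 2 * e_char (- v / (2 * pi) * t)"
    have fg: "?f v = ?g v" if "v \<noteq> 0" for v
    proof -
      have e: "iexp y = e_char (y / (2 * pi))" for y :: real
        by (simp add: e_char_def)
      have "unit_interval_ft (- v / (2 * pi)) = (e_char (v / (2 * pi)) - 1) / (\<i> * v)"
        unfolding unit_interval_ft_def using that by (subst integral_e_char) auto
      moreover have "iexp (-(v * (t - 1))) = e_char (v / (2 * pi)) * e_char (- v / (2 * pi) * t)"
        unfolding e e_char_add[symmetric] by (simp add: field_simps)
      moreover have "iexp (-(v * t)) = e_char (- v / (2 * pi) * t)"
        unfolding e by simp
      ultimately show ?thesis
        by (simp add: char_U power2_eq_square field_simps)
    qed
    have int: "integrable lborel (\<lambda>u. unit_interval_ft u ^ 2 * e_char (u * t))"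
      by (rule Bochner_Integration.integrable_bound[OF integrable_unit_interval_ft_power[of 2]])
         (auto simp: norm_mult)
    have g_int: "integrable lborel ?g"
      using lborel_integrable_real_affine[OF int, of "- 1 / (2 * pi)" 0] by simp
    have g_eq: "(LINT u|lborel. unit_interval_ft u ^ 2 * e_char (u * t))
       = (1 / (2 * pi)) *\<^sub>R (LINT v|lborel. ?g v)"
      by (subst lborel_integral_real_affine[where c = "- 1 / (2 * pi)" and t = 0]) auto
    have ae: "AE v in lborel. ?f v = ?g v"
      using AE_lborel_singleton[of 0] by eventually_elim (rule fg)
    have "(\<lambda>T. 1 / (2 * pi) * (CLBINT v=-(real T)..(real T). ?f v)) \<longlonglongrightarrow> of_real (measure U {t - 1<..t})"
      using U.Levy_Inversion[of "t - 1" t] U_atom by simp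
    moreover have "(CLBINT v=-(real T)..(real T). ?f v) = (LINT v|lborel. indicator {-real T<..<real T} v *\<^sub>R ?g v)"
      for T
    proof -
      have "(CLBINT v=-(real T)..(real T). ?f v) = (LINT v|lborel. indicator {-real T<..<real T} v *\<^sub>R ?f v)"
        by (simp add: interval_lebesgue_integral_def set_lebesgue_integral_def)
      also have "\<dots> = (LINT v|lborel. indicator {-real T<..<real T} v *\<^sub>R ?g v)"
        using ae by (intro integral_cong_AE) (auto elim: eventually_mono)
      finally show ?thesis .
    qed
    moreover have "(\<lambda>T. LINT v|lborel. indicator {-real T<..<real T} v *\<^sub>R ?g v) \<longlonglongrightarrow> (LINT v|lborel. ?g v)"
    proof (rule integral_dominated_convergence)
      show "integrable lborel (\<lambda>v. norm (?g v))" using g_int by (rule integrable_norm)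
      show "AE v in lborel. (\<lambda>T. indicator {-real T<..<real T} v *\<^sub>R ?g v) \<longlonglongrightarrow> ?g v"
      proof (rule AE_I2)
        fix v :: real
        have "\<forall>\<^sub>F T in sequentially. indicator {-real T<..<real T} v *\<^sub>R ?g v = ?g v"
        proof (rule eventually_sequentiallyI)
          fix T assume "nat \<lceil>\<bar>v\<bar>\<rceil> + 1 \<le> T"
          then have "\<bar>v\<bar> < real T" by linarith
          then have "v \<in> {-real T<..<real T}" by auto
          then show "indicator {-real T<..<real T} v *\<^sub>R ?g v = ?g v" by simp
        qed
        then show "(\<lambda>T. indicator {-real T<..<real T} v *\<^sub>R ?g v) \<longlonglongrightarrow> ?g v"
          by (rule tendsto_eventually)
      qed
      show "AE v in lborel. norm (indicator {-real T<..<real T} v *\<^sub>R ?g v) \<le> norm (?g v)" for T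
        by (auto simp: indicator_def)
    qed measurable
    then have "(\<lambda>T. 1 / (2 * pi) * (LINT v|lborel. indicator {-real T<..<real T} v *\<^sub>R ?g v))
        \<longlonglongrightarrow> 1 / (2 * pi) * (LINT v|lborel. ?g v)"
      by (intro tendsto_intros)
    ultimately have "of_real (measure U {t - 1<..t}) = 1 / (2 * pi) * (LINT v|lborel. ?g v)"
      by (metis (no_types, lifting) LIMSEQ_unique ext)
    then show ?thesis
      unfolding b_def g_eq by (simp add: scaleR_conv_of_real)
  qed
  have b_meas: "b \<in> borel_measurable borel"
  proof -
    have "(\<lambda>t. of_real (b t) :: complex) \<in> borel_measurable borel"
      unfolding b_ft by measurable
    then have "(\<lambda>t. Re (of_real (b t))) \<in> borel_measurable borel"
      by measurable
    then show ?thesis by simp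
  qed
  have b_supp: "0 < t \<and> t < real 2" if "b t \<noteq> 0" for t
  proof (rule ccontr)
    assume "\<not> (0 < t \<and> t < real 2)"
    then have "b t = 0" unfolding b_def by (intro U_null) auto
    with that show False by simp
  qed
  have b_sum: "(\<Sum>k\<in>A. b (t - of_int k)) = 1"
    if A: "finite A" "{k::int. 0 < t - of_int k \<and> t - of_int k < real 2} \<subseteq> A" for t A
  proof -
    have "(\<Sum>k\<in>A. b (t - of_int k)) = measure U (\<Union>k\<in>A. {t - of_int k - 1 <.. t - of_int k})"
    proof (unfold b_def, rule U.finite_measure_finite_Union[symmetric])
      show "disjoint_family_on (\<lambda>k. {t - real_of_int k - 1<..t - real_of_int k}) A"
        unfolding disjoint_family_on_def
      proof (intro ballI impI, rule ccontr)
        fix i j :: int assume ij: "i \<noteq> j"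
          "{t - real_of_int i - 1<..t - real_of_int i} \<inter> {t - real_of_int j - 1<..t - real_of_int j} \<noteq> {}"
        then obtain y where "t - real_of_int i - 1 < y" "y \<le> t - real_of_int i"
          "t - real_of_int j - 1 < y" "y \<le> t - real_of_int j" by auto
        then have "i < j + 1" "j < i + 1" by linarith+
        with ij(1) show False by linarith
      qed
    qed (use A in auto)
    also have "\<dots> = 1 - measure U (UNIV - (\<Union>k\<in>A. {t - of_int k - 1 <.. t - of_int k}))"
      using U.prob_compl[of "\<Union>k\<in>A. {t - of_int k - 1 <.. t - of_int k}"] A(1) by auto
    also have "measure U (UNIV - (\<Union>k\<in>A. {t - of_int k - 1 <.. t - of_int k})) = 0"
    proof (rule U_null)
      show "(UNIV - (\<Union>k\<in>A. {t - of_int k - 1 <.. t - of_int k})) \<inter> {0<..<1} = {}"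
      proof (rule ccontr)
        assume "(UNIV - (\<Union>k\<in>A. {t - of_int k - 1 <.. t - of_int k})) \<inter> {0<..<1} \<noteq> {}"
        then obtain y where "y \<in> {0<..<1}" "y \<notin> (\<Union>k\<in>A. {t - of_int k - 1 <.. t - of_int k})"
          by blast
        then have y: "0 < y" "y < 1" "\<And>k. k \<in> A \<Longrightarrow> \<not> (t - of_int k - 1 < y \<and> y \<le> t - of_int k)"
          by auto
        let ?k = "\<lfloor>t - y\<rfloor>"
        have "t - of_int ?k - 1 < y" "y \<le> t - of_int ?k" by linarith+
        moreover from this have "?k \<in> A" using A(2) y(1,2) by auto
        ultimately show False using y(3) by blast
      qed
    qed (use A in auto)
    finally show ?thesis by simp
  qed
  have "spline_pair 2 b"
    unfolding spline_pair_def using b_meas b_ft b_supp b_sum by (auto simp: b_def)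
  then show ?thesis by blast
qed

text \<open>
Convolving with the indicator of \<open>[0,1]\<close> raises the order by one: it averages the partition of unity,
widens the support by \<open>1\<close> and, by Fubini, multiplies the density \<open>\<sigma>\<^sup>m\<close> by \<open>\<sigma>\<close>.
\<close>

lemma spline_pair_Suc:
  assumes b: "spline_pair m b" and m: "m \<ge> 2"
  shows "\<exists>b'. spline_pair (Suc m) b'"
proof -
  note b' = b[unfolded spline_pair_def]
  have [measurable]: "b \<in> borel_measurable borel" using b' by auto
  have b01: "0 \<le> b t" "b t \<le> 1" for t using b' by auto
  have b_supp: "b t \<noteq> 0 \<Longrightarrow> 0 < t \<and> t < real m" for t using b' by auto
  have b_sum: "finite A \<Longrightarrow> {k::int. 0 < t - of_int k \<and> t - of_int k < real m} \<subseteq> A \<Longrightarrow>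
        (\<Sum>k\<in>A. b (t - of_int k)) = 1" for t A using b' by auto
  have b_ft: "of_real (b t) = (LINT u|lborel. unit_interval_ft u ^ m * e_char (u * t))" for t using b' by auto
  define c where "c t = (LINT x:{0..1}|lborel. b (t - x))" for t
  have int: "set_integrable lborel {0..1} (\<lambda>x. b (t - x))" for t
    unfolding set_integrable_def
    by (rule integrableI_bounded_set_indicator[where B = 1]) (use b01 in \<open>auto simp: abs_le_iff\<close>)
  have c_meas: "c \<in> borel_measurable borel"
    unfolding c_def set_lebesgue_integral_def by measurable
  have c_le: "0 \<le> c t \<and> c t \<le> 1" for t
  proof
    show "0 \<le> c t" unfolding c_def using b01
      by (auto simp: set_lebesgue_integral_def intro!: Bochner_Integration.integral_nonneg)
    have "c t \<le> (LINT x:{0..1::real}|lborel. 1)"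
      unfolding c_def by (rule set_integral_mono[OF int])
        (use b01 in \<open>auto intro!: borel_integrable_atLeastAtMost'\<close>)
    then show "c t \<le> 1" by (simp add: set_lebesgue_integral_def)
  qed
  have c_supp: "0 < t \<and> t < real (Suc m)" if "c t \<noteq> 0" for t
  proof -
    have "\<exists>x\<in>{0..1}. b (t - x) \<noteq> 0"
    proof (rule ccontr)
      assume "\<not> ?thesis"
      then have "c t = (LINT x:{0..1::real}|lborel. 0::real)"
        unfolding c_def by (intro set_lebesgue_integral_cong) auto
      with that show False by (simp add: set_lebesgue_integral_def)
    qed
    then show ?thesis using b_supp by fastforce
  qed
  have c_sum: "(\<Sum>k\<in>A. c (t - of_int k)) = 1"
    if A: "finite A" "{k::int. 0 < t - of_int k \<and> t - of_int k < real (Suc m)} \<subseteq> A" for t A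
  proof -
    have "(\<Sum>k\<in>A. c (t - of_int k)) = (LINT x:{0..1}|lborel. (\<Sum>k\<in>A. b (t - of_int k - x)))"
      unfolding c_def set_lebesgue_integral_def scaleR_sum_right
      by (intro Bochner_Integration.integral_sum[symmetric]) (use int in \<open>auto simp: set_integrable_def\<close>)
    also have "\<dots> = (LINT x:{0..1::real}|lborel. 1)"
    proof (intro set_lebesgue_integral_cong ballI allI impI)
      fix x :: real assume x: "x \<in> {0..1}"
      have "(\<Sum>k\<in>A. b ((t - x) - of_int k)) = 1"
        by (intro b_sum A) (use A x in auto)
      then show "(\<Sum>k\<in>A. b (t - of_int k - x)) = 1" by (simp add: algebra_simps)
    qed simp
    also have "\<dots> = 1" by (simp add: set_lebesgue_integral_def)
    finally show ?thesis .
  qed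
  have c_ft: "of_real (c t) = (LINT u|lborel. unit_interval_ft u ^ Suc m * e_char (u * t))" for t
  proof -
    let ?F = "\<lambda>u x. indicator {0..1} x *\<^sub>R (unit_interval_ft u ^ m * e_char (u * (t - x)))"
    have "integrable (lborel \<Otimes>\<^sub>M lborel) (case_prod ?F)"
    proof (rule lborel_pair.Fubini_integrable)
      show "integrable lborel (\<lambda>u. LINT x|lborel. norm (case (u, x) of (u, x) \<Rightarrow> ?F u x))"
        using integrable_norm[OF integrable_unit_interval_ft_power[OF m]]
        by (simp add: norm_mult)
      show "AE u in lborel. integrable lborel (\<lambda>x. case (u, x) of (u, x) \<Rightarrow> ?F u x)"
      proof (rule AE_I2)
        fix u
        show "integrable lborel (\<lambda>x. case (u, x) of (u, x) \<Rightarrow> ?F u x)"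
          unfolding prod.case
          by (rule integrableI_bounded_set_indicator[where B = 1])
             (auto simp: norm_mult norm_power norm_unit_interval_ft_le_1 power_le_one)
      qed
    qed measurable
    then have Fub: "(LINT x|lborel. LINT u|lborel. ?F u x) = (LINT u|lborel. LINT x|lborel. ?F u x)"
      by (rule lborel_pair.Fubini_integral)
    have "of_real (c t) = (LINT x|lborel. of_real (indicator {0..1} x *\<^sub>R b (t - x)) :: complex)"
      unfolding c_def set_lebesgue_integral_def by (rule integral_complex_of_real[symmetric])
    also have "\<dots> = (LINT x|lborel. LINT u|lborel. ?F u x)"
      by (intro Bochner_Integration.integral_cong refl) (simp add: b_ft scaleR_conv_of_real)
    also have "\<dots> = (LINT u|lborel. LINT x|lborel. ?F u x)" by (rule Fub)
    also have "\<dots> = (LINT u|lborel. unit_interval_ft u ^ Suc m * e_char (u * t))"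
    proof (intro Bochner_Integration.integral_cong refl)
      fix u
      have "(LINT x|lborel. ?F u x) = (LINT x|lborel. (unit_interval_ft u ^ m * e_char (u * t)) * (indicator {0..1} x *\<^sub>R e_char (- u * x)))"
        by (intro Bochner_Integration.integral_cong refl)
           (simp add: right_diff_distrib e_char_add[of "u * t" "- (u * _)", simplified] scaleR_conv_of_real)
      also have "\<dots> = unit_interval_ft u ^ m * e_char (u * t) * unit_interval_ft u"
        by (simp only: integral_mult_right_zero unit_interval_ft_def set_lebesgue_integral_def)
      finally show "(LINT x|lborel. ?F u x) = unit_interval_ft u ^ Suc m * e_char (u * t)"
        by simp
    qed
    finally show ?thesis .
  qed
  have "spline_pair (Suc m) c"
    unfolding spline_pair_def using c_meas c_le c_supp c_sum c_ft by blast
  then show ?thesis by blast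
qed

lemma spline_pair_exists: "m \<ge> 2 \<Longrightarrow> \<exists>b. spline_pair m b"
  by (induction m rule: nat_induct_at_least) (auto simp: spline_pair_2 intro: spline_pair_Suc)

section \<open>A weighted Bessel inequality\<close>

text \<open>
Orthogonality of the characters over a period. The period is run through as \<open>v - t\<close>, which is what the
substitution \<open>v = u + t\<close> in \<open>nn_integral_cauchy_density_trig_polynomial\<close> produces.
\<close>

lemma integral_trig_polynomial_sq:
  assumes "finite K"
  shows "(LINT t:{0..1}|lborel. (norm (\<Sum>k\<in>K. a k * e_char (of_int k * (v - t))))\<^sup>2)
    = (\<Sum>k\<in>K. (norm (a k))\<^sup>2)"
proof -
  let ?P = "\<lambda>t. \<Sum>k\<in>K. a k * e_char (of_int k * (v - t))"
  have P2: "of_real ((norm (?P t))\<^sup>2) = (\<Sum>k\<in>K. \<Sum>l\<in>K. a k * cnj (a l) * e_char (of_int (k - l) * v) * e_char (of_int (l - k) * t))"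
    for t
  proof -
    have *: "e_char (of_int k * (v - t)) * e_char (- (of_int l * (v - t))) = e_char (of_int (k - l) * v) * e_char (of_int (l - k) * t)"
      for k l unfolding e_char_add[symmetric] by (simp add: algebra_simps)
    have "of_real ((norm (?P t))\<^sup>2) = ?P t * cnj (?P t)"
      by (rule complex_norm_square)
    also have "\<dots> = (\<Sum>k\<in>K. \<Sum>l\<in>K. a k * cnj (a l) * (e_char (of_int k * (v - t)) * e_char (- (of_int l * (v - t)))))"
      by (simp add: sum_product cnj_e_char mult_ac)
    finally show ?thesis unfolding * by (simp add: mult_ac)
  qed
  have "of_real (LINT t:{0..1}|lborel. (norm (?P t))\<^sup>2)
      = (LINT t|lborel. indicator {0..1} t *\<^sub>R of_real ((norm (?P t))\<^sup>2) :: complex)"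
    unfolding set_lebesgue_integral_def
    by (subst integral_complex_of_real[symmetric]) (simp add: scaleR_conv_of_real)
  also have "\<dots> = (\<Sum>k\<in>K. \<Sum>l\<in>K. a k * cnj (a l) * e_char (of_int (k - l) * v) *
      (LINT t|lborel. indicator {0..1} t *\<^sub>R e_char (of_int (l - k) * t)))"
  proof -
    have i: "integrable lborel (\<lambda>t. indicator {0..1::real} t *\<^sub>R (z * e_char (c * t)))" for z c
      using integrable_mult_right[OF set_integrable_e_char[unfolded set_integrable_def], of z c] by simp
    have "(LINT t|lborel. indicator {0..1} t *\<^sub>R of_real ((norm (?P t))\<^sup>2) :: complex)
       = (LINT t|lborel. (\<Sum>k\<in>K. \<Sum>l\<in>K. indicator {0..1} t *\<^sub>R (a k * cnj (a l) * e_char (of_int (k - l) * v) * e_char (of_int (l - k) * t))))"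
      unfolding P2 scaleR_sum_right ..
    also have "\<dots> = (\<Sum>k\<in>K. \<Sum>l\<in>K. (LINT t|lborel. indicator {0..1} t *\<^sub>R (a k * cnj (a l) * e_char (of_int (k - l) * v) * e_char (of_int (l - k) * t))))"
      by (simp only: Bochner_Integration.integral_sum i Bochner_Integration.integrable_sum)
    finally show ?thesis
      by (simp only: integral_mult_right_zero mult_scaleR_right[symmetric])
  qed
  also have "\<dots> = (\<Sum>k\<in>K. \<Sum>l\<in>K. if l = k then of_real ((norm (a k))\<^sup>2) else 0)"
  proof (intro sum.cong refl)
    fix k l
    show "a k * cnj (a l) * e_char (of_int (k - l) * v) *
      (LINT t|lborel. indicator {0..1} t *\<^sub>R e_char (of_int (l - k) * t)) = (if l = k then of_real ((norm (a k))\<^sup>2) else 0)"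
      using integral_e_char_int[of "l - k"]
      by (cases "l = k") (auto simp: set_lebesgue_integral_def simp flip: complex_norm_square)
  qed
  also have "\<dots> = of_real (\<Sum>k\<in>K. (norm (a k))\<^sup>2)"
    using assms by (simp add: sum.delta)
  finally show ?thesis by (simp only: of_real_eq_iff)
qed

lemma nn_integral_trig_polynomial_sq:
  assumes "finite K"
  shows "(\<integral>\<^sup>+t. indicator {0..1} t * ennreal ((norm (\<Sum>k\<in>K. a k * e_char (of_int k * (v - t))))\<^sup>2) \<partial>lborel)
    = ennreal (\<Sum>k\<in>K. (norm (a k))\<^sup>2)"
proof -
  let ?g = "\<lambda>t. (norm (\<Sum>k\<in>K. a k * e_char (of_int k * (v - t))))\<^sup>2"
  have "set_integrable lborel {0..1} ?g"
    by (intro borel_integrable_atLeastAtMost' continuous_intros)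
  then have "(\<integral>\<^sup>+t. ennreal (indicator {0..1} t *\<^sub>R ?g t) \<partial>lborel) = ennreal (LINT t:{0..1}|lborel. ?g t)"
    unfolding set_lebesgue_integral_def set_integrable_def
    by (intro nn_integral_eq_integral) auto
  moreover have "ennreal (indicator {0..1} t *\<^sub>R ?g t) = indicator {0..1} t * ennreal (?g t)" for t
    by (simp add: indicator_def)
  ultimately show ?thesis
    using integral_trig_polynomial_sq[OF assms, of a v] by simp
qed

lemma nn_integral_lborel_shift:
  fixes f :: "'a::euclidean_space \<Rightarrow> ennreal"
  assumes [measurable]: "f \<in> borel_measurable borel"
  shows "(\<integral>\<^sup>+x. f (x + a) \<partial>lborel) = (\<integral>\<^sup>+x. f x \<partial>lborel)"
proof -
  have "(\<integral>\<^sup>+x. f x \<partial>lborel) = (\<integral>\<^sup>+x. f x \<partial>distr lborel borel ((+) a))"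
    by (simp add: lborel_distr_plus)
  also have "\<dots> = (\<integral>\<^sup>+x. f (x + a) \<partial>lborel)"
    by (subst nn_integral_distr) (auto simp: add.commute)
  finally show ?thesis ..
qed

lemma cauchy_density_shift:
  assumes "0 \<le> t" "t \<le> 1"
  shows "cauchy_density u \<le> 3 * cauchy_density (u + t)"
proof -
  have "t * t \<le> 1" using assms by (simp add: mult_le_one)
  then have "(u + t)\<^sup>2 \<le> 2 * u\<^sup>2 + 2"
    using zero_le_power2[of "u - t"] by (simp add: power2_eq_square algebra_simps)
  then have "1 + (u + t)\<^sup>2 \<le> 3 * (1 + u\<^sup>2)"
    using zero_le_power2[of u] by argo
  then show ?thesis
    by (simp add: cauchy_density_def divide_simps add_pos_nonneg)
qed

text \<open>
A \<open>1\<close>-periodic function, integrated against a density that barely changes over a period, behaves as if it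
were replaced by its mean. Concretely, \<open>\<omega>(u) \<le> 3 \<integral>\<^sub>0\<^sup>1 \<omega>(u + t) dt\<close>, and after the substitution
\<open>v = u + t\<close> the inner integral runs over a full period of the polynomial.
\<close>

lemma nn_integral_cauchy_density_trig_polynomial:
  assumes "finite K"
  shows "(\<integral>\<^sup>+u. ennreal (cauchy_density u * (norm (\<Sum>k\<in>K. a k * e_char (of_int k * u)))\<^sup>2) \<partial>lborel)
    \<le> ennreal (3 * (LINT u|lborel. cauchy_density u) * (\<Sum>k\<in>K. (norm (a k))\<^sup>2))"
proof -
  define g where "g u = (norm (\<Sum>k\<in>K. a k * e_char (of_int k * u)))\<^sup>2" for u :: real
  have [measurable]: "g \<in> borel_measurable borel" unfolding g_def by measurable
  have g0: "0 \<le> g u" for u by (simp add: g_def)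
  let ?S = "\<Sum>k\<in>K. (norm (a k))\<^sup>2"
  let ?i = "indicator {0..1} :: real \<Rightarrow> ennreal"
  have "(\<integral>\<^sup>+u. ennreal (cauchy_density u * g u) \<partial>lborel)
      = (\<integral>\<^sup>+u. (\<integral>\<^sup>+t. ?i t \<partial>lborel) * ennreal (cauchy_density u * g u) \<partial>lborel)"
    by simp
  also have "\<dots> = (\<integral>\<^sup>+u. (\<integral>\<^sup>+t. ?i t * ennreal (cauchy_density u * g u) \<partial>lborel) \<partial>lborel)"
    by (intro nn_integral_cong nn_integral_multc[symmetric]) auto
  also have "\<dots> \<le> (\<integral>\<^sup>+u. (\<integral>\<^sup>+t. ?i t * ennreal (3 * cauchy_density (u + t) * g u) \<partial>lborel) \<partial>lborel)"
    using cauchy_density_shift g0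
    by (intro nn_integral_mono) (auto simp: indicator_def intro!: ennreal_leI mult_right_mono)
  also have "\<dots> = (\<integral>\<^sup>+t. (\<integral>\<^sup>+u. ?i t * ennreal (3 * cauchy_density (u + t) * g u) \<partial>lborel) \<partial>lborel)"
    by (rule lborel_pair.Fubini') measurable
  also have "\<dots> = (\<integral>\<^sup>+t. (\<integral>\<^sup>+v. ?i t * ennreal (3 * cauchy_density v * g (v - t)) \<partial>lborel) \<partial>lborel)"
  proof (rule nn_integral_cong)
    fix t :: real
    show "(\<integral>\<^sup>+u. ?i t * ennreal (3 * cauchy_density (u + t) * g u) \<partial>lborel)
        = (\<integral>\<^sup>+v. ?i t * ennreal (3 * cauchy_density v * g (v - t)) \<partial>lborel)"
      using nn_integral_lborel_shift[of "\<lambda>v. ?i t * ennreal (3 * cauchy_density v * g (v - t))" t]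
      by simp
  qed
  also have "\<dots> = (\<integral>\<^sup>+v. (\<integral>\<^sup>+t. ?i t * ennreal (3 * cauchy_density v * g (v - t)) \<partial>lborel) \<partial>lborel)"
    by (rule lborel_pair.Fubini') measurable
  also have "\<dots> = (\<integral>\<^sup>+v. ennreal (3 * cauchy_density v) * (\<integral>\<^sup>+t. ?i t * ennreal (g (v - t)) \<partial>lborel) \<partial>lborel)"
    by (intro nn_integral_cong, subst nn_integral_cmult[symmetric])
       (auto intro!: nn_integral_cong
          simp: ennreal_mult'' g0 indicator_def cauchy_density_pos less_imp_le)
  also have "\<dots> = (\<integral>\<^sup>+v. ennreal (3 * cauchy_density v) * ennreal ?S \<partial>lborel)"
    unfolding g_def by (intro nn_integral_cong) (simp add: nn_integral_trig_polynomial_sq[OF assms])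
  also have "\<dots> = (\<integral>\<^sup>+v. ennreal (3 * cauchy_density v) \<partial>lborel) * ennreal ?S"
    by (rule nn_integral_multc) measurable
  also have "(\<integral>\<^sup>+v. ennreal (3 * cauchy_density v) \<partial>lborel) = ennreal (LINT v|lborel. 3 * cauchy_density v)"
    by (intro nn_integral_eq_integral integrable_mult_right integrable_cauchy_density)
       (auto simp: cauchy_density_pos less_imp_le)
  finally show ?thesis
    by (simp add: g_def ennreal_mult'' sum_nonneg)
qed

text \<open>
With \<open>a\<^sub>k\<close> the coefficients on the left and \<open>P = \<Sum>\<^sub>k cnj a\<^sub>k e(- k u)\<close>, the left-hand side \<open>X\<close> equals
\<open>\<integral> h \<eta> P\<close>. By the inequality of arithmetic and geometric means this is at most
\<open>D/2 \<integral> |h|\<^sup>2 |\<eta>| + 1/(2D) \<integral> |\<eta>| |P|\<^sup>2\<close>, and the last integral is at most \<open>D X\<close> by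
the preceding lemma once \<open>D\<close> is large, so half of \<open>X\<close> is absorbed. Since \<open>|\<eta>|\<close> itself remains as the
kernel on the right, its decay is not spent.
\<close>

lemma bessel_inequality:
  fixes \<eta> :: "real \<Rightarrow> complex"
  assumes [measurable]: "\<eta> \<in> borel_measurable borel" and A: "\<And>u. norm (\<eta> u) \<le> A * cauchy_density u"
  shows "\<exists>D>0. \<forall>h K. h \<in> borel_measurable borel \<and> bounded (range h) \<and> finite K \<longrightarrow>
     (\<Sum>k\<in>K. (norm (LINT u|lborel. h u * \<eta> u * e_char (- of_int k * u)))\<^sup>2)
       \<le> D * (LINT u|lborel. (norm (h u))\<^sup>2 * norm (\<eta> u))"
proof -
  define I where "I = (LINT u|lborel. cauchy_density u)"
  have I0: "I \<ge> 0" unfolding I_def by (intro Bochner_Integration.integral_nonneg) (auto simp: cauchy_density_pos less_imp_le)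
  have A0: "A \<ge> 0"
    using order_trans[OF norm_ge_zero A[of 0]] by (simp add: cauchy_density_def)
  \<comment> \<open>The summand \<open>1\<close> only serves to make \<open>D\<close> positive.\<close>
  define D where "D = 3 * A * I + 1"
  have D: "D > 0" "3 * A * I \<le> D" using I0 A0 by (auto simp: D_def add_nonneg_pos)
  have eta_int: "integrable lborel (\<lambda>u. norm (\<eta> u))"
    by (rule Bochner_Integration.integrable_bound[OF integrable_mult_right[OF integrable_cauchy_density, of A]])
       (use A in \<open>auto intro: order_trans abs_ge_self\<close>)
  have bdd_int: "integrable lborel (\<lambda>u. norm (\<eta> u) * f u)"
    if [measurable]: "f \<in> borel_measurable borel" and "\<And>u. norm (f u) \<le> B" for f :: "real \<Rightarrow> real" and B
    by (rule Bochner_Integration.integrable_bound[OF integrable_mult_right[OF eta_int, of B]])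
       (use that order_trans[OF norm_ge_zero that(2)] in \<open>auto simp: abs_mult mult.commute intro!: AE_I2 mult_right_mono\<close>)
  show ?thesis
  proof (intro exI[of _ D] conjI allI impI D(1))
    fix h :: "real \<Rightarrow> complex" and K :: "int set"
    assume hK: "h \<in> borel_measurable borel \<and> bounded (range h) \<and> finite K"
    then have [measurable]: "h \<in> borel_measurable borel" and K: "finite K" by auto
    obtain H where H: "\<And>u. norm (h u) \<le> H" using hK by (auto simp: bounded_iff)
    have H0: "H \<ge> 0" using H[of 0] norm_ge_zero[of "h 0"] by linarith
    define a where "a k = (LINT u|lborel. h u * \<eta> u * e_char (- of_int k * u))" for k :: int
    define P where "P u = (\<Sum>k\<in>K. cnj (a k) * e_char (of_int (- k) * u))" for u
    define X where "X = (\<Sum>k\<in>K. (norm (a k))\<^sup>2)"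
    define Y where "Y = (LINT u|lborel. (norm (h u))\<^sup>2 * norm (\<eta> u))"
    have [measurable]: "P \<in> borel_measurable borel" unfolding P_def by measurable
    define Q where "Q = (\<Sum>k\<in>K. norm (a k))"
    have P_le: "norm (P u) \<le> Q" for u
      unfolding P_def Q_def by (intro order_trans[OF norm_sum] sum_mono) (simp add: norm_mult)
    have Q0: "Q \<ge> 0" by (simp add: Q_def sum_nonneg)
    have int: "integrable lborel (\<lambda>u. h u * \<eta> u * e_char (- of_int k * u))" for k
      using bdd_int[of "\<lambda>u. norm (h u)" H] H
      by (subst integrable_norm_iff[symmetric]) (auto simp: norm_mult mult.commute)
    have int_h: "integrable lborel (\<lambda>u. norm (\<eta> u) * (norm (h u))\<^sup>2)"
      by (rule bdd_int[where B = "H\<^sup>2"]) (use H in \<open>auto intro!: power_mono\<close>)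
    have int_P: "integrable lborel (\<lambda>u. norm (\<eta> u) * (norm (P u))\<^sup>2)"
      by (rule bdd_int[where B = "Q\<^sup>2"]) (use P_le in \<open>auto intro!: power_mono\<close>)
    have "of_real X = (\<Sum>k\<in>K. cnj (a k) * a k)"
      by (simp add: X_def complex_norm_square mult.commute flip: of_real_power)
    also have "\<dots> = (LINT u|lborel. (\<Sum>k\<in>K. cnj (a k) * (h u * \<eta> u * e_char (- of_int k * u))))"
      unfolding a_def by (subst Bochner_Integration.integral_sum) (use int in auto)
    also have "\<dots> = (LINT u|lborel. h u * \<eta> u * P u)"
      by (simp add: P_def sum_distrib_left mult_ac)
    finally have "norm (of_real X :: complex) = norm (LINT u|lborel. h u * \<eta> u * P u)" by simp
    also have "\<dots> \<le> (LINT u|lborel. norm (h u * \<eta> u * P u))"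
      by (rule integral_norm_bound)
    also have "\<dots> \<le> (LINT u|lborel. D / 2 * ((norm (h u))\<^sup>2 * norm (\<eta> u)) + 1 / (2 * D) * (norm (\<eta> u) * (norm (P u))\<^sup>2))"
    proof (rule integral_mono)
      show "integrable lborel (\<lambda>u. norm (h u * \<eta> u * P u))"
      proof -
        have "norm (norm (h u) * norm (P u)) \<le> H * Q" for u
          using mult_mono[OF H[of u] P_le[of u]] H0 by simp
        then have "integrable lborel (\<lambda>u. norm (\<eta> u) * (norm (h u) * norm (P u)))"
          by (intro bdd_int) auto
        then show ?thesis
          by (simp add: norm_mult mult_ac)
      qed
      show "integrable lborel (\<lambda>u. D / 2 * ((norm (h u))\<^sup>2 * norm (\<eta> u)) + 1 / (2 * D) * (norm (\<eta> u) * (norm (P u))\<^sup>2))"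
        using int_h int_P
        by (intro Bochner_Integration.integrable_add integrable_mult_right) (auto simp: mult.commute)
      fix u
      have am: "x * y \<le> D / 2 * x\<^sup>2 + 1 / (2 * D) * y\<^sup>2" for x y :: real
        using zero_le_power2[of "D * x - y"] D(1) by (simp add: field_simps power2_eq_square)
      have "norm (h u * \<eta> u * P u) = norm (\<eta> u) * (norm (h u) * norm (P u))"
        by (simp add: norm_mult)
      also have "\<dots> \<le> norm (\<eta> u) * (D / 2 * (norm (h u))\<^sup>2 + 1 / (2 * D) * (norm (P u))\<^sup>2)"
        by (intro mult_left_mono am) auto
      finally show "norm (h u * \<eta> u * P u) \<le> D / 2 * ((norm (h u))\<^sup>2 * norm (\<eta> u)) + 1 / (2 * D) * (norm (\<eta> u) * (norm (P u))\<^sup>2)"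
        by (simp add: algebra_simps)
    qed
    also have "\<dots> = D / 2 * Y + 1 / (2 * D) * (LINT u|lborel. norm (\<eta> u) * (norm (P u))\<^sup>2)"
      using int_h int_P unfolding Y_def
      by (subst Bochner_Integration.integral_add) (auto simp: mult.commute)
    also have "(LINT u|lborel. norm (\<eta> u) * (norm (P u))\<^sup>2) \<le> D * X"
    proof -
      have "ennreal (LINT u|lborel. norm (\<eta> u) * (norm (P u))\<^sup>2) = (\<integral>\<^sup>+u. norm (\<eta> u) * (norm (P u))\<^sup>2 \<partial>lborel)"
        using int_P by (intro nn_integral_eq_integral[symmetric]) auto
      also have "\<dots> \<le> (\<integral>\<^sup>+u. ennreal A * ennreal (cauchy_density u * (norm (P u))\<^sup>2) \<partial>lborel)"
        using A A0 by (intro nn_integral_mono)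
           (auto simp: mult.assoc[symmetric] intro!: ennreal_leI mult_right_mono simp flip: ennreal_mult')
      also have "\<dots> = ennreal A * (\<integral>\<^sup>+u. ennreal (cauchy_density u * (norm (P u))\<^sup>2) \<partial>lborel)"
        by (rule nn_integral_cmult) measurable
      also have "\<dots> \<le> ennreal A * ennreal (3 * I * X)"
      proof (rule mult_left_mono)
        have P_eq: "P u = (\<Sum>k\<in>uminus ` K. cnj (a (- k)) * e_char (of_int k * u))" for u
          by (simp add: P_def sum.reindex)
        have X_eq: "X = (\<Sum>k\<in>uminus ` K. (norm (cnj (a (- k))))\<^sup>2)"
          by (simp add: X_def sum.reindex)
        show "(\<integral>\<^sup>+u. ennreal (cauchy_density u * (norm (P u))\<^sup>2) \<partial>lborel) \<le> ennreal (3 * I * X)"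
          unfolding P_eq X_eq I_def
          by (rule nn_integral_cauchy_density_trig_polynomial) (use K in auto)
      qed simp
      finally have "(LINT u|lborel. norm (\<eta> u) * (norm (P u))\<^sup>2) \<le> A * (3 * I * X)"
        using A0 I0 by (subst (asm) ennreal_mult'[symmetric]) (auto simp: mult_left_mono X_def sum_nonneg)
      also have "\<dots> \<le> D * X"
        using mult_right_mono[OF D(2), of X] by (simp add: X_def sum_nonneg mult_ac)
      finally show ?thesis .
    qed
    then have "D / 2 * Y + 1 / (2 * D) * (LINT u|lborel. norm (\<eta> u) * (norm (P u))\<^sup>2) \<le> D / 2 * Y + 1 / (2 * D) * (D * X)"
      using D by (intro add_left_mono mult_left_mono) auto
    finally have "\<bar>X\<bar> \<le> D / 2 * Y + X / 2" using D by simp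
    then have "X \<le> D * Y" by linarith
    then show "(\<Sum>k\<in>K. (norm (LINT u|lborel. h u * \<eta> u * e_char (- of_int k * u)))\<^sup>2)
       \<le> D * (LINT u|lborel. (norm (h u))\<^sup>2 * norm (\<eta> u))"
      by (simp add: X_def Y_def a_def)
  qed
qed

section \<open>Jensen and Minkowski inequalities for powers\<close>

lemma powr_above_tangent:
  fixes a t q :: real
  assumes "q \<ge> 1" "a > 0" "t \<ge> 0"
  shows "t powr q \<ge> a powr q + q * a powr (q - 1) * (t - a)"
proof (cases "t = 0")
  case True
  have "a powr (q - 1) * a = a powr q"
    using assms by (simp add: powr_diff)
  then have "q * a powr (q - 1) * a = q * a powr q"
    by (simp only: mult.assoc)
  moreover have "a powr q \<le> q * a powr q"
    using assms by simp
  ultimately have "a powr q + q * a powr (q - 1) * (0 - a) \<le> 0"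
    by (simp only: right_diff_distrib)
  then show ?thesis unfolding True using assms(1) by simp
next
  case False
  have "(\<lambda>x. x powr q) t - (\<lambda>x. x powr q) a \<ge> q * a powr (q - 1) * (t - a)"
  proof (rule convex_on_imp_above_tangent[OF powr_convex])
    show "((\<lambda>x. x powr q) has_real_derivative q * a powr (q - 1)) (at a within {0<..})"
      using assms by (auto intro!: derivative_eq_intros)
  qed (use assms False in \<open>auto intro: connected_Ioi simp: interior_open\<close>)
  then show ?thesis by simp
qed

text \<open>
Jensen's inequality for a measure of total mass at most \<open>M\<close>, from the tangent line of \<open>t\<^sup>q\<close> at the mean
value \<open>a = X / M\<close>.
\<close>

lemma powr_integral_le:
  fixes h \<kappa> :: "'a \<Rightarrow> real"
  assumes q: "q \<ge> 1" and M: "M > 0" "(LINT u|N. \<kappa> u) \<le> M"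
    and nonneg: "\<And>u. u \<in> space N \<Longrightarrow> 0 \<le> \<kappa> u" "\<And>u. u \<in> space N \<Longrightarrow> 0 \<le> h u"
    and int: "integrable N \<kappa>" "integrable N (\<lambda>u. h u * \<kappa> u)" "integrable N (\<lambda>u. h u powr q * \<kappa> u)"
  shows "(LINT u|N. h u * \<kappa> u) powr q \<le> M powr (q - 1) * (LINT u|N. h u powr q * \<kappa> u)"
proof -
  define X where "X = (LINT u|N. h u * \<kappa> u)"
  have X0: "X \<ge> 0" unfolding X_def by (intro Bochner_Integration.integral_nonneg) (auto simp: nonneg)
  have Z0: "(LINT u|N. h u powr q * \<kappa> u) \<ge> 0" by (intro Bochner_Integration.integral_nonneg) (auto simp: nonneg)
  show ?thesis
  proof (cases "X = 0")
    case True
    then show ?thesis using Z0 by (simp flip: X_def)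
  next
    case False
    define a where "a = X / M"
    have a: "a > 0" using False X0 M by (simp add: a_def)
    let ?d = "q * a powr (q - 1)"
    have aq: "a powr (q - 1) * a = a powr q"
      using a by (simp add: powr_diff)
    have "(a powr q - ?d * a) * M \<le> (a powr q - ?d * a) * (LINT u|N. \<kappa> u)"
    proof (rule mult_left_mono_neg[OF M(2)])
      have "?d * a = q * a powr q" using aq by (simp only: mult.assoc)
      moreover have "a powr q \<le> q * a powr q" using mult_right_mono[OF q powr_ge_zero[of a q]] by simp
      ultimately show "a powr q - ?d * a \<le> 0" by linarith
    qed
    then have "(a powr q - ?d * a) * M + ?d * X \<le> (a powr q - ?d * a) * (LINT u|N. \<kappa> u) + ?d * X" by simp
    also have "\<dots> = (LINT u|N. (a powr q - ?d * a) * \<kappa> u + ?d * (h u * \<kappa> u))"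
      unfolding X_def using int by simp
    also have "\<dots> \<le> (LINT u|N. h u powr q * \<kappa> u)"
    proof (rule integral_mono)
      fix u assume u: "u \<in> space N"
      have "(a powr q + ?d * (h u - a)) * \<kappa> u \<le> h u powr q * \<kappa> u"
        using u by (intro mult_right_mono powr_above_tangent) (auto simp: nonneg q a)
      then show "(a powr q - ?d * a) * \<kappa> u + ?d * (h u * \<kappa> u) \<le> h u powr q * \<kappa> u"
        by (simp add: algebra_simps)
    qed (use int in auto)
    also have "(a powr q - ?d * a) * M + ?d * X = a powr q * M"
      using M by (simp add: a_def algebra_simps)
    finally have "M powr (q - 1) * (a powr q * M) \<le> M powr (q - 1) * (LINT u|N. h u powr q * \<kappa> u)"
      by (intro mult_left_mono) auto
    moreover have "M powr (q - 1) * (a powr q * M) = X powr q"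
      using M X0 by (simp add: a_def powr_divide powr_diff)
    ultimately show ?thesis by (simp add: X_def)
  qed
qed

text \<open>
Hoelder's inequality with free positive weights \<open>a i\<close>: it is Jensen's inequality for the values
\<open>H i / a i\<close> with masses \<open>a i\<close>.
\<close>

lemma powr_sum_le:
  fixes H :: "'i \<Rightarrow> real"
  assumes "finite I" "I \<noteq> {}" "q \<ge> 1" "\<And>i. i \<in> I \<Longrightarrow> 0 \<le> H i" "\<And>i. i \<in> I \<Longrightarrow> 0 < a i"
  shows "(\<Sum>i\<in>I. H i) powr q \<le> (\<Sum>i\<in>I. a i) powr (q - 1) * (\<Sum>i\<in>I. a i powr (1 - q) * H i powr q)"
proof -
  have "(LINT i|count_space I. (H i / a i) * a i) powr q
      \<le> (\<Sum>i\<in>I. a i) powr (q - 1) * (LINT i|count_space I. (H i / a i) powr q * a i)"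
    by (rule powr_integral_le)
       (use assms in \<open>auto simp: lebesgue_integral_count_space_finite integrable_count_space less_imp_le intro!: sum_pos\<close>)
  moreover have "(H i / a i) powr q * a i = a i powr (1 - q) * H i powr q" if "i \<in> I" for i
    using assms(4,5)[OF that] by (simp add: powr_divide powr_diff)
  moreover have "(H i / a i) * a i = H i" if "i \<in> I" for i
    using assms(5)[OF that] by simp
  ultimately show ?thesis
    using assms(1) by (simp add: lebesgue_integral_count_space_finite cong: sum.cong)
qed

text \<open>
With \<open>a i\<close> equal to the \<open>L\<^sup>q\<close> norms in the preceding lemma, integration gives the triangle inequality at once.
That lemma divides by the norms, so they are first enlarged to be positive, and the enlargement
tends to \<open>0\<close> at the end.
\<close>

lemma minkowski_finite_sum:
  fixes H :: "'i \<Rightarrow> 'a \<Rightarrow> real" and w :: "'a \<Rightarrow> real"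
  assumes I: "finite I" "I \<noteq> {}" and q: "q \<ge> 1"
    and [measurable]: "\<And>i. i \<in> I \<Longrightarrow> H i \<in> borel_measurable N" "w \<in> borel_measurable N"
    and nonneg: "\<And>i x. i \<in> I \<Longrightarrow> 0 \<le> H i x" "\<And>x. 0 \<le> w x"
    and a: "\<And>i. i \<in> I \<Longrightarrow> 0 \<le> a i"
    and le: "\<And>i. i \<in> I \<Longrightarrow> (\<integral>\<^sup>+x. ennreal (H i x powr q * w x) \<partial>N) \<le> ennreal (a i powr q)"
  shows "(\<integral>\<^sup>+x. ennreal ((\<Sum>i\<in>I. H i x) powr q * w x) \<partial>N) \<le> ennreal ((\<Sum>i\<in>I. a i) powr q)"
proof -
  have strict: "(\<integral>\<^sup>+x. ennreal ((\<Sum>i\<in>I. H i x) powr q * w x) \<partial>N) \<le> ennreal ((\<Sum>i\<in>I. b i) powr q)"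
    if b: "\<And>i. i \<in> I \<Longrightarrow> a i \<le> b i \<and> 0 < b i" for b
  proof -
    let ?B = "\<Sum>i\<in>I. b i"
    have B: "?B > 0" using I b by (intro sum_pos) auto
    have "(\<integral>\<^sup>+x. ennreal ((\<Sum>i\<in>I. H i x) powr q * w x) \<partial>N)
       \<le> (\<integral>\<^sup>+x. (\<Sum>i\<in>I. ennreal (?B powr (q - 1) * b i powr (1 - q)) * ennreal (H i x powr q * w x)) \<partial>N)"
    proof (rule nn_integral_mono)
      fix x
      have "(\<Sum>i\<in>I. H i x) powr q * w x \<le> (?B powr (q - 1) * (\<Sum>i\<in>I. b i powr (1 - q) * H i x powr q)) * w x"
        using I q nonneg b by (intro mult_right_mono powr_sum_le) auto
      also have "\<dots> = (\<Sum>i\<in>I. (?B powr (q - 1) * b i powr (1 - q)) * (H i x powr q * w x))"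
        by (simp add: sum_distrib_left sum_distrib_right mult_ac)
      finally have "ennreal ((\<Sum>i\<in>I. H i x) powr q * w x)
         \<le> ennreal (\<Sum>i\<in>I. (?B powr (q - 1) * b i powr (1 - q)) * (H i x powr q * w x))"
        by (rule ennreal_leI)
      also have "\<dots> = (\<Sum>i\<in>I. ennreal ((?B powr (q - 1) * b i powr (1 - q)) * (H i x powr q * w x)))"
        using nonneg by (intro sum_ennreal[symmetric]) auto
      finally show "ennreal ((\<Sum>i\<in>I. H i x) powr q * w x)
         \<le> (\<Sum>i\<in>I. ennreal (?B powr (q - 1) * b i powr (1 - q)) * ennreal (H i x powr q * w x))"
        using nonneg by (simp add: ennreal_mult'')
    qed
    also have "\<dots> = (\<Sum>i\<in>I. ennreal (?B powr (q - 1) * b i powr (1 - q)) * (\<integral>\<^sup>+x. ennreal (H i x powr q * w x) \<partial>N))"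
      by (subst nn_integral_sum) (auto intro!: sum.cong nn_integral_cmult)
    also have "\<dots> \<le> (\<Sum>i\<in>I. ennreal (?B powr (q - 1) * b i powr (1 - q)) * ennreal (b i powr q))"
      using a b q by (intro sum_mono mult_left_mono order_trans[OF le] ennreal_leI powr_mono2) auto
    also have "\<dots> = (\<Sum>i\<in>I. ennreal (?B powr (q - 1) * b i))"
    proof (intro sum.cong refl)
      fix i assume "i \<in> I"
      then have "b i powr (1 - q) * b i powr q = b i"
        using b[of i] by (simp flip: powr_add)
      then show "ennreal (?B powr (q - 1) * b i powr (1 - q)) * ennreal (b i powr q) = ennreal (?B powr (q - 1) * b i)"
        by (simp add: ennreal_mult''[symmetric] mult.assoc)
    qed
    also have "\<dots> = ennreal (\<Sum>i\<in>I. ?B powr (q - 1) * b i)"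
      using b by (intro sum_ennreal) (auto simp: less_imp_le)
    also have "(\<Sum>i\<in>I. ?B powr (q - 1) * b i) = ?B powr q"
      using B by (simp only: sum_distrib_left[symmetric]) (simp add: powr_diff)
    finally show ?thesis .
  qed
  \<comment> \<open>The strict case applies to the enlarged numbers \<open>a i + 1 / (n + 1)\<close>.\<close>
  let ?l = "\<lambda>n. ennreal ((\<Sum>i\<in>I. a i + 1 / real (Suc n)) powr q)"
  have "?l \<longlonglongrightarrow> ennreal ((\<Sum>i\<in>I. a i + 0) powr q)"
  proof (rule tendsto_ennrealI, rule tendsto_powr')
    show "(\<lambda>n. \<Sum>i\<in>I. a i + 1 / real (Suc n)) \<longlonglongrightarrow> (\<Sum>i\<in>I. a i + 0)"
      by (intro tendsto_sum tendsto_add tendsto_const LIMSEQ_Suc[OF lim_1_over_n])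
    show "(\<Sum>i\<in>I. a i + 0) \<noteq> 0 \<or> 0 < q \<and> (\<forall>\<^sub>F n in sequentially. 0 \<le> (\<Sum>i\<in>I. a i + 1 / real (Suc n)))"
      using q a by (auto intro!: always_eventually sum_nonneg add_nonneg_nonneg)
  qed auto
  then have "?l \<longlonglongrightarrow> ennreal ((\<Sum>i\<in>I. a i) powr q)" by simp
  then show ?thesis
  proof (rule LIMSEQ_le_const)
    show "\<exists>N'. \<forall>n\<ge>N'. (\<integral>\<^sup>+x. ennreal ((\<Sum>i\<in>I. H i x) powr q * w x) \<partial>N) \<le> ?l n"
      using a by (intro exI allI impI strict) (auto intro: add_nonneg_pos)
  qed
qed

section \<open>The ball weight and averages along a line\<close>

lemma ball_weight_nonneg [simp]: "0 \<le> ball_weight c R x"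
  by (simp add: ball_weight_def)

lemma ball_weight_measurable [measurable]: "ball_weight c R \<in> borel_measurable borel"
  unfolding ball_weight_def by measurable

lemma ball_weight_le:
  assumes "0 < R" "0 < A" and le: "1 + norm (x - c) / R \<le> A * (1 + norm (y - d) / R)"
  shows "ball_weight d R y \<le> A powr 100 * ball_weight c R x"
proof -
  have pos: "1 + norm (x - c) / R > 0" "1 + norm (y - d) / R > 0"
    using assms(1) by (auto intro: add_pos_nonneg)
  have "(A * (1 + norm (y - d) / R)) powr (-100) \<le> (1 + norm (x - c) / R) powr (-100)"
    by (rule powr_mono2') (use le pos in auto)
  then have "A powr 100 * (A * (1 + norm (y - d) / R)) powr (-100) \<le> A powr 100 * (1 + norm (x - c) / R) powr (-100)"
    by (intro mult_left_mono) auto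
  moreover have "A powr 100 * (A * (1 + norm (y - d) / R)) powr (-100) = (1 + norm (y - d) / R) powr (-100)"
  proof -
    have "A powr 100 * A powr (-100) = 1"
      using assms(2) by (simp add: powr_add[symmetric] del: powr_numeral)
    then show ?thesis
      using assms(2) pos by (simp only: powr_mult mult.assoc[symmetric] mult_1)
  qed
  ultimately show ?thesis by (simp add: ball_weight_def)
qed

text \<open>
The weight is almost constant at scale \<open>R\<close>; a shift by \<open>a R\<close> costs a polynomial factor in \<open>a\<close> of the
same degree as the decay of the weight.
\<close>

lemma ball_weight_shift:
  assumes "0 < R" "norm v \<le> a * R"
  shows "ball_weight c R (x - v) \<le> (1 + a) powr 100 * ball_weight c R x"
proof (rule ball_weight_le)
  have a: "a \<ge> 0"
    using order_trans[OF norm_ge_zero assms(2)] assms(1) by (simp add: zero_le_mult_iff)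
  have "norm (x - c) \<le> norm (x - v - c) + norm v"
    using norm_triangle_ineq[of "x - v - c" v] by simp
  then have "norm (x - c) / R \<le> norm (x - v - c) / R + norm v / R"
    using assms by (simp add: divide_right_mono flip: add_divide_distrib)
  also have "norm v / R \<le> a" using assms by (simp add: pos_divide_le_eq)
  finally have "1 + norm (x - c) / R \<le> (1 + a) + norm (x - v - c) / R" by simp
  also have "\<dots> \<le> (1 + a) + (1 + a) * (norm (x - v - c) / R)"
    using a assms(1) mult_right_mono[of 1 "1 + a" "norm (x - v - c) / R"] by simp
  also have "\<dots> = (1 + a) * (1 + norm (x - v - c) / R)"
    by (rule distrib_left[of "1 + a" 1, simplified, symmetric])
  finally show "1 + norm (x - c) / R \<le> (1 + a) * (1 + norm (x - v - c) / R)" .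
  show "0 < 1 + a" using a by simp
qed (use assms in auto)

definition directional_average :: "(real \<Rightarrow> real) \<Rightarrow> real^3 \<Rightarrow> (real^3 \<Rightarrow> real) \<Rightarrow> real^3 \<Rightarrow> real" where
  "directional_average \<kappa> v h x = (LINT u|lborel. h (x + u *\<^sub>R v) * \<kappa> u)"

lemma directional_average_measurable [measurable (raw)]:
  assumes [measurable]: "\<kappa> \<in> borel_measurable borel" "h \<in> borel_measurable borel"
  shows "directional_average \<kappa> v h \<in> borel_measurable borel"
  unfolding directional_average_def by measurable

lemma integrable_bounded_mult:
  fixes \<kappa> f :: "real \<Rightarrow> real"
  assumes "integrable lborel \<kappa>" "f \<in> borel_measurable borel" "\<And>u. \<bar>f u\<bar> \<le> B"
  shows "integrable lborel (\<lambda>u. f u * \<kappa> u)"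
proof (rule Bochner_Integration.integrable_bound)
  show "integrable lborel (\<lambda>u. B * \<kappa> u)" using assms by simp
  show "AE u in lborel. norm (f u * \<kappa> u) \<le> norm (B * \<kappa> u)"
    using assms(3) order_trans[OF abs_ge_zero assms(3)]
    by (auto simp: abs_mult intro!: AE_I2 mult_right_mono)
qed (use assms in measurable)

lemma directional_average_bounds:
  assumes \<kappa>: "integrable lborel \<kappa>" "\<And>u. 0 \<le> \<kappa> u"
    and h: "h \<in> borel_measurable borel" "\<And>x. 0 \<le> h x" "\<And>x. h x \<le> B"
  shows "0 \<le> directional_average \<kappa> v h x" "directional_average \<kappa> v h x \<le> B * (LINT u|lborel. \<kappa> u)"
proof -
  note [measurable] = h(1)
  show "0 \<le> directional_average \<kappa> v h x"
    unfolding directional_average_def using \<kappa> h by (intro Bochner_Integration.integral_nonneg) auto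
  have "B \<ge> 0" using order_trans[OF h(2) h(3)] .
  then have "directional_average \<kappa> v h x \<le> (LINT u|lborel. B * \<kappa> u)"
    unfolding directional_average_def
    using \<kappa> h by (intro integral_mono integrable_bounded_mult[where B = B]) (auto intro!: mult_right_mono)
  then show "directional_average \<kappa> v h x \<le> B * (LINT u|lborel. \<kappa> u)" by simp
qed

text \<open>
Jensen's inequality moves the power inside the average; after Fubini each translate of \<open>h\<close> is
moved onto the weight, and the loss \<open>(1 + L |u|)\<^bsup>100\<^esup>\<close> is integrable against the kernel by assumption.
\<close>

lemma directional_average_weighted:
  assumes q: "q \<ge> 1" and M: "M > 0" "(LINT u|lborel. \<kappa> u) \<le> M"
      "(\<integral>\<^sup>+u. ennreal (\<kappa> u * (1 + L * \<bar>u\<bar>) powr 100) \<partial>lborel) \<le> ennreal M"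
    and \<kappa>: "integrable lborel \<kappa>" "\<And>u. 0 \<le> \<kappa> u"
    and h: "h \<in> borel_measurable borel" "\<And>x. 0 \<le> h x" "\<And>x. h x \<le> B"
    and R: "0 < R" "norm v \<le> L * R"
  shows "(\<integral>\<^sup>+x. ennreal (directional_average \<kappa> v h x powr q * ball_weight c R x) \<partial>lborel)
     \<le> ennreal (M powr q) * (\<integral>\<^sup>+x. ennreal (h x powr q * ball_weight c R x) \<partial>lborel)"
proof -
  note [measurable] = h(1)
  have [measurable]: "\<kappa> \<in> borel_measurable borel" using \<kappa>(1) by auto
  let ?w = "ball_weight c R"
  have "(\<integral>\<^sup>+x. ennreal (directional_average \<kappa> v h x powr q * ?w x) \<partial>lborel)
    \<le> (\<integral>\<^sup>+x. ennreal (M powr (q - 1)) * (\<integral>\<^sup>+u. ennreal (h (x + u *\<^sub>R v) powr q * \<kappa> u * ?w x) \<partial>lborel) \<partial>lborel)"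
  proof (rule nn_integral_mono)
    fix x
    have i: "integrable lborel (\<lambda>u. h (x + u *\<^sub>R v) powr q * \<kappa> u)"
      using h q by (intro integrable_bounded_mult[OF \<kappa>(1), where B = "B powr q"]) (auto intro!: powr_mono2)
    have i': "integrable lborel (\<lambda>u. h (x + u *\<^sub>R v) * \<kappa> u)"
      using h by (intro integrable_bounded_mult[OF \<kappa>(1), where B = B]) auto
    have "directional_average \<kappa> v h x powr q \<le> M powr (q - 1) * (LINT u|lborel. h (x + u *\<^sub>R v) powr q * \<kappa> u)"
      unfolding directional_average_def
      using q M \<kappa> h i i' by (intro powr_integral_le) auto
    then have "directional_average \<kappa> v h x powr q * ?w x
        \<le> M powr (q - 1) * (LINT u|lborel. h (x + u *\<^sub>R v) powr q * \<kappa> u) * ?w x"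
      by (rule mult_right_mono) simp
    then have "directional_average \<kappa> v h x powr q * ?w x
        \<le> M powr (q - 1) * (LINT u|lborel. h (x + u *\<^sub>R v) powr q * \<kappa> u * ?w x)"
      by (subst integral_mult_left_zero) (simp add: mult.assoc)
    then have "ennreal (directional_average \<kappa> v h x powr q * ?w x)
        \<le> ennreal (M powr (q - 1)) * ennreal (LINT u|lborel. h (x + u *\<^sub>R v) powr q * \<kappa> u * ?w x)"
      by (simp add: ennreal_leI flip: ennreal_mult')
    also have "ennreal (LINT u|lborel. h (x + u *\<^sub>R v) powr q * \<kappa> u * ?w x)
      = (\<integral>\<^sup>+u. ennreal (h (x + u *\<^sub>R v) powr q * \<kappa> u * ?w x) \<partial>lborel)"
      using i \<kappa> by (intro nn_integral_eq_integral[symmetric]) auto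
    finally show "ennreal (directional_average \<kappa> v h x powr q * ?w x)
        \<le> ennreal (M powr (q - 1)) * (\<integral>\<^sup>+u. ennreal (h (x + u *\<^sub>R v) powr q * \<kappa> u * ?w x) \<partial>lborel)" .
  qed
  also have "\<dots> = ennreal (M powr (q - 1)) * (\<integral>\<^sup>+x. \<integral>\<^sup>+u. ennreal (h (x + u *\<^sub>R v) powr q * \<kappa> u * ?w x) \<partial>lborel \<partial>lborel)"
    by (rule nn_integral_cmult) measurable
  also have "(\<integral>\<^sup>+x. \<integral>\<^sup>+u. ennreal (h (x + u *\<^sub>R v) powr q * \<kappa> u * ?w x) \<partial>lborel \<partial>lborel)
    = (\<integral>\<^sup>+u. \<integral>\<^sup>+x. ennreal (h (x + u *\<^sub>R v) powr q * \<kappa> u * ?w x) \<partial>lborel \<partial>lborel)"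
    by (rule lborel_pair.Fubini'[symmetric]) measurable
  also have "\<dots> \<le> (\<integral>\<^sup>+u. ennreal (\<kappa> u * (1 + L * \<bar>u\<bar>) powr 100) * (\<integral>\<^sup>+x. ennreal (h x powr q * ?w x) \<partial>lborel) \<partial>lborel)"
  proof (rule nn_integral_mono)
    fix u :: real
    have "(\<integral>\<^sup>+x. ennreal (h (x + u *\<^sub>R v) powr q * \<kappa> u * ?w x) \<partial>lborel)
       = (\<integral>\<^sup>+x. ennreal (h x powr q * \<kappa> u * ?w (x - u *\<^sub>R v)) \<partial>lborel)"
      using nn_integral_lborel_shift[of "\<lambda>x. ennreal (h x powr q * \<kappa> u * ?w (x - u *\<^sub>R v))" "u *\<^sub>R v"] by simp
    also have "\<dots> \<le> (\<integral>\<^sup>+x. ennreal (\<kappa> u * (1 + L * \<bar>u\<bar>) powr 100) * ennreal (h x powr q * ?w x) \<partial>lborel)"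
    proof (rule nn_integral_mono)
      fix x
      have "norm (u *\<^sub>R v) \<le> (L * \<bar>u\<bar>) * R"
        using mult_left_mono[OF R(2), of "\<bar>u\<bar>"] by (simp add: mult_ac)
      from ball_weight_shift[OF R(1) this]
      have "h x powr q * \<kappa> u * ?w (x - u *\<^sub>R v) \<le> h x powr q * \<kappa> u * ((1 + L * \<bar>u\<bar>) powr 100 * ?w x)"
        using \<kappa>(2) by (intro mult_left_mono) auto
      also have "\<dots> = (\<kappa> u * (1 + L * \<bar>u\<bar>) powr 100) * (h x powr q * ?w x)" by simp
      finally show "ennreal (h x powr q * \<kappa> u * ?w (x - u *\<^sub>R v))
        \<le> ennreal (\<kappa> u * (1 + L * \<bar>u\<bar>) powr 100) * ennreal (h x powr q * ?w x)"
        using \<kappa>(2) by (simp add: ennreal_leI flip: ennreal_mult')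
    qed
    also have "\<dots> = ennreal (\<kappa> u * (1 + L * \<bar>u\<bar>) powr 100) * (\<integral>\<^sup>+x. ennreal (h x powr q * ?w x) \<partial>lborel)"
      by (rule nn_integral_cmult) measurable
    finally show "(\<integral>\<^sup>+x. ennreal (h (x + u *\<^sub>R v) powr q * \<kappa> u * ?w x) \<partial>lborel) \<le> \<dots>" .
  qed
  also have "\<dots> = (\<integral>\<^sup>+u. ennreal (\<kappa> u * (1 + L * \<bar>u\<bar>) powr 100) \<partial>lborel) * (\<integral>\<^sup>+x. ennreal (h x powr q * ?w x) \<partial>lborel)"
    by (rule nn_integral_multc) measurable
  also have "\<dots> \<le> ennreal M * (\<integral>\<^sup>+x. ennreal (h x powr q * ?w x) \<partial>lborel)"
    by (rule mult_right_mono[OF M(3)]) simp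
  finally have "(\<integral>\<^sup>+x. ennreal (directional_average \<kappa> v h x powr q * ?w x) \<partial>lborel)
    \<le> ennreal (M powr (q - 1)) * (ennreal M * (\<integral>\<^sup>+x. ennreal (h x powr q * ?w x) \<partial>lborel))"
    by (simp add: mult_left_mono)
  also have "\<dots> = ennreal (M powr q) * (\<integral>\<^sup>+x. ennreal (h x powr q * ?w x) \<partial>lborel)"
    using M(1) by (simp add: mult.assoc[symmetric] powr_diff flip: ennreal_mult')
  finally show ?thesis .
qed

section \<open>Smooth frequency localization of the extension operator\<close>

text \<open>
The extension operator over the Borel measure and without a domain: cutoffs are multiplied into \<open>g\<close>. For Borel
\<open>g\<close> all integrands below are jointly measurable in frequency and position, as Fubini's
theorem requires.
\<close>

definition extension_op :: "(real^2 \<Rightarrow> complex) \<Rightarrow> real^3 \<Rightarrow> complex" where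
  "extension_op g x = (LINT \<xi>|lborel. g \<xi> * e_char (paraboloid \<xi> \<bullet> x))"

lemma paraboloid_inner: "paraboloid \<xi> \<bullet> x = \<xi> $ 1 * x $ 1 + \<xi> $ 2 * x $ 2 + ((\<xi> $ 1)\<^sup>2 + (\<xi> $ 2)\<^sup>2) * x $ 3"
  unfolding paraboloid_def by (simp add: inner_vec_def sum_3 norm_vec_def L2_set_def sum_2)

lemma vec_nth_measurable [measurable]: "(\<lambda>x::real^'n. x $ i) \<in> borel_measurable borel"
  by (intro borel_measurable_continuous_onI continuous_intros)

lemma paraboloid_measurable [measurable]: "paraboloid \<in> borel_measurable borel"
  unfolding borel_measurable_euclidean_space[where 'c = "real^3"] paraboloid_inner
  by (intro ballI) measurable

lemma extension_op_measurable [measurable]: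
  assumes [measurable]: "g \<in> borel_measurable borel"
  shows "extension_op g \<in> borel_measurable borel"
  unfolding extension_op_def by measurable

lemma norm_extension_op_le: "norm (extension_op g x) \<le> (LINT \<xi>|lborel. norm (g \<xi>))"
proof -
  have "norm (extension_op g x) \<le> (LINT \<xi>|lborel. norm (g \<xi> * e_char (paraboloid \<xi> \<bullet> x)))"
    unfolding extension_op_def by (rule integral_norm_bound)
  then show ?thesis by (simp add: norm_mult)
qed

lemma integrable_times_bounded:
  fixes f m :: "real^2 \<Rightarrow> complex"
  assumes f: "integrable lborel f" and [measurable]: "m \<in> borel_measurable borel"
    and m: "\<And>\<xi>. norm (m \<xi>) \<le> 1"
  shows "integrable lborel (\<lambda>\<xi>. m \<xi> * f \<xi>)"
proof (rule Bochner_Integration.integrable_bound[OF f])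
  have [measurable]: "f \<in> borel_measurable borel" using f by auto
  show "(\<lambda>\<xi>. m \<xi> * f \<xi>) \<in> borel_measurable lborel" by measurable
  show "AE \<xi> in lborel. norm (m \<xi> * f \<xi>) \<le> norm (f \<xi>)"
    using m by (auto simp: norm_mult intro!: AE_I2 mult_left_le_one_le)
qed

lemma integrable_extension_op:
  assumes f: "integrable lborel f"
  shows "integrable lborel (\<lambda>\<xi>. f \<xi> * e_char (paraboloid \<xi> \<bullet> x))"
  using integrable_times_bounded[OF f, of "\<lambda>\<xi>. e_char (paraboloid \<xi> \<bullet> x)"] by (simp add: mult.commute)

lemma extension_op_sum:
  assumes "finite I" "\<And>i. i \<in> I \<Longrightarrow> integrable lborel (f i)"
  shows "extension_op (\<lambda>\<xi>. \<Sum>i\<in>I. f i \<xi>) x = (\<Sum>i\<in>I. extension_op (f i) x)"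
  unfolding extension_op_def sum_distrib_right
  by (rule Bochner_Integration.integral_sum) (use assms integrable_extension_op in auto)

text \<open>
Writing the spline as a superposition of characters, each character of the linear form
\<open>\<xi> \<mapsto> paraboloid \<xi> \<bullet> v\<close> translates the argument of the extension operator along \<open>v\<close>.
\<close>

lemma spline_multiplier:
  assumes b: "spline_pair m b" and m: "m \<ge> 2" and f: "integrable lborel f"
  shows "extension_op (\<lambda>\<xi>. of_real (b (paraboloid \<xi> \<bullet> v - of_int k)) * f \<xi>) x
    = (LINT u|lborel. extension_op f (x + u *\<^sub>R v) * unit_interval_ft u ^ m * e_char (- of_int k * u))"
proof -
  have [measurable]: "f \<in> borel_measurable borel" using f by auto
  have b_ft: "of_real (b t) = (LINT u|lborel. unit_interval_ft u ^ m * e_char (u * t))" for t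
    using b by (auto simp: spline_pair_def)
  let ?F = "\<lambda>\<xi> u. f \<xi> * e_char (paraboloid \<xi> \<bullet> (x + u *\<^sub>R v)) * (unit_interval_ft u ^ m * e_char (- of_int k * u))"
  have int: "integrable (lborel \<Otimes>\<^sub>M lborel) (case_prod ?F)"
  proof (rule lborel_pair.Fubini_integrable)
    show "case_prod ?F \<in> borel_measurable (lborel \<Otimes>\<^sub>M lborel)" by measurable
    show "integrable lborel (\<lambda>\<xi>. LINT u|lborel. norm (case (\<xi>, u) of (\<xi>, u) \<Rightarrow> ?F \<xi> u))"
      using f by (simp add: norm_mult)
    have "integrable lborel (\<lambda>u. norm (f \<xi>) * norm (unit_interval_ft u ^ m))" for \<xi>
      by (intro integrable_mult_right integrable_norm integrable_unit_interval_ft_power m)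
    then show "AE \<xi> in lborel. integrable lborel (\<lambda>u. case (\<xi>, u) of (\<xi>, u) \<Rightarrow> ?F \<xi> u)"
      by (intro AE_I2, subst integrable_norm_iff[symmetric]) (auto simp: norm_mult)
  qed
  have "(LINT u|lborel. extension_op f (x + u *\<^sub>R v) * unit_interval_ft u ^ m * e_char (- of_int k * u))
      = (LINT u|lborel. LINT \<xi>|lborel. ?F \<xi> u)"
    unfolding extension_op_def mult.assoc[of _ "unit_interval_ft _ ^ _"] integral_mult_left_zero ..
  also have "\<dots> = (LINT \<xi>|lborel. LINT u|lborel. ?F \<xi> u)"
    by (rule lborel_pair.Fubini_integral[OF int])
  also have "\<dots> = extension_op (\<lambda>\<xi>. of_real (b (paraboloid \<xi> \<bullet> v - of_int k)) * f \<xi>) x"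
    unfolding extension_op_def
  proof (intro Bochner_Integration.integral_cong refl)
    fix \<xi>
    have "?F \<xi> u = (f \<xi> * e_char (paraboloid \<xi> \<bullet> x)) * (unit_interval_ft u ^ m * e_char (u * (paraboloid \<xi> \<bullet> v - of_int k)))" for u
    proof -
      have "e_char (paraboloid \<xi> \<bullet> (x + u *\<^sub>R v)) * e_char (- of_int k * u)
         = e_char (paraboloid \<xi> \<bullet> x) * e_char (u * (paraboloid \<xi> \<bullet> v - of_int k))"
        unfolding e_char_add[symmetric] by (simp add: inner_add_right algebra_simps)
      then show ?thesis by (simp add: mult_ac)
    qed
    then have "(LINT u|lborel. ?F \<xi> u) = (LINT u|lborel. (f \<xi> * e_char (paraboloid \<xi> \<bullet> x)) *
        (unit_interval_ft u ^ m * e_char (u * (paraboloid \<xi> \<bullet> v - of_int k))))"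
      by (intro Bochner_Integration.integral_cong refl)
    also have "\<dots> = (f \<xi> * e_char (paraboloid \<xi> \<bullet> x)) * of_real (b (paraboloid \<xi> \<bullet> v - of_int k))"
      by (simp only: integral_mult_right_zero b_ft)
    finally show "(LINT u|lborel. ?F \<xi> u) = of_real (b (paraboloid \<xi> \<bullet> v - of_int k)) * f \<xi> * e_char (paraboloid \<xi> \<bullet> x)"
      by (simp only: mult_ac)
  qed
  finally show ?thesis ..
qed

lemma spline_bessel:
  assumes b: "spline_pair m b" and m: "m \<ge> 2"
  shows "\<exists>D>0. \<forall>f K v x. integrable lborel f \<and> finite K \<longrightarrow>
    (\<Sum>k\<in>K. (norm (extension_op (\<lambda>\<xi>. of_real (b (paraboloid \<xi> \<bullet> v - of_int k)) * f \<xi>) x))\<^sup>2)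
     \<le> D * directional_average (\<lambda>u. norm (unit_interval_ft u ^ m)) v (\<lambda>x. (norm (extension_op f x))\<^sup>2) x"
proof -
  from bessel_inequality[OF _ norm_unit_interval_ft_power[OF m]] obtain D where D: "D > 0"
    "\<And>h K. h \<in> borel_measurable borel \<Longrightarrow> bounded (range h) \<Longrightarrow> finite K \<Longrightarrow>
     (\<Sum>k\<in>K. (norm (LINT u|lborel. h u * unit_interval_ft u ^ m * e_char (- of_int k * u)))\<^sup>2)
       \<le> D * (LINT u|lborel. (norm (h u))\<^sup>2 * norm (unit_interval_ft u ^ m))"
    by auto
  show ?thesis
  proof (intro exI[of _ D] conjI allI impI D(1))
    fix f :: "real^2 \<Rightarrow> complex" and K :: "int set" and v x :: "real^3"
    assume fK: "integrable lborel f \<and> finite K"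
    then have [measurable]: "f \<in> borel_measurable borel" by auto
    show "(\<Sum>k\<in>K. (norm (extension_op (\<lambda>\<xi>. of_real (b (paraboloid \<xi> \<bullet> v - of_int k)) * f \<xi>) x))\<^sup>2)
     \<le> D * directional_average (\<lambda>u. norm (unit_interval_ft u ^ m)) v (\<lambda>x. (norm (extension_op f x))\<^sup>2) x"
      unfolding spline_multiplier[OF b m conjunct1[OF fK]] directional_average_def
      by (rule D(2)) (use fK norm_extension_op_le[of f] in \<open>auto simp: bounded_iff\<close>)
  qed
qed

definition spline_tensor :: "(real \<Rightarrow> real) \<Rightarrow> real \<Rightarrow> int \<times> int \<Rightarrow> real^2 \<Rightarrow> complex" where
  "spline_tensor b s k \<xi> = of_real (b (s * \<xi> $ 1 - of_int (fst k)) * b (s * \<xi> $ 2 - of_int (snd k)))"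

lemma integrable_along_line:
  fixes h :: "real^3 \<Rightarrow> real"
  assumes "integrable lborel \<kappa>" "\<And>u. 0 \<le> \<kappa> u" and [measurable]: "h \<in> borel_measurable borel"
    "\<And>x. \<bar>h x\<bar> \<le> B"
  shows "integrable lborel (\<lambda>u. h (x + u *\<^sub>R v) * \<kappa> u)"
  using assms by (intro integrable_bounded_mult[where B = B]) auto

lemma directional_average_mono:
  fixes h h' :: "real^3 \<Rightarrow> real"
  assumes \<kappa>: "integrable lborel \<kappa>" "\<And>u. 0 \<le> \<kappa> u"
    and h: "h \<in> borel_measurable borel" "h' \<in> borel_measurable borel"
      "\<And>x. \<bar>h x\<bar> \<le> B" "\<And>x. \<bar>h' x\<bar> \<le> B" "\<And>x. h x \<le> h' x"
  shows "directional_average \<kappa> v h x \<le> directional_average \<kappa> v h' x"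
  unfolding directional_average_def
  using assms by (intro integral_mono integrable_along_line[where B = B] mult_right_mono) auto

text \<open>
The one-dimensional inequality is used first in the first coordinate, for each value of the second index, and
then in the second coordinate under the average along the first axis.
\<close>

lemma spline_tensor_bessel:
  assumes b: "spline_pair m b" and m: "m \<ge> 2"
  defines "\<kappa> \<equiv> \<lambda>u. norm (unit_interval_ft u ^ m)"
  shows "\<exists>D>0. \<forall>f K s x. integrable lborel f \<and> finite K \<longrightarrow>
    (\<Sum>k\<in>K. (norm (extension_op (\<lambda>\<xi>. spline_tensor b s k \<xi> * f \<xi>) x))\<^sup>2)
     \<le> D * directional_average \<kappa> (s *\<^sub>R axis 1 1) (directional_average \<kappa> (s *\<^sub>R axis 2 1) (\<lambda>x. (norm (extension_op f x))\<^sup>2)) x"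
proof -
  obtain D where D: "D > 0"
    "\<And>f K v x. integrable lborel f \<Longrightarrow> finite K \<Longrightarrow>
    (\<Sum>k\<in>K. (norm (extension_op (\<lambda>\<xi>. of_real (b (paraboloid \<xi> \<bullet> v - of_int k)) * f \<xi>) x))\<^sup>2)
     \<le> D * directional_average \<kappa> v (\<lambda>x. (norm (extension_op f x))\<^sup>2) x"
    using spline_bessel[OF b m] unfolding \<kappa>_def by blast
  have b01: "\<And>t. 0 \<le> b t" "\<And>t. b t \<le> 1" and [measurable]: "b \<in> borel_measurable borel"
    using b by (auto simp: spline_pair_def)
  have \<kappa>: "integrable lborel \<kappa>" "\<And>u. 0 \<le> \<kappa> u"
    unfolding \<kappa>_def using m by (auto intro!: integrable_norm integrable_unit_interval_ft_power)
  have [measurable]: "\<kappa> \<in> borel_measurable borel" unfolding \<kappa>_def by measurable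
  define I where "I = (LINT u|lborel. \<kappa> u)"
  have I0: "I \<ge> 0" unfolding I_def using \<kappa> by simp
  show ?thesis
  proof (intro exI[of _ "D * D"] conjI allI impI)
    fix f :: "real^2 \<Rightarrow> complex" and K :: "(int \<times> int) set" and s :: real and x :: "real^3"
    assume fK: "integrable lborel f \<and> finite K"
    then have f: "integrable lborel f" and fin: "finite K" and [measurable]: "f \<in> borel_measurable borel" by auto
    let ?v1 = "s *\<^sub>R axis 1 1 :: real^3" and ?v2 = "s *\<^sub>R axis 2 1 :: real^3"
    let ?K1 = "fst ` K" and ?K2 = "snd ` K"
    define f2 where "f2 k2 = (\<lambda>\<xi>. of_real (b (paraboloid \<xi> \<bullet> ?v2 - of_int k2)) * f \<xi>)" for k2
    have f2: "integrable lborel (f2 k2)" for k2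
      unfolding f2_def by (rule integrable_times_bounded[OF f]) (use b01 in \<open>auto\<close>)
    have [measurable]: "f2 k2 \<in> borel_measurable borel" for k2 unfolding f2_def by measurable
    define B where "B = (LINT \<xi>|lborel. norm (f \<xi>))"
    have f2_le: "norm (extension_op (f2 k2) x) \<le> B" for k2 x
    proof (rule order_trans[OF norm_extension_op_le], unfold B_def, rule integral_mono)
      show "norm (f2 k2 \<xi>) \<le> norm (f \<xi>)" for \<xi>
        using b01 by (auto simp: f2_def norm_mult intro!: mult_left_le_one_le)
    qed (use f2 f in auto)
    have f_le: "norm (extension_op f x) \<le> B" for x
      unfolding B_def by (rule norm_extension_op_le)
    have B0: "B \<ge> 0" using order_trans[OF norm_ge_zero f_le] .
    have par: "paraboloid \<xi> \<bullet> ?v1 = s * \<xi> $ 1" "paraboloid \<xi> \<bullet> ?v2 = s * \<xi> $ 2" for \<xi>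
      unfolding paraboloid_inner by (auto simp: axis_def)
    have "(\<Sum>k\<in>K. (norm (extension_op (\<lambda>\<xi>. spline_tensor b s k \<xi> * f \<xi>) x))\<^sup>2)
       \<le> (\<Sum>k\<in>?K1 \<times> ?K2. (norm (extension_op (\<lambda>\<xi>. spline_tensor b s k \<xi> * f \<xi>) x))\<^sup>2)"
      using fin by (intro sum_mono2) force+
    also have "\<dots> = (\<Sum>k2\<in>?K2. \<Sum>k1\<in>?K1. (norm (extension_op (\<lambda>\<xi>. of_real (b (paraboloid \<xi> \<bullet> ?v1 - of_int k1)) * f2 k2 \<xi>) x))\<^sup>2)"
    proof -
      have "(\<Sum>k\<in>?K1 \<times> ?K2. g k) = (\<Sum>k2\<in>?K2. \<Sum>k1\<in>?K1. g (k1, k2))" for g :: "int \<times> int \<Rightarrow> real"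
        by (subst sum.swap) (simp add: sum.cartesian_product)
      then show ?thesis
        by (simp only: par f2_def spline_tensor_def fst_conv snd_conv of_real_mult mult.assoc)
    qed
    also have "\<dots> \<le> (\<Sum>k2\<in>?K2. D * directional_average \<kappa> ?v1 (\<lambda>x. (norm (extension_op (f2 k2) x))\<^sup>2) x)"
      using fin by (intro sum_mono D(2) f2) auto
    also have "\<dots> = D * directional_average \<kappa> ?v1 (\<lambda>x. \<Sum>k2\<in>?K2. (norm (extension_op (f2 k2) x))\<^sup>2) x"
      unfolding directional_average_def sum_distrib_right sum_distrib_left[symmetric]
    proof (subst Bochner_Integration.integral_sum)
      show "integrable lborel (\<lambda>u. (norm (extension_op (f2 k2) (x + u *\<^sub>R ?v1)))\<^sup>2 * \<kappa> u)" for k2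
        using f2_le
        by (intro integrable_along_line[OF \<kappa>, where B = "B\<^sup>2" and h = "\<lambda>x. (norm (extension_op (f2 k2) x))\<^sup>2"])
           (auto intro!: power_mono)
    qed simp
    also have "\<dots> \<le> D * directional_average \<kappa> ?v1 (\<lambda>x. D * directional_average \<kappa> ?v2 (\<lambda>x. (norm (extension_op f x))\<^sup>2) x) x"
    proof (intro mult_left_mono)
      let ?h = "\<lambda>x. \<Sum>k2\<in>?K2. (norm (extension_op (f2 k2) x))\<^sup>2"
      let ?h' = "\<lambda>x. D * directional_average \<kappa> ?v2 (\<lambda>x. (norm (extension_op f x))\<^sup>2) x"
      have le: "?h x \<le> ?h' x" for x
        unfolding f2_def using fin by (intro D(2) f) auto
      have h0: "0 \<le> ?h x" for x by (intro sum_nonneg) auto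
      have "directional_average \<kappa> ?v2 (\<lambda>x. (norm (extension_op f x))\<^sup>2) x \<le> B\<^sup>2 * I" for x
        unfolding I_def using f_le by (intro directional_average_bounds \<kappa>) (auto intro: power_mono)
      then have h': "?h' x \<le> D * (B\<^sup>2 * I)" for x using D(1) by (intro mult_left_mono) auto
      show "directional_average \<kappa> ?v1 ?h x \<le> directional_average \<kappa> ?v1 ?h' x"
      proof (rule directional_average_mono[OF \<kappa>, where B = "D * (B\<^sup>2 * I)"])
        show "\<bar>?h x\<bar> \<le> D * (B\<^sup>2 * I)" for x
          using h0[of x] order_trans[OF le h', of x] by simp
        show "\<bar>?h' x\<bar> \<le> D * (B\<^sup>2 * I)" for x
          using order_trans[OF h0 le, of x] h'[of x] by (simp only: abs_of_nonneg)
      qed (use le in measurable)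
    qed (use D in auto)
    also have "\<dots> = D * D * directional_average \<kappa> ?v1 (directional_average \<kappa> ?v2 (\<lambda>x. (norm (extension_op f x))\<^sup>2)) x"
      by (simp add: directional_average_def mult.assoc)
    finally show "(\<Sum>k\<in>K. (norm (extension_op (\<lambda>\<xi>. spline_tensor b s k \<xi> * f \<xi>) x))\<^sup>2) \<le> \<dots>" .
  qed (use D in auto)
qed

text \<open>
Order \<open>102\<close> makes the kernel \<open>O((1 + u\<^sup>2)\<^bsup>-51\<^esup>)\<close>. The growth of the weight takes \<open>50\<close> of these powers
and the remaining one is integrable.
\<close>

lemma kernel_weighted_integrable:
  assumes "L \<ge> 0"
  shows "\<exists>M>0. (LINT u|lborel. norm (unit_interval_ft u ^ 102)) \<le> M \<and>
    (\<integral>\<^sup>+u. ennreal (norm (unit_interval_ft u ^ 102) * (1 + L * \<bar>u\<bar>) powr 100) \<partial>lborel) \<le> ennreal M"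
proof -
  let ?\<kappa> = "\<lambda>u. norm (unit_interval_ft u ^ 102)"
  define A where "A = 2 ^ 51 * (1 + L\<^sup>2) ^ 50"
  have A0: "A \<ge> 0" by (simp add: A_def)
  have key: "?\<kappa> u * (1 + L * \<bar>u\<bar>) powr 100 \<le> A * cauchy_density u" for u
  proof -
    have pos: "1 + L * \<bar>u\<bar> > 0" using assms by (simp add: add_pos_nonneg)
    have "(1 + L * \<bar>u\<bar>)\<^sup>2 \<le> (1 + L\<^sup>2) * (1 + u\<^sup>2)"
      using zero_le_power2[of "L - \<bar>u\<bar>"] by (simp add: power2_eq_square algebra_simps)
    then have "((1 + L * \<bar>u\<bar>)\<^sup>2) ^ 50 \<le> ((1 + L\<^sup>2) * (1 + u\<^sup>2)) ^ 50"
      by (intro power_mono) auto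
    then have w: "(1 + L * \<bar>u\<bar>) powr 100 \<le> (1 + L\<^sup>2) ^ 50 * (1 + u\<^sup>2) ^ 50"
      using pos by (simp add: power_mult[symmetric] power_mult_distrib)
    have k: "?\<kappa> u \<le> 2 ^ 51 * (1 / (1 + u\<^sup>2)) ^ 51"
      using norm_unit_interval_ft_even_power[of u 51] by (simp add: cauchy_density_def)
    have "?\<kappa> u * (1 + L * \<bar>u\<bar>) powr 100
       \<le> (2 ^ 51 * (1 / (1 + u\<^sup>2)) ^ 51) * ((1 + L\<^sup>2) ^ 50 * (1 + u\<^sup>2) ^ 50)"
      using k w by (intro mult_mono) auto
    also have "\<dots> = A * ((1 / (1 + u\<^sup>2)) ^ 51 * (1 + u\<^sup>2) ^ 50)"
      by (simp only: A_def mult_ac)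
    also have "(1 / (1 + u\<^sup>2)) ^ 51 * (1 + u\<^sup>2) ^ 50 = cauchy_density u"
    proof -
      have "1 + u\<^sup>2 \<noteq> 0" using zero_le_power2[of u] by linarith
      moreover have "(1 / y) ^ 51 * y ^ 50 = 1 / y" if "y \<noteq> 0" for y :: real
      proof -
        have "(1 / y) ^ 51 * y ^ 50 = (1 / y) * ((1 / y) ^ 50 * y ^ 50)"
          using power_add[of "1 / y" 1 50] by simp
        also have "(1 / y) ^ 50 * y ^ 50 = 1"
          using that by (simp only: power_mult_distrib[symmetric]) simp
        finally show ?thesis by simp
      qed
      ultimately show ?thesis by (simp add: cauchy_density_def)
    qed
    finally show ?thesis .
  qed
  define J where "J = (LINT u|lborel. A * cauchy_density u)"
  define I where "I = (LINT u|lborel. ?\<kappa> u)"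
  have J0: "J \<ge> 0" unfolding J_def using A0
    by (intro Bochner_Integration.integral_nonneg) (auto simp: cauchy_density_pos less_imp_le)
  have I0: "I \<ge> 0" unfolding I_def by simp
  have "(\<integral>\<^sup>+u. ennreal (?\<kappa> u * (1 + L * \<bar>u\<bar>) powr 100) \<partial>lborel) \<le> (\<integral>\<^sup>+u. ennreal (A * cauchy_density u) \<partial>lborel)"
    by (intro nn_integral_mono ennreal_leI key)
  also have "\<dots> = ennreal J"
    unfolding J_def using A0 by (intro nn_integral_eq_integral integrable_mult_right integrable_cauchy_density)
      (auto simp: cauchy_density_pos less_imp_le)
  also have "\<dots> \<le> ennreal (I + J + 1)"
    using I0 by (intro ennreal_leI) simp
  finally show ?thesis
    using I0 J0 by (intro exI[of _ "I + J + 1"]) (auto simp flip: I_def)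
qed

text \<open>
The square function estimate for smooth pieces: pointwise Bessel, then Minkowski over \<open>i\<close>, then the
boundedness of the two successive averages. The bound \<open>|s| \<le> L R\<close> says that the averages act
at a scale not exceeding the radius of the ball.
\<close>

lemma spline_square_function_weighted:
  assumes b: "spline_pair 102 b" and L: "L \<ge> 0" and q: "q \<ge> 1"
  shows "\<exists>C>0. \<forall>(I :: nat set) f N K s R c. finite I \<and> I \<noteq> {} \<and> finite K \<and>
      R > 0 \<and> \<bar>s\<bar> \<le> L * R \<and>
      (\<forall>i\<in>I. integrable lborel (f i) \<and> 0 \<le> N i \<and>
        (\<integral>\<^sup>+x. ennreal ((norm (extension_op (f i) x))\<^sup>2 powr q * ball_weight c R x) \<partial>lborel) \<le> ennreal (N i powr q)) \<longrightarrow>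
     (\<integral>\<^sup>+x. ennreal ((\<Sum>i\<in>I. \<Sum>k\<in>K. (norm (extension_op (\<lambda>\<xi>. spline_tensor b s k \<xi> * f i \<xi>) x))\<^sup>2) powr q
        * ball_weight c R x) \<partial>lborel) \<le> ennreal ((C * (\<Sum>i\<in>I. N i)) powr q)"
proof -
  let ?\<kappa> = "\<lambda>u. norm (unit_interval_ft u ^ 102)"
  obtain D where D: "D > 0" "\<And>f K s x. integrable lborel f \<Longrightarrow> finite K \<Longrightarrow>
    (\<Sum>k\<in>K. (norm (extension_op (\<lambda>\<xi>. spline_tensor b s k \<xi> * f \<xi>) x))\<^sup>2)
     \<le> D * directional_average ?\<kappa> (s *\<^sub>R axis 1 1) (directional_average ?\<kappa> (s *\<^sub>R axis 2 1) (\<lambda>x. (norm (extension_op f x))\<^sup>2)) x"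
    using spline_tensor_bessel[OF b] by auto
  obtain M where M: "M > 0" "(LINT u|lborel. ?\<kappa> u) \<le> M"
    "(\<integral>\<^sup>+u. ennreal (?\<kappa> u * (1 + L * \<bar>u\<bar>) powr 100) \<partial>lborel) \<le> ennreal M"
    using kernel_weighted_integrable[OF L] by blast
  have \<kappa>: "integrable lborel ?\<kappa>" "\<And>u. 0 \<le> ?\<kappa> u"
    by (auto intro!: integrable_norm integrable_unit_interval_ft_power)
  show ?thesis
  proof (intro exI[of _ "D * M * M"] conjI allI impI)
    show "D * M * M > 0" using D M by simp
    fix I :: "nat set" and f N and K :: "(int \<times> int) set" and s R :: real and c :: "real^3"
    assume *: "finite I \<and> I \<noteq> {} \<and> finite K \<and> R > 0 \<and> \<bar>s\<bar> \<le> L * R \<and>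
      (\<forall>i\<in>I. integrable lborel (f i) \<and> 0 \<le> N i \<and>
        (\<integral>\<^sup>+x. ennreal ((norm (extension_op (f i) x))\<^sup>2 powr q * ball_weight c R x) \<partial>lborel) \<le> ennreal (N i powr q))"
    then have I: "finite I" "I \<noteq> {}" and K: "finite K" and R: "R > 0" and s: "\<bar>s\<bar> \<le> L * R"
      and f: "\<And>i. i \<in> I \<Longrightarrow> integrable lborel (f i)" and N: "\<And>i. i \<in> I \<Longrightarrow> 0 \<le> N i"
      and fN: "\<And>i. i \<in> I \<Longrightarrow> (\<integral>\<^sup>+x. ennreal ((norm (extension_op (f i) x))\<^sup>2 powr q * ball_weight c R x) \<partial>lborel) \<le> ennreal (N i powr q)"
      by auto
    let ?v1 = "s *\<^sub>R axis 1 1 :: real^3" and ?v2 = "s *\<^sub>R axis 2 1 :: real^3"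
    have v: "norm ?v1 \<le> L * R" "norm ?v2 \<le> L * R" using s by auto
    define h where "h i = (\<lambda>x. (norm (extension_op (f i) x))\<^sup>2)" for i
    define B where "B i = (LINT \<xi>|lborel. norm (f i \<xi>))\<^sup>2" for i
    have h: "h i \<in> borel_measurable borel" "0 \<le> h i x" "h i x \<le> B i" if "i \<in> I" for i x
    proof -
      have [measurable]: "f i \<in> borel_measurable borel" using f[OF that] by auto
      show "h i \<in> borel_measurable borel" unfolding h_def by measurable
      show "0 \<le> h i x" "h i x \<le> B i" unfolding h_def B_def
        by (auto intro!: power_mono norm_extension_op_le)
    qed
    define h2 where "h2 i = directional_average ?\<kappa> ?v2 (h i)" for i
    have h2: "h2 i \<in> borel_measurable borel" "0 \<le> h2 i x" "h2 i x \<le> B i * (LINT u|lborel. ?\<kappa> u)" if "i \<in> I" for i x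
      unfolding h2_def using h[OF that] \<kappa> directional_average_bounds[OF \<kappa> h[OF that]] by auto
    define H where "H i = directional_average ?\<kappa> ?v1 (h2 i)" for i
    have H: "H i \<in> borel_measurable borel" "0 \<le> H i x" if "i \<in> I" for i x
      unfolding H_def using h2[OF that] \<kappa> directional_average_bounds[OF \<kappa> h2[OF that]] by auto
    have "(\<integral>\<^sup>+x. ennreal ((\<Sum>i\<in>I. \<Sum>k\<in>K. (norm (extension_op (\<lambda>\<xi>. spline_tensor b s k \<xi> * f i \<xi>) x))\<^sup>2) powr q
        * ball_weight c R x) \<partial>lborel)
      \<le> (\<integral>\<^sup>+x. ennreal ((\<Sum>i\<in>I. D * H i x) powr q * ball_weight c R x) \<partial>lborel)"
    proof (intro nn_integral_mono ennreal_leI mult_right_mono powr_mono2 sum_mono)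
      show "(\<Sum>k\<in>K. (norm (extension_op (\<lambda>\<xi>. spline_tensor b s k \<xi> * f i \<xi>) x))\<^sup>2) \<le> D * H i x" if "i \<in> I" for i x
        unfolding H_def h2_def h_def by (intro D(2) f K that)
    qed (use q in \<open>auto intro!: sum_nonneg\<close>)
    also have "\<dots> \<le> ennreal ((\<Sum>i\<in>I. D * M * M * N i) powr q)"
    proof (rule minkowski_finite_sum[OF I q])
      fix i assume i: "i \<in> I"
      note hm [measurable] = h(1)[OF i] h2(1)[OF i] H(1)[OF i]
      have Hq: "(D * H i x) powr q * ball_weight c R x = D powr q * (H i x powr q * ball_weight c R x)" for x
        using D H[OF i] by (simp add: powr_mult)
      have "(\<integral>\<^sup>+x. ennreal ((D * H i x) powr q * ball_weight c R x) \<partial>lborel)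
         = ennreal (D powr q) * (\<integral>\<^sup>+x. ennreal (H i x powr q * ball_weight c R x) \<partial>lborel)"
        unfolding Hq by (subst nn_integral_cmult[symmetric]) (auto simp: ennreal_mult')
      also have "\<dots> \<le> ennreal (D powr q) * (ennreal (M powr q) * (\<integral>\<^sup>+x. ennreal (h2 i x powr q * ball_weight c R x) \<partial>lborel))"
        unfolding H_def
        by (intro mult_left_mono directional_average_weighted[OF q M \<kappa> h2[OF i] R v(1)]) auto
      also have "\<dots> \<le> ennreal (D powr q) * (ennreal (M powr q) * (ennreal (M powr q) * (\<integral>\<^sup>+x. ennreal (h i x powr q * ball_weight c R x) \<partial>lborel)))"
        unfolding h2_def
        by (intro mult_left_mono directional_average_weighted[OF q M \<kappa> h[OF i] R v(2)]) auto
      also have "\<dots> \<le> ennreal (D powr q) * (ennreal (M powr q) * (ennreal (M powr q) * ennreal (N i powr q)))"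
        unfolding h_def by (intro mult_left_mono fN i) auto
      also have "\<dots> = ennreal ((D * M * M * N i) powr q)"
        using D M N[OF i] by (simp add: powr_mult ennreal_mult' mult.assoc)
      finally show "(\<integral>\<^sup>+x. ennreal ((D * H i x) powr q * ball_weight c R x) \<partial>lborel) \<le> ennreal ((D * M * M * N i) powr q)" .
      show "(\<lambda>x. D * H i x) \<in> borel_measurable lborel" by measurable
      show "0 \<le> D * M * M * N i" using D M N[OF i] by simp
      show "0 \<le> D * H i x" for x using D H[OF i] by simp
    qed auto
    finally show "(\<integral>\<^sup>+x. ennreal ((\<Sum>i\<in>I. \<Sum>k\<in>K. (norm (extension_op (\<lambda>\<xi>. spline_tensor b s k \<xi> * f i \<xi>) x))\<^sup>2) powr q
        * ball_weight c R x) \<partial>lborel) \<le> ennreal ((D * M * M * (\<Sum>i\<in>I. N i)) powr q)"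
      by (simp add: sum_distrib_left)
  qed
qed

section \<open>Norms as nonnegative integrals and grid squares\<close>

text \<open>
The weight is dominated by a product of three one-dimensional Cauchy densities.
\<close>

lemma integrable_ball_weight:
  assumes R: "R > 0"
  shows "integrable lborel (ball_weight c R)"
proof (rule integrableI_nonneg)
  let ?g = "\<lambda>t::real. 1 / (1 + (t / R)\<^sup>2)"
  have g0: "0 \<le> ?g t" for t by (simp add: add_nonneg_nonneg)
  have "(\<integral>\<^sup>+x. ennreal (ball_weight c R x) \<partial>lborel) = (\<integral>\<^sup>+x. ennreal (ball_weight c R (x + c)) \<partial>lborel)"
    using nn_integral_lborel_shift[of "\<lambda>x. ennreal (ball_weight c R x)" c] by simp
  also have "\<dots> \<le> (\<integral>\<^sup>+(x::real^3). (\<Prod>b\<in>Basis. ennreal (?g (x \<bullet> b))) \<partial>lborel)"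
  proof (rule nn_integral_mono)
    fix x :: "real^3"
    let ?y = "1 + norm x / R"
    have y1: "?y \<ge> 1" using R by simp
    have "(\<Prod>b\<in>(Basis :: (real^3) set). 1 + ((x \<bullet> b) / R)\<^sup>2) \<le> (\<Prod>b\<in>(Basis :: (real^3) set). ?y\<^sup>2)"
    proof (rule prod_mono, intro conjI)
      fix b :: "real^3" assume b: "b \<in> Basis"
      show "0 \<le> 1 + ((x \<bullet> b) / R)\<^sup>2" by (simp add: add_nonneg_nonneg)
      have "\<bar>x \<bullet> b\<bar> / R \<le> norm x / R"
        using R b by (intro divide_right_mono) (auto simp: Basis_le_norm)
      then have "(\<bar>x \<bullet> b\<bar> / R)\<^sup>2 \<le> (norm x / R)\<^sup>2"
        using R by (intro power_mono) auto
      then show "1 + ((x \<bullet> b) / R)\<^sup>2 \<le> ?y\<^sup>2"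
        using R by (simp add: power_divide power2_sum add_increasing2)
    qed
    also have "\<dots> = ?y ^ 6"
      by (simp flip: power_mult)
    also have "\<dots> = ?y powr 6" using y1 powr_realpow[of ?y 6] by simp
    also have "\<dots> \<le> ?y powr 100" using y1 by (intro powr_mono) auto
    finally have le: "(\<Prod>b\<in>(Basis :: (real^3) set). 1 + ((x \<bullet> b) / R)\<^sup>2) \<le> ?y powr 100" .
    have pos: "(\<Prod>b\<in>(Basis :: (real^3) set). 1 + ((x \<bullet> b) / R)\<^sup>2) > 0"
      by (intro prod_pos) (auto simp: add_pos_nonneg)
    have "ball_weight c R (x + c) = inverse (?y powr 100)"
      by (simp add: ball_weight_def powr_minus del: powr_numeral)
    also have "\<dots> \<le> inverse (\<Prod>b\<in>(Basis :: (real^3) set). 1 + ((x \<bullet> b) / R)\<^sup>2)"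
      by (rule le_imp_inverse_le[OF le pos])
    also have "\<dots> = (\<Prod>b\<in>(Basis :: (real^3) set). ?g (x \<bullet> b))"
      by (simp add: prod_dividef inverse_eq_divide)
    finally have "ennreal (ball_weight c R (x + c)) \<le> ennreal (\<Prod>b\<in>(Basis :: (real^3) set). ?g (x \<bullet> b))"
      by (rule ennreal_leI)
    then show "ennreal (ball_weight c R (x + c)) \<le> (\<Prod>b\<in>Basis. ennreal (?g (x \<bullet> b)))"
      using g0 by (subst prod_ennreal) auto
  qed
  also have "\<dots> = (\<Prod>b\<in>(Basis :: (real^3) set). \<integral>\<^sup>+t. ennreal (?g t) \<partial>lborel)"
    by (rule nn_integral_lborel_prod) auto
  also have "\<dots> < \<infinity>"
  proof -
    have "integrable lborel ?g"
      using lborel_integrable_real_affine[OF integrable_cauchy_density, of "1 / R" 0] R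
      by (simp add: cauchy_density_def)
    then have "(\<integral>\<^sup>+t. ennreal (?g t) \<partial>lborel) = ennreal (LINT t|lborel. ?g t)"
      by (rule nn_integral_eq_integral) (use g0 in auto)
    then show ?thesis by (simp add: power_less_top_ennreal)
  qed
  finally show "(\<integral>\<^sup>+x. ennreal (ball_weight c R x) \<partial>lborel) < \<infinity>" .
qed auto

lemma Lp_norm_weighted_eq_nn_integral:
  fixes f :: "real^3 \<Rightarrow> 'b::real_normed_vector"
  assumes [measurable]: "(\<lambda>x. norm (f x)) \<in> borel_measurable borel" and B: "\<And>x. norm (f x) \<le> B"
    and p: "p > 0" and R: "R > 0"
  shows "(\<integral>\<^sup>+x. ennreal (norm (f x) powr p * ball_weight c R x) \<partial>lborel)
    = ennreal (Lp_norm_weighted p (ball_weight c R) f powr p)"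
proof -
  have "integrable lborel (\<lambda>x. norm (f x) powr p * ball_weight c R x)"
  proof (rule Bochner_Integration.integrable_bound)
    show "integrable lborel (\<lambda>x. B powr p * ball_weight c R x)"
      by (intro integrable_mult_right integrable_ball_weight R)
    show "AE x in lborel. norm (norm (f x) powr p * ball_weight c R x) \<le> norm (B powr p * ball_weight c R x)"
      using B p by (auto simp: abs_mult intro!: AE_I2 mult_right_mono powr_mono2)
  qed measurable
  then have "(\<integral>\<^sup>+x. ennreal (norm (f x) powr p * ball_weight c R x) \<partial>lborel)
      = ennreal (LINT x|lborel. norm (f x) powr p * ball_weight c R x)"
    by (rule nn_integral_eq_integral) auto
  then show ?thesis
    using p by (simp add: Lp_norm_weighted_def powr_powr)
qed

lemma Lp_norm_on_eq_nn_integral: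
  fixes f :: "real^3 \<Rightarrow> 'b::real_normed_vector"
  assumes [measurable]: "(\<lambda>x. norm (f x)) \<in> borel_measurable borel" and B: "\<And>x. norm (f x) \<le> B"
    and p: "p > 0"
  shows "(\<integral>\<^sup>+x. indicator (cball c R) x * ennreal (norm (f x) powr p) \<partial>lborel)
    = ennreal (Lp_norm_on p (cball c R) f powr p)"
proof -
  have "integrable lborel (\<lambda>x. indicator (cball c R) x *\<^sub>R (norm (f x) powr p))"
    by (rule integrableI_bounded_set_indicator[where B = "B powr p"])
       (use B p emeasure_bounded_finite[OF bounded_cball, of c R] in \<open>auto intro!: powr_mono2\<close>)
  then have "(\<integral>\<^sup>+x. ennreal (indicator (cball c R) x *\<^sub>R (norm (f x) powr p)) \<partial>lborel)
      = ennreal (LINT x:cball c R|lborel. norm (f x) powr p)"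
    unfolding set_lebesgue_integral_def by (rule nn_integral_eq_integral) auto
  moreover have "ennreal (indicator (cball c R) x *\<^sub>R (norm (f x) powr p)) = indicator (cball c R) x * ennreal (norm (f x) powr p)" for x
    by (simp add: indicator_def)
  moreover have "(LINT x:cball c R|lborel. norm (f x) powr p) \<ge> 0"
    unfolding set_lebesgue_integral_def by (intro Bochner_Integration.integral_nonneg) auto
  ultimately show ?thesis
    using p by (simp add: Lp_norm_on_def powr_powr)
qed

lemma grid_square_eq_cbox:
  "grid_square R j i = cbox (vector [of_int j / sqrt R, of_int i / sqrt R])
     (vector [(of_int j + 1) / sqrt R, (of_int i + 1) / sqrt R])"
  by (auto simp: grid_square_def mem_box_cart forall_2)

lemma grid_square_measurable [measurable]: "grid_square R j i \<in> sets borel"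
  by (simp add: grid_square_eq_cbox)

lemma unit_square_eq_cbox: "unit_square = cbox 0 1"
  by (auto simp: unit_square_def mem_box_cart)

lemma unit_square_measurable [measurable]: "unit_square \<in> sets borel"
  by (simp add: unit_square_eq_cbox)

lemma grid_square_not_negligible:
  assumes "R > 0"
  shows "\<not> negligible (grid_square R j i)"
proof -
  have "(vector [of_int j / sqrt R, of_int i / sqrt R] :: real^2) $ k
      < (vector [(of_int j + 1) / sqrt R, (of_int i + 1) / sqrt R] :: real^2) $ k" for k
    using assms exhaust_2[of k] by (auto simp: divide_strict_right_mono)
  then show ?thesis
    unfolding grid_square_eq_cbox negligible_interval interval_eq_empty_cart
    by (simp add: not_le)
qed

lemma grid_square_subset_unit_square_iff:
  assumes r: "sqrt R = real r" "r \<ge> 1"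
  shows "grid_square R j i \<subseteq> unit_square \<longleftrightarrow> 0 \<le> j \<and> j < int r \<and> 0 \<le> i \<and> i < int r"
proof
  assume sub: "grid_square R j i \<subseteq> unit_square"
  have "vector [of_int j / real r, of_int i / real r] \<in> grid_square R j i"
    "vector [(of_int j + 1) / real r, (of_int i + 1) / real r] \<in> grid_square R j i"
    using r by (auto simp: grid_square_def divide_right_mono)
  with sub have "0 \<le> of_int j / real r" "0 \<le> of_int i / real r" "(of_int j + 1) / real r \<le> 1" "(of_int i + 1) / real r \<le> 1"
    by (auto simp: unit_square_def subset_iff forall_2)
  with r show "0 \<le> j \<and> j < int r \<and> 0 \<le> i \<and> i < int r"
    by (auto simp: zero_le_divide_iff divide_le_eq)
next
  assume ji: "0 \<le> j \<and> j < int r \<and> 0 \<le> i \<and> i < int r"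
  have "0 \<le> of_int m / real r" "(of_int m + 1) / real r \<le> 1" if "0 \<le> m" "m < int r" for m
    using that r by (auto simp: divide_le_eq)
  note b = this[of j] this[of i]
  show "grid_square R j i \<subseteq> unit_square"
  proof
    fix \<xi> assume "\<xi> \<in> grid_square R j i"
    then have "of_int j / real r \<le> \<xi> $ 1" "\<xi> $ 1 \<le> (of_int j + 1) / real r"
      "of_int i / real r \<le> \<xi> $ 2" "\<xi> $ 2 \<le> (of_int i + 1) / real r"
      using r by (auto simp: grid_square_def)
    then have "0 \<le> \<xi> $ 1" "\<xi> $ 1 \<le> 1" "0 \<le> \<xi> $ 2" "\<xi> $ 2 \<le> 1"
      using b ji by linarith+
    then show "\<xi> \<in> unit_square" by (simp add: unit_square_def forall_2)
  qed
qed

lemma grid_squares_eq: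
  assumes r: "sqrt R = real r" "r \<ge> 1"
  shows "grid_squares R = (\<lambda>n. grid_square R (fst n) (snd n)) ` ({0..<int r} \<times> {0..<int r})"
proof -
  have "grid_squares R = {grid_square R j i | j i. 0 \<le> j \<and> j < int r \<and> 0 \<le> i \<and> i < int r}"
    unfolding grid_squares_def by (simp only: grid_square_subset_unit_square_iff[OF r])
  also have "\<dots> = (\<lambda>n. grid_square R (fst n) (snd n)) ` ({0..<int r} \<times> {0..<int r})"
    by force
  finally show ?thesis .
qed

lemma finite_grid_squares:
  assumes "sqrt R = real r" "r \<ge> 1"
  shows "finite (grid_squares R)"
  unfolding grid_squares_eq[OF assms] by simp

lemma grid_square_sets: "q \<in> grid_squares R \<Longrightarrow> q \<in> sets borel"
  by (auto simp: grid_squares_def)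

lemma grid_squares_subset: "q \<in> grid_squares R \<Longrightarrow> q \<subseteq> unit_square"
  by (auto simp: grid_squares_def)

lemma extension_eq_extension_op:
  assumes [measurable]: "S \<in> sets borel" "F \<in> borel_measurable borel"
  shows "extension S F = extension_op (\<lambda>\<xi>. indicator S \<xi> * F \<xi>)"
proof
  fix x
  have "extension S F x = (LINT \<xi>|lebesgue. (indicator S \<xi> * F \<xi>) * e_char (paraboloid \<xi> \<bullet> x))"
    unfolding extension_def set_lebesgue_integral_def
    by (intro Bochner_Integration.integral_cong refl) (simp add: indicator_def)
  also have "\<dots> = (LINT \<xi>|lborel. (indicator S \<xi> * F \<xi>) * e_char (paraboloid \<xi> \<bullet> x))"
    by (rule integral_completion) measurable
  finally show "extension S F x = extension_op (\<lambda>\<xi>. indicator S \<xi> * F \<xi>) x"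
    by (simp add: extension_op_def)
qed

text \<open>
The hypothesis of the theorem for one exponent, in terms of nonnegative integrals of \<open>p\<close>-th powers, so that
later estimates need no integrability side conditions.
\<close>

definition reverse_square_function :: "real \<Rightarrow> real \<Rightarrow> real \<Rightarrow> bool" where
  "reverse_square_function p \<epsilon> D \<longleftrightarrow> (\<forall>R r c F. sqrt R = real r \<and> r \<ge> 1 \<and> integrable lborel F \<and>
     F \<in> borel_measurable borel \<and> (\<forall>\<xi>. F \<xi> \<noteq> 0 \<longrightarrow> \<xi> \<in> unit_square) \<longrightarrow>
     (\<integral>\<^sup>+x. indicator (cball c R) x * ennreal (norm (extension_op F x) powr p) \<partial>lborel)
       \<le> ennreal (D * R powr \<epsilon>) * (\<integral>\<^sup>+x. ennreal ((\<Sum>q\<in>grid_squares R.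
            (norm (extension_op (\<lambda>\<xi>. indicator q \<xi> * F \<xi>) x))\<^sup>2) powr (p / 2) * ball_weight c R x) \<partial>lborel))"

lemma reverse_square_functionI:
  fixes C p \<epsilon> :: real
  assumes p: "p > 0"
    and est: "\<And>R c (F :: real^2 \<Rightarrow> complex). R \<ge> 1 \<Longrightarrow> sqrt R \<in> \<nat> \<Longrightarrow> F absolutely_integrable_on unit_square \<Longrightarrow>
          Lp_norm_on p (cball c R) (extension unit_square F)
            \<le> C * R powr \<epsilon> * Lp_norm_weighted p (ball_weight c R) (square_function R F)"
  shows "\<exists>D>0. reverse_square_function p (\<epsilon> * p) D"
proof (intro exI[of _ "(\<bar>C\<bar> + 1) powr p"] conjI)
  show "reverse_square_function p (\<epsilon> * p) ((\<bar>C\<bar> + 1) powr p)"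
    unfolding reverse_square_function_def
  proof (intro allI impI, elim conjE)
    fix R :: real and r :: nat and c and F :: "real^2 \<Rightarrow> complex"
    assume r: "sqrt R = real r" "1 \<le> r" and F: "integrable lborel F" and [measurable]: "F \<in> borel_measurable borel"
      and supp: "\<forall>\<xi>. F \<xi> \<noteq> 0 \<longrightarrow> \<xi> \<in> unit_square"
    have R1: "R \<ge> 1" using r real_sqrt_ge_1_iff[of R] by simp
    have F_abs: "F absolutely_integrable_on unit_square"
    proof -
      have "(\<lambda>\<xi>. indicator unit_square \<xi> *\<^sub>R F \<xi>) = F"
        using supp by (auto simp: indicator_def fun_eq_iff)
      then show ?thesis
        using F by (simp add: set_integrable_def integrable_completion)
    qed
    have ext_eq: "extension unit_square F = extension_op F"
    proof -
      have "(\<lambda>\<xi>. indicator unit_square \<xi> * F \<xi>) = F"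
        using supp by (auto simp: indicator_def fun_eq_iff)
      then show ?thesis by (simp add: extension_eq_extension_op)
    qed
    define S where "S x = (\<Sum>q\<in>grid_squares R. (norm (extension_op (\<lambda>\<xi>. indicator q \<xi> * F \<xi>) x))\<^sup>2)" for x
    have S0: "S x \<ge> 0" for x unfolding S_def by (intro sum_nonneg) auto
    have [measurable]: "S \<in> borel_measurable borel"
      unfolding S_def by (intro borel_measurable_sum) (use grid_square_sets in measurable)
    have sq_eq: "square_function R F = (\<lambda>x. sqrt (S x))"
      unfolding square_function_def S_def by (intro ext arg_cong[where f = sqrt] sum.cong refl)
        (simp add: extension_eq_extension_op grid_square_sets)
    define B where "B = (\<Sum>q\<in>grid_squares R. (LINT \<xi>|lborel. norm (indicator q \<xi> * F \<xi>))\<^sup>2)"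
    have S_le: "S x \<le> B" for x
      unfolding S_def B_def by (intro sum_mono power_mono norm_extension_op_le) auto
    let ?l = "Lp_norm_on p (cball c R) (extension_op F)"
    let ?n = "Lp_norm_weighted p (ball_weight c R) (\<lambda>x. sqrt (S x))"
    have n0: "?n \<ge> 0" by (simp add: Lp_norm_weighted_def)
    have "?l \<le> C * R powr \<epsilon> * ?n"
      using est[OF R1 _ F_abs, of c] r by (simp add: ext_eq sq_eq)
    also have "\<dots> \<le> (\<bar>C\<bar> + 1) * R powr \<epsilon> * ?n"
      using n0 by (intro mult_right_mono) auto
    finally have "?l powr p \<le> ((\<bar>C\<bar> + 1) * R powr \<epsilon> * ?n) powr p"
      using p by (intro powr_mono2) (auto simp: Lp_norm_on_def)
    also have "\<dots> = (\<bar>C\<bar> + 1) powr p * R powr (\<epsilon> * p) * ?n powr p"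
      using n0 by (simp add: powr_mult powr_powr)
    finally have le: "ennreal (?l powr p) \<le> ennreal ((\<bar>C\<bar> + 1) powr p * R powr (\<epsilon> * p)) * ennreal (?n powr p)"
      by (simp add: ennreal_leI flip: ennreal_mult')
    have "(\<integral>\<^sup>+x. indicator (cball c R) x * ennreal (norm (extension_op F x) powr p) \<partial>lborel) = ennreal (?l powr p)"
      by (rule Lp_norm_on_eq_nn_integral[OF _ norm_extension_op_le p]) measurable
    also note le
    also have "ennreal (?n powr p) = (\<integral>\<^sup>+x. ennreal (norm (sqrt (S x)) powr p * ball_weight c R x) \<partial>lborel)"
      by (rule Lp_norm_weighted_eq_nn_integral[symmetric, where B = "sqrt B"])
         (use p R1 S0 S_le in \<open>auto\<close>)
    also have "\<dots> = (\<integral>\<^sup>+x. ennreal (S x powr (p / 2) * ball_weight c R x) \<partial>lborel)"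
      using S0 by (simp add: powr_half_sqrt[symmetric] powr_powr mult.commute)
    finally show "(\<integral>\<^sup>+x. indicator (cball c R) x * ennreal (norm (extension_op F x) powr p) \<partial>lborel)
       \<le> ennreal ((\<bar>C\<bar> + 1) powr p * R powr (\<epsilon> * p)) * (\<integral>\<^sup>+x. ennreal ((\<Sum>q\<in>grid_squares R.
            (norm (extension_op (\<lambda>\<xi>. indicator q \<xi> * F \<xi>) x))\<^sup>2) powr (p / 2) * ball_weight c R x) \<partial>lborel)"
      by (simp add: S_def)
  qed
qed simp

text \<open>
The map of physical space induced by the Galilean symmetry of the paraboloid, that is, by the frequency
translation \<open>\<xi> \<mapsto> \<xi> + \<tau>\<close>.
\<close>

section \<open>The Galilean symmetry\<close>

definition shear :: "real^2 \<Rightarrow> real^3 \<Rightarrow> real^3" where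
  "shear \<tau> x = x + (2 * x $ 3) *\<^sub>R (\<tau> $ 1 *\<^sub>R axis 1 1 + \<tau> $ 2 *\<^sub>R axis 2 1)"

lemma shear_nth: "shear \<tau> x $ 1 = x $ 1 + 2 * x $ 3 * \<tau> $ 1" "shear \<tau> x $ 2 = x $ 2 + 2 * x $ 3 * \<tau> $ 2"
  "shear \<tau> x $ 3 = x $ 3"
  by (simp_all add: shear_def axis_def)

lemma linear_shear: "linear (shear \<tau>)"
  by (rule linearI) (simp_all add: vec_eq_iff forall_3 shear_nth algebra_simps)

lemma shear_inverse: "shear (- \<tau>) (shear \<tau> x) = x" "shear \<tau> (shear (- \<tau>) x) = x"
  by (simp_all add: vec_eq_iff forall_3 shear_nth)

lemma paraboloid_translate:
  "paraboloid (\<xi> + \<tau>) \<bullet> x = paraboloid \<xi> \<bullet> shear \<tau> x + paraboloid \<tau> \<bullet> x"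
  unfolding paraboloid_inner shear_nth by (simp add: power2_eq_square algebra_simps)

lemma norm_shear_le:
  assumes "\<bar>\<tau> $ 1\<bar> \<le> 1" "\<bar>\<tau> $ 2\<bar> \<le> 1"
  shows "norm (shear \<tau> x) \<le> 5 * norm x"
proof -
  have "norm (\<tau> $ 1 *\<^sub>R axis 1 1 + \<tau> $ 2 *\<^sub>R axis 2 1 :: real^3) \<le> 2"
    using assms by (intro order_trans[OF norm_triangle_ineq]) auto
  then have "norm ((2 * x $ 3) *\<^sub>R (\<tau> $ 1 *\<^sub>R axis 1 1 + \<tau> $ 2 *\<^sub>R axis 2 1 :: real^3)) \<le> (2 * norm x) * 2"
    unfolding norm_scaleR by (intro mult_mono) (use component_le_norm_cart[of x 3] in auto)
  then show ?thesis
    unfolding shear_def by (intro order_trans[OF norm_triangle_ineq]) simp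
qed

lemma shear_measurable [measurable]: "shear \<tau> \<in> borel_measurable borel"
  unfolding shear_def by measurable

text \<open>
The shear has determinant \<open>1\<close>.
\<close>

lemma distr_lborel_shear: "distr lborel borel (shear \<tau>) = lborel"
proof (rule lborel_eqI[symmetric])
  fix l u :: "real^3" assume lu: "\<And>b. b \<in> Basis \<Longrightarrow> l \<bullet> b \<le> u \<bullet> b"
  have det: "det (matrix (shear (- \<tau>))) = 1"
    by (simp add: det_3 matrix_def shear_nth axis_def)
  have vim: "shear \<tau> -` box l u = shear (- \<tau>) ` box l u"
    using shear_inverse by (auto simp: image_iff) (metis shear_inverse)
  have m: "shear (- \<tau>) ` box l u \<in> lmeasurable"
    "measure lebesgue (shear (- \<tau>) ` box l u) = measure lebesgue (box l u)"
    using measurable_linear_image[OF linear_shear] measure_linear_image[OF linear_shear, of "box l u" "- \<tau>"] det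
    by auto
  have "emeasure (distr lborel borel (shear \<tau>)) (box l u) = emeasure lborel (shear \<tau> -` box l u)"
    by (simp add: emeasure_distr)
  also have "\<dots> = emeasure lebesgue (shear (- \<tau>) ` box l u)"
    unfolding vim[symmetric] using measurable_sets_borel[OF shear_measurable, of "box l u"] by simp
  also have "\<dots> = ennreal (measure lebesgue (box l u))"
    using m by (simp add: emeasure_eq_measure2)
  also have "\<dots> = (\<Prod>b\<in>Basis. (u - l) \<bullet> b)"
    using lu by (simp add: measure_lborel_box_eq)
  finally show "emeasure (distr lborel borel (shear \<tau>)) (box l u) = (\<Prod>b\<in>Basis. (u - l) \<bullet> b)" .
qed simp

lemma nn_integral_shear:
  assumes [measurable]: "f \<in> borel_measurable borel"
  shows "(\<integral>\<^sup>+x. f (shear \<tau> x) \<partial>lborel) = (\<integral>\<^sup>+x. f x \<partial>lborel)"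
  by (subst (2) distr_lborel_shear[of \<tau>, symmetric]) (simp add: nn_integral_distr)

lemma norm_extension_op_translate:
  assumes [measurable]: "f \<in> borel_measurable borel"
  shows "norm (extension_op f x) = norm (extension_op (\<lambda>\<xi>. f (\<xi> + \<tau>)) (shear \<tau> x))"
proof -
  let ?g = "\<lambda>\<xi>. f \<xi> * e_char (paraboloid \<xi> \<bullet> x)"
  have "extension_op f x = (LINT \<xi>|distr lborel borel ((+) \<tau>). ?g \<xi>)"
    unfolding extension_op_def by (simp add: lborel_distr_plus)
  also have "\<dots> = (LINT \<xi>|lborel. ?g (\<tau> + \<xi>))"
    by (rule integral_distr) measurable
  also have "\<dots> = (LINT \<xi>|lborel. e_char (paraboloid \<tau> \<bullet> x) * (f (\<xi> + \<tau>) * e_char (paraboloid \<xi> \<bullet> shear \<tau> x)))"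
    by (intro Bochner_Integration.integral_cong refl)
       (simp add: add.commute[of \<tau>] paraboloid_translate e_char_add)
  also have "\<dots> = e_char (paraboloid \<tau> \<bullet> x) * extension_op (\<lambda>\<xi>. f (\<xi> + \<tau>)) (shear \<tau> x)"
    by (simp add: extension_op_def)
  finally show ?thesis by (simp add: norm_mult)
qed

section \<open>The reverse square function estimate for translated pieces\<close>

text \<open>
If, after translation by \<open>\<tau>\<close>, the pieces \<open>g k\<close> live in the interiors of distinct grid squares, then the sharp
cutoffs of their sum are the pieces themselves, and the hypothesis gives an estimate for \<open>\<Sum>\<^sub>k g k\<close> whose
square function consists of the unmodified \<open>g k\<close>. The translation turns the ball into its sheared image, which is
covered by boundedly many balls of the same radius, and the weights of these balls pull back to
at most a constant times the original weight.
\<close>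

lemma translated_pieces_estimate:
  assumes p: "p > 0" and D: "reverse_square_function p \<epsilon> D" "D > 0"
  shows "\<exists>C>0. \<forall>R r c \<tau> K g n. sqrt R = real r \<and> r \<ge> 1 \<and> \<bar>\<tau> $ 1\<bar> \<le> 1 \<and> \<bar>\<tau> $ 2\<bar> \<le> 1 \<and>
      finite K \<and> inj_on n K \<and> n ` K \<subseteq> {0..<int r} \<times> {0..<int r} \<and>
      (\<forall>k\<in>K. integrable lborel (g k)) \<and>
      (\<forall>k\<in>K. \<forall>\<xi>. g k (\<xi> + \<tau>) \<noteq> 0 \<longrightarrow>
         of_int (fst (n k)) < real r * \<xi> $ 1 \<and> real r * \<xi> $ 1 < of_int (fst (n k)) + 1 \<and>
         of_int (snd (n k)) < real r * \<xi> $ 2 \<and> real r * \<xi> $ 2 < of_int (snd (n k)) + 1) \<longrightarrow>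
     (\<integral>\<^sup>+x. indicator (cball c R) x * ennreal (norm (extension_op (\<lambda>\<xi>. \<Sum>k\<in>K. g k \<xi>) x) powr p) \<partial>lborel)
       \<le> ennreal (C * R powr \<epsilon>) * (\<integral>\<^sup>+x. ennreal ((\<Sum>k\<in>(K :: (int \<times> int) set).
            (norm (extension_op (g k) x))\<^sup>2) powr (p / 2) * ball_weight c R x) \<partial>lborel)"
proof -
  have "compact (cball (0::real^3) 5)" by simp
  then obtain Z where Z: "finite Z" "cball (0::real^3) 5 \<subseteq> (\<Union>z\<in>Z. ball z 1)"
    using compact_imp_seq_compact seq_compact_imp_totally_bounded[of "cball (0::real^3) 5"] zero_less_one by metis
  \<comment> \<open>A shear by \<open>\<tau>\<close> or \<open>- \<tau>\<close> stretches lengths at most by the factor \<open>5\<close>; the sum bounds the displacement of the covering balls.\<close>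
  define A where "A = 5 + 5 * (\<Sum>z\<in>Z. norm z)"
  have A_pos: "A > 0" by (simp add: A_def sum_nonneg add_pos_nonneg)
  define C where "C = (real (card Z) + 1) * D * A powr 100"
  have C: "C > 0" using D A_pos by (simp add: C_def)
  show ?thesis
  proof (intro exI[of _ C] conjI allI impI C, elim conjE)
    fix R :: real and r :: nat and c :: "real^3" and \<tau> :: "real^2" and K :: "(int \<times> int) set"
      and g :: "int \<times> int \<Rightarrow> real^2 \<Rightarrow> complex" and n
    assume r: "sqrt R = real r" "r \<ge> 1" and \<tau>: "\<bar>\<tau> $ 1\<bar> \<le> 1" "\<bar>\<tau> $ 2\<bar> \<le> 1"
      and K: "finite K" "inj_on n K" "n ` K \<subseteq> {0..<int r} \<times> {0..<int r}"
      and g: "\<forall>k\<in>K. integrable lborel (g k)"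
      and supp: "\<forall>k\<in>K. \<forall>\<xi>. g k (\<xi> + \<tau>) \<noteq> 0 \<longrightarrow>
         of_int (fst (n k)) < real r * \<xi> $ 1 \<and> real r * \<xi> $ 1 < of_int (fst (n k)) + 1 \<and>
         of_int (snd (n k)) < real r * \<xi> $ 2 \<and> real r * \<xi> $ 2 < of_int (snd (n k)) + 1"
    have R: "R \<ge> 1" using r real_sqrt_ge_1_iff[of R] by simp
    have gm: "g k \<in> borel_measurable borel" if "k \<in> K" for k using g that by auto
    define f where "f \<xi> = (\<Sum>k\<in>K. g k \<xi>)" for \<xi>
    have fm [measurable]: "f \<in> borel_measurable borel"
      unfolding f_def using gm by (intro borel_measurable_sum) auto
    have f_int: "integrable lborel f" unfolding f_def using g by (intro Bochner_Integration.integrable_sum) auto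
    define G where "G \<xi> = f (\<xi> + \<tau>)" for \<xi>
    have Gm [measurable]: "G \<in> borel_measurable borel" unfolding G_def by measurable
    have G_int: "integrable lborel G"
      using integrable_distr_eq[of "(+) \<tau>" lborel borel f] f_int
      by (simp add: lborel_distr_plus G_def[abs_def] add.commute)
    let ?q = "\<lambda>k. grid_square R (fst (n k)) (snd (n k))"
    have in_cell: "\<xi> \<in> ?q k" if "k \<in> K" "g k (\<xi> + \<tau>) \<noteq> 0" for k \<xi>
      using supp that r by (fastforce simp: grid_square_def field_simps)
    have cell_eq: "n k = m" if "k \<in> K" "g k (\<xi> + \<tau>) \<noteq> 0" "\<xi> \<in> grid_square R (fst m) (snd m)" for k m \<xi>
    proof -
      have "of_int (fst m) \<le> real r * \<xi> $ 1" "real r * \<xi> $ 1 \<le> of_int (fst m) + 1"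
        "of_int (snd m) \<le> real r * \<xi> $ 2" "real r * \<xi> $ 2 \<le> of_int (snd m) + 1"
        using that(3) r by (auto simp: grid_square_def field_simps)
      moreover have "of_int (fst (n k)) < real r * \<xi> $ 1" "real r * \<xi> $ 1 < of_int (fst (n k)) + 1"
        "of_int (snd (n k)) < real r * \<xi> $ 2" "real r * \<xi> $ 2 < of_int (snd (n k)) + 1"
        using supp that by auto
      ultimately have "fst (n k) = fst m" "snd (n k) = snd m" by linarith+
      then show ?thesis by (simp add: prod_eq_iff)
    qed
    have q_grid: "?q k \<in> grid_squares R" if "k \<in> K" for k
      using K(3) that unfolding grid_squares_eq[OF r] by blast
    have G_nz: "\<exists>k\<in>K. g k (\<xi> + \<tau>) \<noteq> 0" if "G \<xi> \<noteq> 0" for \<xi>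
      by (rule ccontr) (use that in \<open>auto simp: G_def f_def\<close>)
    have G_supp: "\<xi> \<in> unit_square" if "G \<xi> \<noteq> 0" for \<xi>
    proof -
      obtain k where "k \<in> K" "g k (\<xi> + \<tau>) \<noteq> 0"
        using G_nz[OF \<open>G \<xi> \<noteq> 0\<close>] by blast
      then show ?thesis using in_cell q_grid grid_squares_subset by blast
    qed
    have G_cell: "indicator (?q k) \<xi> * G \<xi> = g k (\<xi> + \<tau>)" if k: "k \<in> K" for k \<xi>
    proof (cases "\<xi> \<in> ?q k")
      case True
      have "g k' (\<xi> + \<tau>) = 0" if "k' \<in> K - {k}" for k'
        using cell_eq[of k' \<xi> "n k"] True that k inj_onD[OF K(2), of k' k] by blast
      then have "G \<xi> = g k (\<xi> + \<tau>)"
        unfolding G_def f_def using K(1) k by (subst sum.remove[of _ k]) auto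
      then show ?thesis using True by simp
    next
      case False
      then show ?thesis using in_cell[OF k, of \<xi>] by auto
    qed
    have G_empty: "indicator q \<xi> * G \<xi> = 0" if q: "q \<in> grid_squares R" "q \<notin> ?q ` K" for q \<xi>
    proof (rule ccontr)
      assume nz: "indicator q \<xi> * G \<xi> \<noteq> 0"
      then obtain k where k: "k \<in> K" "g k (\<xi> + \<tau>) \<noteq> 0"
        using G_nz[of \<xi>] by auto
      obtain j i where "q = grid_square R j i" using q(1) by (auto simp: grid_squares_def)
      with cell_eq[OF k, of "(j, i)"] nz have "q = ?q k" by (auto simp: indicator_def split: if_splits)
      with q k show False by blast
    qed
    have inj: "inj_on ?q K"
    proof (rule inj_onI)
      fix k k' assume k: "k \<in> K" "k' \<in> K" "?q k = ?q k'"
      \<comment> \<open>Distinct grid squares overlap at most in their boundaries, so a centre identifies its square.\<close>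
      define mid :: "real^2" where "mid = vector [(of_int (fst (n k)) + 1 / 2) / real r, (of_int (snd (n k)) + 1 / 2) / real r]"
      have "mid \<in> ?q k" using r by (auto simp: mid_def grid_square_def intro!: divide_right_mono)
      then have "mid \<in> ?q k'" using k by simp
      then have "of_int (fst (n k')) \<le> of_int (fst (n k)) + 1 / (2::real)" "of_int (fst (n k)) + 1 / (2::real) \<le> of_int (fst (n k')) + 1"
        "of_int (snd (n k')) \<le> of_int (snd (n k)) + 1 / (2::real)" "of_int (snd (n k)) + 1 / (2::real) \<le> of_int (snd (n k')) + 1"
        using r by (auto simp: mid_def grid_square_def divide_le_cancel)
      then have "fst (n k) = fst (n k')" "snd (n k) = snd (n k')" by linarith+
      then have "n k = n k'" by (rule prod_eqI)
      then show "k = k'" by (rule inj_onD[OF K(2) _ k(1,2)])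
    qed
    define S where "S y = (\<Sum>q\<in>grid_squares R. (norm (extension_op (\<lambda>\<xi>. indicator q \<xi> * G \<xi>) y))\<^sup>2)" for y
    have [measurable]: "S \<in> borel_measurable borel"
      unfolding S_def by (intro borel_measurable_sum) (use grid_square_sets in measurable)
    have S_shear: "S (shear \<tau> x) = (\<Sum>k\<in>K. (norm (extension_op (g k) x))\<^sup>2)" for x
    proof -
      have "S (shear \<tau> x) = (\<Sum>q\<in>?q ` K. (norm (extension_op (\<lambda>\<xi>. indicator q \<xi> * G \<xi>) (shear \<tau> x)))\<^sup>2)"
        unfolding S_def
      proof (rule sum.mono_neutral_right)
        show "\<forall>q\<in>grid_squares R - ?q ` K. (norm (extension_op (\<lambda>\<xi>. indicator q \<xi> * G \<xi>) (shear \<tau> x)))\<^sup>2 = 0"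
        proof
          fix q assume "q \<in> grid_squares R - ?q ` K"
          then have "(\<lambda>\<xi>. indicator q \<xi> * G \<xi>) = (\<lambda>_. 0)"
            using G_empty[of q] by (intro ext) blast
          then show "(norm (extension_op (\<lambda>\<xi>. indicator q \<xi> * G \<xi>) (shear \<tau> x)))\<^sup>2 = 0"
            by (simp add: extension_op_def)
        qed
      qed (use q_grid finite_grid_squares[OF r] in auto)
      also have "\<dots> = (\<Sum>k\<in>K. (norm (extension_op (\<lambda>\<xi>. indicator (?q k) \<xi> * G \<xi>) (shear \<tau> x)))\<^sup>2)"
        by (simp add: sum.reindex[OF inj])
      also have "\<dots> = (\<Sum>k\<in>K. (norm (extension_op (g k) x))\<^sup>2)"
        using norm_extension_op_translate[OF gm] by (intro sum.cong refl) (simp add: G_cell)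
      finally show ?thesis .
    qed
    have f_shear: "norm (extension_op f x) = norm (extension_op G (shear \<tau> x))" for x
      unfolding G_def by (rule norm_extension_op_translate) measurable
    define d where "d z = shear \<tau> c + R *\<^sub>R z" for z
    \<comment> \<open>The sheared ball lies in the ball of radius \<open>5 R\<close>, which the translates by \<open>R z\<close> cover.\<close>
    have cover: "\<exists>z\<in>Z. shear \<tau> x \<in> cball (d z) R" if x: "x \<in> cball c R" for x
    proof -
      have "norm (shear \<tau> (x - c)) \<le> 5 * R"
        using norm_shear_le[OF \<tau>, of "x - c"] x by (simp add: dist_norm norm_minus_commute)
      then have "(1 / R) *\<^sub>R shear \<tau> (x - c) \<in> cball 0 5"
        using R by (simp add: pos_divide_le_eq)
      then obtain z where z: "z \<in> Z" "dist z ((1 / R) *\<^sub>R shear \<tau> (x - c)) < 1"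
        using subsetD[OF Z(2)] by (metis UN_E mem_ball)
      have "shear \<tau> x - d z = R *\<^sub>R ((1 / R) *\<^sub>R shear \<tau> (x - c) - z)"
        using R by (simp add: d_def linear_diff[OF linear_shear] algebra_simps)
      then have "norm (shear \<tau> x - d z) = R * dist z ((1 / R) *\<^sub>R shear \<tau> (x - c))"
        using R by (simp add: dist_norm norm_minus_commute)
      also have "\<dots> \<le> R * 1" using R z by (intro mult_left_mono) auto
      finally show ?thesis using z(1) by (auto simp: dist_norm norm_minus_commute)
    qed
    have weight: "ball_weight (d z) R (shear \<tau> x) \<le> A powr 100 * ball_weight c R x" if z: "z \<in> Z" for z x
    proof (rule ball_weight_le[OF _ A_pos])
      let ?N = "norm (shear \<tau> x - d z) / R"
      have nz: "norm z \<le> (\<Sum>z\<in>Z. norm z)" using member_le_sum[OF z, of norm] Z(1) by simp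
      have "norm (x - c) \<le> 5 * norm (shear \<tau> (x - c))"
        using norm_shear_le[of "- \<tau>" "shear \<tau> (x - c)"] \<tau> by (simp add: shear_inverse)
      also have "shear \<tau> (x - c) = (shear \<tau> x - d z) + R *\<^sub>R z"
        by (simp add: d_def linear_diff[OF linear_shear])
      also have "norm \<dots> \<le> norm (shear \<tau> x - d z) + R * norm z"
        using norm_triangle_ineq[of "shear \<tau> x - d z" "R *\<^sub>R z"] R by simp
      finally have "norm (x - c) \<le> 5 * (norm (shear \<tau> x - d z) + R * norm z)" by simp
      then have "norm (x - c) / R \<le> 5 * (norm (shear \<tau> x - d z) + R * norm z) / R"
        using R by (intro divide_right_mono) auto
      also have "\<dots> = 5 * ?N + 5 * norm z" using R by (simp add: field_simps)
      finally have 1: "1 + norm (x - c) / R \<le> A + 5 * ?N" using nz by (simp add: A_def)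
      have "5 \<le> A" by (simp add: A_def sum_nonneg)
      then have 2: "5 * ?N \<le> A * ?N" using R by (intro mult_right_mono) auto
      have 3: "A * (1 + ?N) = A + A * ?N" by (simp only: distrib_left mult_1_right)
      show "1 + norm (x - c) / R \<le> A * (1 + ?N)" unfolding 3 using 1 2 by linarith
    qed (use R in auto)
    let ?W = "\<integral>\<^sup>+x. ennreal ((\<Sum>k\<in>K. (norm (extension_op (g k) x))\<^sup>2) powr (p / 2) * ball_weight c R x) \<partial>lborel"
    have one: "(\<integral>\<^sup>+y. indicator (cball (d z) R) y * ennreal (norm (extension_op G y) powr p) \<partial>lborel)
        \<le> ennreal (D * R powr \<epsilon> * A powr 100) * ?W" if z: "z \<in> Z" for z
    proof -
      have "(\<integral>\<^sup>+y. indicator (cball (d z) R) y * ennreal (norm (extension_op G y) powr p) \<partial>lborel)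
        \<le> ennreal (D * R powr \<epsilon>) * (\<integral>\<^sup>+y. ennreal (S y powr (p / 2) * ball_weight (d z) R y) \<partial>lborel)"
        unfolding S_def using D(1) r G_int Gm G_supp by (auto simp: reverse_square_function_def)
      also have "(\<integral>\<^sup>+y. ennreal (S y powr (p / 2) * ball_weight (d z) R y) \<partial>lborel)
         = (\<integral>\<^sup>+x. ennreal (S (shear \<tau> x) powr (p / 2) * ball_weight (d z) R (shear \<tau> x)) \<partial>lborel)"
        by (rule nn_integral_shear[symmetric]) measurable
      also have "\<dots> \<le> (\<integral>\<^sup>+x. ennreal (A powr 100) * ennreal (S (shear \<tau> x) powr (p / 2) * ball_weight c R x) \<partial>lborel)"
      proof (rule nn_integral_mono)
        fix x
        have "S (shear \<tau> x) powr (p / 2) * ball_weight (d z) R (shear \<tau> x)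
          \<le> S (shear \<tau> x) powr (p / 2) * (A powr 100 * ball_weight c R x)"
          by (intro mult_left_mono weight z) auto
        then show "ennreal (S (shear \<tau> x) powr (p / 2) * ball_weight (d z) R (shear \<tau> x))
          \<le> ennreal (A powr 100) * ennreal (S (shear \<tau> x) powr (p / 2) * ball_weight c R x)"
          by (simp add: ennreal_leI mult_ac flip: ennreal_mult')
      qed
      also have "\<dots> = ennreal (A powr 100) * ?W"
        unfolding S_shear by (rule nn_integral_cmult) (use gm in measurable)
      finally show ?thesis
        by (simp add: ennreal_mult'' mult.assoc mult_left_mono)
    qed
    have Gz: "(\<lambda>y. indicator (cball (d z) R) y * ennreal (norm (extension_op G y) powr p)) \<in> borel_measurable borel" for z
    proof -
      have [measurable]: "cball (d z) R \<in> sets borel" by simp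
      show ?thesis by measurable
    qed
    have "(\<integral>\<^sup>+x. indicator (cball c R) x * ennreal (norm (extension_op f x) powr p) \<partial>lborel)
       \<le> (\<integral>\<^sup>+x. (\<Sum>z\<in>Z. indicator (cball (d z) R) (shear \<tau> x) * ennreal (norm (extension_op G (shear \<tau> x)) powr p)) \<partial>lborel)"
    proof (rule nn_integral_mono)
      fix x
      show "indicator (cball c R) x * ennreal (norm (extension_op f x) powr p)
        \<le> (\<Sum>z\<in>Z. indicator (cball (d z) R) (shear \<tau> x) * ennreal (norm (extension_op G (shear \<tau> x)) powr p))"
      proof (cases "x \<in> cball c R")
        case True
        then obtain z where z: "z \<in> Z" "shear \<tau> x \<in> cball (d z) R" using cover by blast
        have "indicator (cball c R) x * ennreal (norm (extension_op f x) powr p)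
          = indicator (cball (d z) R) (shear \<tau> x) * ennreal (norm (extension_op G (shear \<tau> x)) powr p)"
          using True z by (simp add: f_shear)
        also have "\<dots> \<le> (\<Sum>z\<in>Z. indicator (cball (d z) R) (shear \<tau> x) * ennreal (norm (extension_op G (shear \<tau> x)) powr p))"
          using Z(1) z(1) by (intro member_le_sum) auto
        finally show ?thesis .
      qed simp
    qed
    also have "\<dots> = (\<Sum>z\<in>Z. \<integral>\<^sup>+x. indicator (cball (d z) R) (shear \<tau> x) * ennreal (norm (extension_op G (shear \<tau> x)) powr p) \<partial>lborel)"
      by (rule nn_integral_sum) (use measurable_compose[OF shear_measurable Gz] in simp)
    also have "\<dots> = (\<Sum>z\<in>Z. \<integral>\<^sup>+y. indicator (cball (d z) R) y * ennreal (norm (extension_op G y) powr p) \<partial>lborel)"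
      by (intro sum.cong refl nn_integral_shear Gz)
    also have "\<dots> \<le> (\<Sum>z\<in>Z. ennreal (D * R powr \<epsilon> * A powr 100) * ?W)"
      by (intro sum_mono one)
    also have "\<dots> = ennreal (real (card Z) * (D * R powr \<epsilon> * A powr 100)) * ?W"
      using D(2) by (simp add: ennreal_mult' ennreal_of_nat_eq_real_of_nat mult.assoc)
    also have "\<dots> \<le> ennreal (C * R powr \<epsilon>) * ?W"
    proof (intro mult_right_mono ennreal_leI)
      have "C * R powr \<epsilon> = real (card Z) * (D * R powr \<epsilon> * A powr 100) + D * R powr \<epsilon> * A powr 100"
        by (simp add: C_def algebra_simps)
      then show "real (card Z) * (D * R powr \<epsilon> * A powr 100) \<le> C * R powr \<epsilon>"
        using D(2) by simp
    qed simp
    finally show "(\<integral>\<^sup>+x. indicator (cball c R) x * ennreal (norm (extension_op (\<lambda>\<xi>. \<Sum>k\<in>K. g k \<xi>) x) powr p) \<partial>lborel)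
       \<le> ennreal (C * R powr \<epsilon>) * ?W"
      by (simp only: f_def[abs_def])
  qed
qed

section \<open>The reverse square function estimate for spline pieces\<close>

text \<open>
The lattice index \<open>k\<close> is written as \<open>residue_shift L k + L * cell_index L k\<close>: the first summand is the
translation of the grid, in units of \<open>1/(L\<surd>R)\<close>, and the second is the number of the grid interval that contains
the translated support. Plain division would place the splines with \<open>k < 0\<close>, which straddle the
left end of \<open>[0,1]\<close>, in the cell \<open>-1\<close> outside the unit square; each of them gets a translation of its own that
moves it into the cell \<open>0\<close>.
\<close>

definition residue_shift :: "nat \<Rightarrow> int \<Rightarrow> int" where
  "residue_shift L k = (if k < 0 then k else k mod int L)"

definition cell_index :: "nat \<Rightarrow> int \<Rightarrow> int" where
  "cell_index L k = (if k < 0 then 0 else k div int L)"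

lemma residue_shift_cell_index: "k = residue_shift L k + int L * cell_index L k"
  by (simp add: residue_shift_def cell_index_def)

lemma residue_shift_bounds:
  assumes "L \<ge> 1" "- int L \<le> k"
  shows "residue_shift L k \<in> {- int L..<int L}"
  using assms pos_mod_sign[of "int L" k] by (auto simp: residue_shift_def intro: order_trans[of _ 0])

lemma cell_index_bounds:
  assumes "L \<ge> 1" "r \<ge> 1" "k < int (L * r)"
  shows "cell_index L k \<in> {0..<int r}"
proof (cases "k < 0")
  case False
  have "k div int L < int r"
  proof (rule ccontr)
    assume "\<not> ?thesis"
    then have "int L * int r \<le> int L * (k div int L)" by (intro mult_left_mono) auto
    also have "\<dots> \<le> k"
      using mult_div_mod_eq[of "int L" k] pos_mod_sign[of "int L" k] assms(1) by linarith
    finally show False using assms(3) by simp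
  qed
  then show ?thesis using False assms by (simp add: cell_index_def pos_imp_zdiv_nonneg_iff)
qed (use assms in \<open>auto simp: cell_index_def\<close>)

text \<open>
All lattice points whose spline, of width \<open>L\<close>, can meet \<open>[0, L r]\<close>.
\<close>

definition spline_indices :: "nat \<Rightarrow> nat \<Rightarrow> (int \<times> int) set" where
  "spline_indices L r = {- int L..<int (L * r)} \<times> {- int L..<int (L * r)}"

lemma finite_spline_indices [simp]: "finite (spline_indices L r)"
  by (simp add: spline_indices_def)

lemma spline_tensor_partition_of_unity:
  assumes b: "spline_pair L b" and \<xi>: "\<xi> \<in> unit_square"
  shows "(\<Sum>k\<in>spline_indices L r. spline_tensor b (real (L * r)) k \<xi>) = 1"
proof -
  have one: "(\<Sum>k\<in>{- int L..<int (L * r)}. b (real (L * r) * \<xi> $ j - of_int k)) = 1" for j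
  proof -
    have "0 \<le> \<xi> $ j" "\<xi> $ j \<le> 1" using \<xi> by (auto simp: unit_square_def)
    then have t: "0 \<le> real (L * r) * \<xi> $ j" "real (L * r) * \<xi> $ j \<le> real (L * r)"
      by (auto intro: mult_left_le)
    have "{k::int. 0 < real (L * r) * \<xi> $ j - of_int k \<and> real (L * r) * \<xi> $ j - of_int k < real L}
       \<subseteq> {- int L..<int (L * r)}"
    proof
      fix k :: int assume "k \<in> {k::int. 0 < real (L * r) * \<xi> $ j - of_int k \<and> real (L * r) * \<xi> $ j - of_int k < real L}"
      then have "0 < real (L * r) * \<xi> $ j - of_int k" "real (L * r) * \<xi> $ j - of_int k < real L"
        by (simp_all only: mem_Collect_eq)
      then have "real_of_int k < real_of_int (int (L * r))" "real_of_int (- int L) \<le> real_of_int k"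
        using t by (simp_all only: of_int_of_nat_eq of_int_minus)
      then show "k \<in> {- int L..<int (L * r)}"
        by (simp only: of_int_less_iff of_int_le_iff atLeastLessThan_iff)
    qed
    then show ?thesis using b unfolding spline_pair_def by blast
  qed
  have "(\<Sum>k\<in>spline_indices L r. spline_tensor b (real (L * r)) k \<xi>)
    = of_real ((\<Sum>k\<in>{- int L..<int (L * r)}. b (real (L * r) * \<xi> $ 1 - of_int k)) *
        (\<Sum>k\<in>{- int L..<int (L * r)}. b (real (L * r) * \<xi> $ 2 - of_int k)))"
    unfolding spline_indices_def spline_tensor_def sum_product sum.cartesian_product
    by (simp add: split_def)
  then show ?thesis unfolding one by simp
qed

lemma spline_tensor_measurable:
  assumes "spline_pair L b"
  shows "spline_tensor b s k \<in> borel_measurable borel"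
proof -
  have [measurable]: "b \<in> borel_measurable borel" using assms by (simp add: spline_pair_def)
  show ?thesis unfolding spline_tensor_def by measurable
qed

lemma norm_spline_tensor_le:
  assumes "spline_pair L b"
  shows "norm (spline_tensor b s k \<xi>) \<le> 1"
proof -
  have "0 \<le> b t" "b t \<le> 1" for t using assms by (auto simp: spline_pair_def)
  then show ?thesis by (auto simp: spline_tensor_def norm_mult abs_mult intro!: mult_le_one)
qed

lemma spline_tensor_support:
  assumes "spline_pair L b" "spline_tensor b s k \<xi> \<noteq> 0"
  shows "of_int (fst k) < s * \<xi> $ 1" "s * \<xi> $ 1 < of_int (fst k) + real L"
    "of_int (snd k) < s * \<xi> $ 2" "s * \<xi> $ 2 < of_int (snd k) + real L"
proof -
  have supp: "b t \<noteq> 0 \<Longrightarrow> 0 < t \<and> t < real L" for t using assms(1) by (auto simp: spline_pair_def)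
  have "b (s * \<xi> $ 1 - of_int (fst k)) \<noteq> 0" "b (s * \<xi> $ 2 - of_int (snd k)) \<noteq> 0"
    using assms(2) by (auto simp: spline_tensor_def)
  from this[THEN supp] show "of_int (fst k) < s * \<xi> $ 1" "s * \<xi> $ 1 < of_int (fst k) + real L"
    "of_int (snd k) < s * \<xi> $ 2" "s * \<xi> $ 2 < of_int (snd k) + real L"
    by auto
qed

text \<open>
\<open>F\<close> is split according to the translation assigned to each spline index. There are at most \<open>(2 L)\<^sup>2\<close>
translations, independently of \<open>R\<close>, and each class satisfies the hypotheses of
\<open>translated_pieces_estimate\<close> because two indices with the same translation differ by a multiple of \<open>L\<close>,
that is, by whole grid squares.
\<close>

lemma smooth_reverse_square_function:
  assumes p: "p \<ge> 1" and D: "reverse_square_function p \<epsilon> D" "D > 0"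
    and b: "spline_pair L b" and L: "L \<ge> 1"
  shows "\<exists>C>0. \<forall>R r c F. sqrt R = real r \<and> r \<ge> 1 \<and> integrable lborel F \<and> (\<forall>\<xi>. F \<xi> \<noteq> 0 \<longrightarrow> \<xi> \<in> unit_square) \<longrightarrow>
     (\<integral>\<^sup>+x. indicator (cball c R) x * ennreal (norm (extension_op F x) powr p) \<partial>lborel)
       \<le> ennreal (C * R powr \<epsilon>) * (\<integral>\<^sup>+x. ennreal ((\<Sum>k\<in>spline_indices L r.
            (norm (extension_op (\<lambda>\<xi>. spline_tensor b (real (L * r)) k \<xi> * F \<xi>) x))\<^sup>2) powr (p / 2) * ball_weight c R x) \<partial>lborel)"
proof -
  have p0: "p > 0" using p by simp
  obtain C where C: "C > 0" and
    est: "\<forall>R r c \<tau> K g n. sqrt R = real r \<and> r \<ge> 1 \<and> \<bar>\<tau> $ 1\<bar> \<le> 1 \<and> \<bar>\<tau> $ 2\<bar> \<le> 1 \<and>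
      finite K \<and> inj_on n K \<and> n ` K \<subseteq> {0..<int r} \<times> {0..<int r} \<and>
      (\<forall>k\<in>K. integrable lborel (g k)) \<and>
      (\<forall>k\<in>K. \<forall>\<xi>. g k (\<xi> + \<tau>) \<noteq> 0 \<longrightarrow>
         of_int (fst (n k)) < real r * \<xi> $ 1 \<and> real r * \<xi> $ 1 < of_int (fst (n k)) + 1 \<and>
         of_int (snd (n k)) < real r * \<xi> $ 2 \<and> real r * \<xi> $ 2 < of_int (snd (n k)) + 1) \<longrightarrow>
     (\<integral>\<^sup>+x. indicator (cball c R) x * ennreal (norm (extension_op (\<lambda>\<xi>. \<Sum>k\<in>K. g k \<xi>) x) powr p) \<partial>lborel)
       \<le> ennreal (C * R powr \<epsilon>) * (\<integral>\<^sup>+x. ennreal ((\<Sum>k\<in>(K :: (int \<times> int) set).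
            (norm (extension_op (g k) x))\<^sup>2) powr (p / 2) * ball_weight c R x) \<partial>lborel)"
    using translated_pieces_estimate[OF p0 D] by (elim exE conjE) (rule that)
  define J where "J = {- int L..<int L} \<times> {- int L..<int L}"
  have J: "finite J" "J \<noteq> {}" using L by (auto simp: J_def)
  define m where "m = real (card J)"
  have m: "m \<ge> 1" using J by (simp add: m_def Suc_le_eq card_gt_0_iff)
  define C' where "C' = m powr (p - 1) * m * C"
  have C': "C' > 0" using m C by (simp add: C'_def)
  show ?thesis
  proof (intro exI[of _ C'] conjI allI impI C', elim conjE)
    fix R :: real and r :: nat and c :: "real^3" and F :: "real^2 \<Rightarrow> complex"
    assume r: "sqrt R = real r" "r \<ge> 1" and F: "integrable lborel F"
      and F_supp: "\<forall>\<xi>. F \<xi> \<noteq> 0 \<longrightarrow> \<xi> \<in> unit_square"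
    have Fm: "F \<in> borel_measurable borel" using F by auto
    let ?s = "real (L * r)"
    let ?I = "spline_indices L r"
    define g where "g k = (\<lambda>\<xi>. spline_tensor b ?s k \<xi> * F \<xi>)" for k
    have g_int: "integrable lborel (g k)" for k
      unfolding g_def by (intro integrable_times_bounded F spline_tensor_measurable[OF b] norm_spline_tensor_le[OF b])
    define cl where "cl k = (residue_shift L (fst k), residue_shift L (snd k))" for k
    define n where "n k = (cell_index L (fst k), cell_index L (snd k))" for k
    define K where "K j = {k \<in> ?I. cl k = j}" for j
    let ?W = "\<integral>\<^sup>+x. ennreal ((\<Sum>k\<in>?I. (norm (extension_op (g k) x))\<^sup>2) powr (p / 2) * ball_weight c R x) \<partial>lborel"
    let ?f = "\<lambda>j \<xi>. \<Sum>k\<in>K j. g k \<xi>"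
    have I_D: "fst k \<in> {- int L..<int (L * r)}" "snd k \<in> {- int L..<int (L * r)}" if "k \<in> ?I" for k
      using that by (simp_all only: spline_indices_def mem_Times_iff)
    have shift: "residue_shift L i \<in> {- int L..<int L}" and cell: "cell_index L i \<in> {0..<int r}"
      if "i \<in> {- int L..<int (L * r)}" for i
      using that residue_shift_bounds[OF L, of i] cell_index_bounds[OF L r(2), of i]
      by (simp_all only: atLeastLessThan_iff)
    have cl_J: "cl ` ?I \<subseteq> J"
      using shift I_D by (intro image_subsetI) (simp only: cl_def J_def mem_Times_iff fst_conv snd_conv)
    have F_eq: "F = (\<lambda>\<xi>. \<Sum>j\<in>J. ?f j \<xi>)"
    proof
      fix \<xi>
      have "(\<Sum>j\<in>J. ?f j \<xi>) = (\<Sum>k\<in>?I. g k \<xi>)"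
        unfolding K_def by (rule sum.group) (use J cl_J in auto)
      also have "\<dots> = (\<Sum>k\<in>?I. spline_tensor b ?s k \<xi>) * F \<xi>"
        by (simp add: g_def sum_distrib_right)
      also have "\<dots> = F \<xi>"
        using spline_tensor_partition_of_unity[OF b, of \<xi> r] F_supp by (cases "F \<xi> = 0") auto
      finally show "F \<xi> = (\<Sum>j\<in>J. ?f j \<xi>)" ..
    qed
    have f_int: "integrable lborel (?f j)" for j
      by (intro Bochner_Integration.integrable_sum g_int)
    have ext_m [measurable]: "extension_op (?f j) \<in> borel_measurable borel" for j
      using f_int[of j] by (intro extension_op_measurable) auto
    have ext_g [measurable]: "extension_op (g k) \<in> borel_measurable borel" for k
      using g_int[of k] by (intro extension_op_measurable) auto
    have class_est: "(\<integral>\<^sup>+x. indicator (cball c R) x * ennreal (norm (extension_op (?f j) x) powr p) \<partial>lborel)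
        \<le> ennreal (C * R powr \<epsilon>) * ?W" if j: "j \<in> J" for j
    proof -
      define \<tau> :: "real^2" where "\<tau> = vector [of_int (fst j) / ?s, of_int (snd j) / ?s]"
      have s: "?s > 0" using L r by simp
      have s\<tau>: "?s * \<tau> $ 1 = of_int (fst j)" "?s * \<tau> $ 2 = of_int (snd j)"
        using L r by (simp_all add: \<tau>_def)
      have small: "\<bar>real_of_int i / ?s\<bar> \<le> 1" if "i \<in> {- int L..<int L}" for i
      proof -
        have "\<bar>real_of_int i\<bar> \<le> real L" using that by auto
        also have "\<dots> \<le> ?s" using r L mult_left_mono[of 1 "real r" "real L"] by simp
        finally show ?thesis using s by (simp add: abs_div_pos[symmetric])
      qed
      have "(\<integral>\<^sup>+x. indicator (cball c R) x * ennreal (norm (extension_op (?f j) x) powr p) \<partial>lborel)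
       \<le> ennreal (C * R powr \<epsilon>) * (\<integral>\<^sup>+x. ennreal ((\<Sum>k\<in>K j.
            (norm (extension_op (g k) x))\<^sup>2) powr (p / 2) * ball_weight c R x) \<partial>lborel)"
      proof (rule est[rule_format], intro conjI)
        show "sqrt R = real r" "1 \<le> r" by (fact r)+
        show "\<bar>\<tau> $ 1\<bar> \<le> 1" "\<bar>\<tau> $ 2\<bar> \<le> 1"
          using small[of "fst j"] small[of "snd j"] j by (auto simp: \<tau>_def J_def)
        show "finite (K j)" by (simp add: K_def)
        show "inj_on n (K j)"
        proof (rule inj_onI)
          fix k k' assume "k \<in> K j" "k' \<in> K j" "n k = n k'"
          then show "k = k'"
            using residue_shift_cell_index[of "fst k" L] residue_shift_cell_index[of "fst k'" L]
              residue_shift_cell_index[of "snd k" L] residue_shift_cell_index[of "snd k'" L]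
            by (intro prod_eqI) (auto simp: K_def n_def cl_def)
        qed
        show "n ` K j \<subseteq> {0..<int r} \<times> {0..<int r}"
          using cell I_D
          by (intro image_subsetI) (simp only: K_def n_def mem_Times_iff fst_conv snd_conv mem_Collect_eq)
        show "\<forall>k\<in>K j. integrable lborel (g k)" using g_int by blast
        show "\<forall>k\<in>K j. \<forall>\<xi>. g k (\<xi> + \<tau>) \<noteq> 0 \<longrightarrow>
         of_int (fst (n k)) < real r * \<xi> $ 1 \<and> real r * \<xi> $ 1 < of_int (fst (n k)) + 1 \<and>
         of_int (snd (n k)) < real r * \<xi> $ 2 \<and> real r * \<xi> $ 2 < of_int (snd (n k)) + 1"
        proof (intro ballI allI impI)
          fix k \<xi> assume k: "k \<in> K j" and "g k (\<xi> + \<tau>) \<noteq> 0"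
          then have nz: "spline_tensor b ?s k (\<xi> + \<tau>) \<noteq> 0" by (auto simp: g_def)
          have k_eq: "fst k = fst j + int L * fst (n k)" "snd k = snd j + int L * snd (n k)"
            using k residue_shift_cell_index[of "fst k" L] residue_shift_cell_index[of "snd k" L]
            by (auto simp: K_def cl_def n_def)
          have L0: "real L > 0" using L by simp
          have between: "of_int i < real r * t \<and> real r * t < of_int i + 1"
            if "of_int (j' + int L * i) < ?s * t + of_int j'" "?s * t + of_int j' < of_int (j' + int L * i) + real L"
            for i j' :: int and t :: real
          proof -
            have "real L * of_int i < real L * (real r * t)" "real L * (real r * t) < real L * (of_int i + 1)"
              using that by (auto simp: algebra_simps)
            then show ?thesis using L0 by (auto simp: mult_less_cancel_left_pos)
          qed
          show "of_int (fst (n k)) < real r * \<xi> $ 1 \<and> real r * \<xi> $ 1 < of_int (fst (n k)) + 1 \<and>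
             of_int (snd (n k)) < real r * \<xi> $ 2 \<and> real r * \<xi> $ 2 < of_int (snd (n k)) + 1"
            using between[of "fst j" "fst (n k)" "\<xi> $ 1"] between[of "snd j" "snd (n k)" "\<xi> $ 2"]
              spline_tensor_support[OF b nz]
            unfolding vector_add_component distrib_left s\<tau> k_eq by blast
        qed
      qed
      also have "\<dots> \<le> ennreal (C * R powr \<epsilon>) * ?W"
        using p0 by (intro mult_left_mono nn_integral_mono ennreal_leI mult_right_mono powr_mono2 sum_mono2)
          (auto simp: K_def intro!: sum_nonneg)
      finally show ?thesis .
    qed
    have "(\<integral>\<^sup>+x. indicator (cball c R) x * ennreal (norm (extension_op F x) powr p) \<partial>lborel)
      \<le> (\<integral>\<^sup>+x. ennreal (m powr (p - 1)) * (\<Sum>j\<in>J. indicator (cball c R) x * ennreal (norm (extension_op (?f j) x) powr p)) \<partial>lborel)"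
    proof (rule nn_integral_mono)
      fix x
      have "norm (extension_op F x) = norm (\<Sum>j\<in>J. extension_op (?f j) x)"
        by (subst F_eq, subst extension_op_sum) (use J f_int in auto)
      also have "\<dots> \<le> (\<Sum>j\<in>J. norm (extension_op (?f j) x))" by (rule norm_sum)
      finally have "norm (extension_op F x) powr p \<le> (\<Sum>j\<in>J. norm (extension_op (?f j) x)) powr p"
        using p0 by (intro powr_mono2) auto
      also have "\<dots> \<le> (\<Sum>j\<in>J. 1) powr (p - 1) * (\<Sum>j\<in>J. 1 powr (1 - p) * norm (extension_op (?f j) x) powr p)"
        by (rule powr_sum_le) (use J p in auto)
      finally have "norm (extension_op F x) powr p \<le> m powr (p - 1) * (\<Sum>j\<in>J. norm (extension_op (?f j) x) powr p)"
        by (simp add: m_def)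
      then have "ennreal (norm (extension_op F x) powr p) \<le> ennreal (m powr (p - 1)) * (\<Sum>j\<in>J. ennreal (norm (extension_op (?f j) x) powr p))"
        by (subst sum_ennreal) (auto simp: ennreal_leI simp flip: ennreal_mult')
      then show "indicator (cball c R) x * ennreal (norm (extension_op F x) powr p)
         \<le> ennreal (m powr (p - 1)) * (\<Sum>j\<in>J. indicator (cball c R) x * ennreal (norm (extension_op (?f j) x) powr p))"
        by (simp add: indicator_def)
    qed
    also have "\<dots> = ennreal (m powr (p - 1)) * (\<Sum>j\<in>J. \<integral>\<^sup>+x. indicator (cball c R) x * ennreal (norm (extension_op (?f j) x) powr p) \<partial>lborel)"
    proof -
      have cb [measurable]: "cball c R \<in> sets borel" by simp
      show ?thesis
        by (subst nn_integral_cmult, measurable, subst nn_integral_sum) measurable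
    qed
    also have "\<dots> \<le> ennreal (m powr (p - 1)) * (\<Sum>j\<in>J. ennreal (C * R powr \<epsilon>) * ?W)"
      by (intro mult_left_mono sum_mono class_est) auto
    also have "\<dots> = ennreal (C' * R powr \<epsilon>) * ?W"
      using C m by (simp add: C'_def m_def ennreal_mult'' ennreal_mult' ennreal_of_nat_eq_real_of_nat mult_ac)
    finally show "(\<integral>\<^sup>+x. indicator (cball c R) x * ennreal (norm (extension_op F x) powr p) \<partial>lborel)
       \<le> ennreal (C' * R powr \<epsilon>) * (\<integral>\<^sup>+x. ennreal ((\<Sum>k\<in>spline_indices L r.
            (norm (extension_op (\<lambda>\<xi>. spline_tensor b (real (L * r)) k \<xi> * F \<xi>) x))\<^sup>2) powr (p / 2) * ball_weight c R x) \<partial>lborel)"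
      by (simp only: g_def)
  qed
qed

section \<open>Large ensembles\<close>

lemma ensemble_measurable:
  assumes "large_ensemble R S" "sqrt R = real r" "r \<ge> 1"
  shows "S \<in> sets borel" "S \<subseteq> unit_square"
proof -
  obtain Q where Q: "Q \<subseteq> grid_squares R" "S = \<Union>Q" using assms(1) by (auto simp: large_ensemble_def)
  have "finite Q" using Q(1) finite_grid_squares[OF assms(2,3)] by (rule finite_subset)
  then show "S \<in> sets borel" unfolding Q(2) using Q(1) grid_square_sets
    by (intro sets.finite_Union) auto
  show "S \<subseteq> unit_square" using Q grid_squares_subset by blast
qed

text \<open>
The support of a spline lies in an open square of the same side as the grid squares, so it meets at most \<open>2 \<times> 2\<close>
of them; different ensembles meet it in different grid squares, since grid squares are not negligible.
\<close>

lemma few_ensembles_meet_spline: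
  assumes r: "sqrt R = real r" "r \<ge> 1" and L: "L \<ge> 1" and b: "spline_pair L b"
    and S: "ensemble_partition R N S"
  shows "card {i\<in>{1..N}. \<exists>\<xi>\<in>S i. spline_tensor b (real (L * r)) k \<xi> \<noteq> 0} \<le> 4"
proof -
  let ?I = "{i\<in>{1..N}. \<exists>\<xi>\<in>S i. spline_tensor b (real (L * r)) k \<xi> \<noteq> 0}"
  let ?a = "fst k div int L" and ?b = "snd k div int L"
  have L0: "real L > 0" using L by simp
  have "\<exists>n. grid_square R (fst n) (snd n) \<subseteq> S i \<and> n \<in> {?a, ?a + 1} \<times> {?b, ?b + 1}" if i: "i \<in> ?I" for i
  proof -
    obtain \<xi> where \<xi>: "\<xi> \<in> S i" "spline_tensor b (real (L * r)) k \<xi> \<noteq> 0" using i by blast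
    have "large_ensemble R (S i)" using S i by (auto simp: ensemble_partition_def)
    then obtain Q where "Q \<subseteq> grid_squares R" "S i = \<Union>Q" by (auto simp: large_ensemble_def)
    then obtain q where q: "q \<in> grid_squares R" "q \<subseteq> S i" "\<xi> \<in> q"
      using \<xi>(1) by blast
    then obtain j l where jl: "q = grid_square R j l" by (auto simp: grid_squares_def)
    have near: "m \<in> {k' div int L, k' div int L + 1}"
      if "of_int m / real r \<le> t" "t \<le> (of_int m + 1) / real r"
        "of_int k' < real (L * r) * t" "real (L * r) * t < of_int k' + real L" for m k' :: int and t :: real
    proof -
      have t: "of_int m \<le> real r * t" "real r * t \<le> of_int m + 1"
        using that(1,2) r(2) by (auto simp: field_simps)
      have lm: "real L * of_int m \<le> real (L * r) * t" "real (L * r) * t \<le> real L * (of_int m + 1)"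
        using mult_left_mono[OF t(1), of "real L"] mult_left_mono[OF t(2), of "real L"] by (auto simp: mult_ac)
      then have "real_of_int (int L * m) < real_of_int (k' + int L)" "real_of_int k' < real_of_int (int L * (m + 1))"
        unfolding of_int_mult of_int_add of_int_of_nat_eq of_int_1 using lm that(3,4) by linarith+
      then have 1: "int L * m < k' + int L" "k' < int L * (m + 1)" by linarith+
      define d where "d = k' div int L"
      have d: "int L * d \<le> k'" "k' < int L * d + int L"
        unfolding d_def using mult_div_mod_eq[of "int L" k'] pos_mod_sign[of "int L" k'] pos_mod_bound[of "int L" k'] L
        by linarith+
      have "int L * m < int L * (d + 2)" using 1 d by (simp add: distrib_left)
      moreover have "int L * d < int L * (m + 1)" using 1 d by linarith
      ultimately have "m < d + 2" "d < m + 1" using L by (simp_all add: mult_less_cancel_left_pos)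
      then show ?thesis by (auto simp: d_def)
    qed
    have g: "of_int j / real r \<le> \<xi> $ 1" "\<xi> $ 1 \<le> (of_int j + 1) / real r"
      "of_int l / real r \<le> \<xi> $ 2" "\<xi> $ 2 \<le> (of_int l + 1) / real r"
      using q(3) r(1) by (auto simp: jl grid_square_def)
    have "j \<in> {?a, ?a + 1}" "l \<in> {?b, ?b + 1}"
      using near[OF g(1,2) spline_tensor_support(1,2)[OF b \<xi>(2)]]
        near[OF g(3,4) spline_tensor_support(3,4)[OF b \<xi>(2)]] by blast+
    then show ?thesis using q(2) jl by (intro exI[of _ "(j, l)"]) auto
  qed
  then have "\<forall>i\<in>?I. \<exists>n. grid_square R (fst n) (snd n) \<subseteq> S i \<and> n \<in> {?a, ?a + 1} \<times> {?b, ?b + 1}"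
    by blast
  from bchoice[OF this] obtain n where n: "\<And>i. i \<in> ?I \<Longrightarrow> grid_square R (fst (n i)) (snd (n i)) \<subseteq> S i"
    "\<And>i. i \<in> ?I \<Longrightarrow> n i \<in> {?a, ?a + 1} \<times> {?b, ?b + 1}"
    by blast
  have R: "R > 0" using r real_sqrt_gt_0_iff[of R] by simp
  have "inj_on n ?I"
  proof (rule inj_onI, rule ccontr)
    fix i j assume ij: "i \<in> ?I" "j \<in> ?I" "n i = n j" "i \<noteq> j"
    then have "negligible (S i \<inter> S j)" using S by (auto simp: ensemble_partition_def)
    then have "negligible (grid_square R (fst (n i)) (snd (n i)))"
      by (rule negligible_subset) (use n(1)[of i] n(1)[of j] ij in auto)
    then show False using grid_square_not_negligible[OF R] by blast
  qed
  then have "card ?I \<le> card ({?a, ?a + 1} \<times> {?b, ?b + 1})"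
  proof (rule card_inj_on_le)
    show "n ` ?I \<subseteq> {?a, ?a + 1} \<times> {?b, ?b + 1}" using n(2) by blast
  qed simp
  then show ?thesis by (simp add: card_cartesian_product)
qed

lemma ensemble_AE_sum:
  assumes r: "sqrt R = real r" "r \<ge> 1" and S: "ensemble_partition R N S"
  shows "AE \<xi> in lborel. \<xi> \<in> unit_square \<longrightarrow> (\<Sum>i=1..N. indicator (S i) \<xi> :: complex) = 1"
proof -
  have Sm: "S i \<in> sets borel" if "i \<in> {1..N}" for i
    using S that ensemble_measurable(1)[OF _ r] by (auto simp: ensemble_partition_def)
  have "AE \<xi> in lborel. \<xi> \<notin> S i \<inter> S j" if ij: "i \<in> {1..N}" "j \<in> {1..N}" "i \<noteq> j" for i j
  proof (rule AE_not_in)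
    have "negligible (S i \<inter> S j)" using S ij by (auto simp: ensemble_partition_def)
    then have "S i \<inter> S j \<in> null_sets lebesgue" by (simp add: negligible_iff_null_sets)
    then show "S i \<inter> S j \<in> null_sets lborel"
      using Sm ij by (subst (asm) null_sets_completion_iff) auto
  qed
  then have "\<forall>i\<in>{1..N}. \<forall>j\<in>{1..N}. AE \<xi> in lborel. i \<noteq> j \<longrightarrow> \<xi> \<notin> S i \<inter> S j" by auto
  then have "AE \<xi> in lborel. \<forall>i\<in>{1..N}. \<forall>j\<in>{1..N}. i \<noteq> j \<longrightarrow> \<xi> \<notin> S i \<inter> S j"
    by (simp add: AE_ball_countable)
  then show ?thesis
  proof eventually_elim
    fix \<xi> assume disj: "\<forall>i\<in>{1..N}. \<forall>j\<in>{1..N}. i \<noteq> j \<longrightarrow> \<xi> \<notin> S i \<inter> S j"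
    show "\<xi> \<in> unit_square \<longrightarrow> (\<Sum>i=1..N. indicator (S i) \<xi> :: complex) = 1"
    proof
      assume "\<xi> \<in> unit_square"
      then have "\<xi> \<in> (\<Union>i\<in>{1..N}. S i)" using S by (simp only: ensemble_partition_def)
      then obtain i where i: "i \<in> {1..N}" "\<xi> \<in> S i" by blast
      then have "\<xi> \<notin> S j" if "j \<in> {1..N} - {i}" for j using disj that by blast
      then have "(\<Sum>i\<in>{1..N} - {i}. indicator (S i) \<xi> :: complex) = 0" by (intro sum.neutral) auto
      then show "(\<Sum>i=1..N. indicator (S i) \<xi> :: complex) = 1"
        using i by (subst sum.remove[of _ i]) auto
    qed
  qed
qed

lemma spline_piece_ensemble_bound:
  assumes r: "sqrt R = real r" "r \<ge> 1" and L: "L \<ge> 1" and b: "spline_pair L b"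
    and S: "ensemble_partition R N S"
    and F: "integrable lborel F" "\<forall>\<xi>. F \<xi> \<noteq> 0 \<longrightarrow> \<xi> \<in> unit_square"
  shows "(norm (extension_op (\<lambda>\<xi>. spline_tensor b (real (L * r)) k \<xi> * F \<xi>) x))\<^sup>2
    \<le> 4 * (\<Sum>i=1..N. (norm (extension_op (\<lambda>\<xi>. spline_tensor b (real (L * r)) k \<xi> * (indicator (S i) \<xi> * F \<xi>)) x))\<^sup>2)"
proof -
  let ?s = "real (L * r)"
  let ?g = "\<lambda>i \<xi>. spline_tensor b ?s k \<xi> * (indicator (S i) \<xi> * F \<xi>)"
  let ?I = "{i\<in>{1..N}. \<exists>\<xi>\<in>S i. spline_tensor b ?s k \<xi> \<noteq> 0}"
  have Fm [measurable]: "F \<in> borel_measurable borel" using F(1) by auto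
  have Sm: "S i \<in> sets borel" if "i \<in> {1..N}" for i
    using S that ensemble_measurable(1)[OF _ r] by (auto simp: ensemble_partition_def)
  have g_int: "integrable lborel (?g i)" if "i \<in> {1..N}" for i
  proof (intro integrable_times_bounded F spline_tensor_measurable[OF b] norm_spline_tensor_le[OF b])
    show "(indicator (S i) :: real^2 \<Rightarrow> complex) \<in> borel_measurable borel" using Sm[OF that] by simp
  qed (simp add: indicator_def)
  have "extension_op (\<lambda>\<xi>. spline_tensor b ?s k \<xi> * F \<xi>) x = extension_op (\<lambda>\<xi>. \<Sum>i=1..N. ?g i \<xi>) x"
    unfolding extension_op_def
  proof (rule integral_cong_AE)
    note [measurable] = spline_tensor_measurable[OF b]
    show "(\<lambda>\<xi>. spline_tensor b ?s k \<xi> * F \<xi> * e_char (paraboloid \<xi> \<bullet> x)) \<in> borel_measurable lborel"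
      by measurable
    have [measurable]: "(\<lambda>\<xi>. \<Sum>i=1..N. ?g i \<xi>) \<in> borel_measurable borel"
      using g_int by (intro borel_measurable_sum) auto
    show "(\<lambda>\<xi>. (\<Sum>i=1..N. ?g i \<xi>) * e_char (paraboloid \<xi> \<bullet> x)) \<in> borel_measurable lborel"
      by measurable
    show "AE \<xi> in lborel. spline_tensor b ?s k \<xi> * F \<xi> * e_char (paraboloid \<xi> \<bullet> x)
        = (\<Sum>i=1..N. ?g i \<xi>) * e_char (paraboloid \<xi> \<bullet> x)"
      using ensemble_AE_sum[OF r S]
    proof eventually_elim
      fix \<xi> assume one: "\<xi> \<in> unit_square \<longrightarrow> (\<Sum>i=1..N. indicator (S i) \<xi> :: complex) = 1"
      have "(\<Sum>i=1..N. ?g i \<xi>) = spline_tensor b ?s k \<xi> * F \<xi> * (\<Sum>i=1..N. indicator (S i) \<xi>)"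
        by (simp only: sum_distrib_left mult_ac)
      also have "\<dots> = spline_tensor b ?s k \<xi> * F \<xi>"
        using one F(2) by (cases "F \<xi> = 0") auto
      finally show "spline_tensor b ?s k \<xi> * F \<xi> * e_char (paraboloid \<xi> \<bullet> x)
        = (\<Sum>i=1..N. ?g i \<xi>) * e_char (paraboloid \<xi> \<bullet> x)" by simp
    qed
  qed
  also have "\<dots> = (\<Sum>i=1..N. extension_op (?g i) x)"
    by (rule extension_op_sum) (use g_int in auto)
  also have "\<dots> = (\<Sum>i\<in>?I. extension_op (?g i) x)"
  proof (rule sum.mono_neutral_right)
    show "\<forall>i\<in>{1..N} - ?I. extension_op (?g i) x = 0"
    proof
      fix i assume "i \<in> {1..N} - ?I"
      then have "?g i = (\<lambda>_. 0)" by (auto simp: indicator_def fun_eq_iff)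
      then show "extension_op (?g i) x = 0" by (simp add: extension_op_def)
    qed
  qed auto
  finally have "(norm (extension_op (\<lambda>\<xi>. spline_tensor b ?s k \<xi> * F \<xi>) x))\<^sup>2 = (norm (\<Sum>i\<in>?I. extension_op (?g i) x))\<^sup>2"
    by simp
  also have "\<dots> \<le> (\<Sum>i\<in>?I. norm (extension_op (?g i) x))\<^sup>2"
    by (intro power_mono norm_sum) auto
  also have "\<dots> \<le> (\<Sum>i\<in>?I. (norm (extension_op (?g i) x))\<^sup>2) * card ?I"
    by (rule sum_squared_le_sum_of_squares)
  also have "\<dots> \<le> (\<Sum>i=1..N. (norm (extension_op (?g i) x))\<^sup>2) * 4"
  proof (rule mult_mono)
    show "real (card ?I) \<le> 4"
      using few_ensembles_meet_spline[OF r L b S, of k] by linarith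
  qed (auto intro!: sum_mono2 sum_nonneg)
  finally show ?thesis by (simp add: mult.commute)
qed

text \<open>
Changing \<open>F\<close> on a null set makes it Borel measurable and does not affect any of the extensions.
\<close>

lemma borel_representative:
  assumes F: "F absolutely_integrable_on unit_square"
  shows "\<exists>F'. integrable lborel F' \<and> F' \<in> borel_measurable borel \<and> (\<forall>\<xi>. F' \<xi> \<noteq> 0 \<longrightarrow> \<xi> \<in> unit_square) \<and>
    (\<forall>S\<in>sets borel. S \<subseteq> unit_square \<longrightarrow> extension S F = extension_op (\<lambda>\<xi>. indicator S \<xi> * F' \<xi>))"
proof -
  define G where "G \<xi> = indicator unit_square \<xi> *\<^sub>R F \<xi>" for \<xi>
  have G: "integrable lebesgue G" using F by (simp add: set_integrable_def G_def[abs_def])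
  then have Gm [measurable]: "G \<in> borel_measurable lebesgue" by auto
  have "(\<lambda>\<xi>. Re (G \<xi>)) \<in> borel_measurable lebesgue" "(\<lambda>\<xi>. Im (G \<xi>)) \<in> borel_measurable lebesgue" by measurable
  from this[THEN completion_ex_borel_measurable_real] obtain u v
    where uv: "u \<in> borel_measurable lborel" "AE \<xi> in lborel. Re (G \<xi>) = u \<xi>"
      "v \<in> borel_measurable lborel" "AE \<xi> in lborel. Im (G \<xi>) = v \<xi>" by blast
  note [measurable] = uv(1,3)
  define F' where "F' \<xi> = indicator unit_square \<xi> * (of_real (u \<xi>) + \<i> * of_real (v \<xi>))" for \<xi>
  have F'm [measurable]: "F' \<in> borel_measurable borel" unfolding F'_def by measurable
  have "AE \<xi> in lborel. F' \<xi> = G \<xi>"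
    using uv(2,4)
  proof eventually_elim
    fix \<xi> assume "Re (G \<xi>) = u \<xi>" "Im (G \<xi>) = v \<xi>"
    then have "of_real (u \<xi>) + \<i> * of_real (v \<xi>) = G \<xi>" using complex_eq[of "G \<xi>"] by simp
    then show "F' \<xi> = G \<xi>" by (simp add: F'_def G_def indicator_def)
  qed
  then have ae: "AE \<xi> in lebesgue. F' \<xi> = G \<xi>" by (rule AE_completion)
  have "integrable lebesgue F'"
    using G ae by (subst integrable_cong_AE[where g = G]) (auto simp: measurable_completion)
  then have int: "integrable lborel F'" by (simp add: integrable_completion)
  have "extension S F = extension_op (\<lambda>\<xi>. indicator S \<xi> * F' \<xi>)" if S: "S \<in> sets borel" "S \<subseteq> unit_square" for S
  proof
    fix x
    note [measurable] = S(1)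
    have em [measurable]: "(\<lambda>\<xi>. e_char (paraboloid \<xi> \<bullet> x)) \<in> borel_measurable lebesgue"
      by (rule measurable_completion) measurable
    have Sm [measurable]: "S \<in> sets lebesgue" using S(1) by simp
    have "extension S F x = (LINT \<xi>|lebesgue. (indicator S \<xi> * G \<xi>) * e_char (paraboloid \<xi> \<bullet> x))"
      unfolding extension_def set_lebesgue_integral_def G_def
      by (intro Bochner_Integration.integral_cong refl) (use S(2) in \<open>auto simp: indicator_def\<close>)
    also have "\<dots> = (LINT \<xi>|lebesgue. (indicator S \<xi> * F' \<xi>) * e_char (paraboloid \<xi> \<bullet> x))"
    proof (rule integral_cong_AE)
      show "AE \<xi> in lebesgue. indicator S \<xi> * G \<xi> * e_char (paraboloid \<xi> \<bullet> x) = indicator S \<xi> * F' \<xi> * e_char (paraboloid \<xi> \<bullet> x)"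
        using ae by eventually_elim simp
      show "(\<lambda>\<xi>. indicator S \<xi> * G \<xi> * e_char (paraboloid \<xi> \<bullet> x)) \<in> borel_measurable lebesgue" by measurable
      show "(\<lambda>\<xi>. indicator S \<xi> * F' \<xi> * e_char (paraboloid \<xi> \<bullet> x)) \<in> borel_measurable lebesgue"
        by (rule measurable_completion) measurable
    qed
    also have "\<dots> = (LINT \<xi>|lborel. (indicator S \<xi> * F' \<xi>) * e_char (paraboloid \<xi> \<bullet> x))"
      by (rule integral_completion) measurable
    finally show "extension S F x = extension_op (\<lambda>\<xi>. indicator S \<xi> * F' \<xi>) x"
      by (simp add: extension_op_def)
  qed
  moreover have "\<forall>\<xi>. F' \<xi> \<noteq> 0 \<longrightarrow> \<xi> \<in> unit_square" by (simp add: F'_def indicator_def)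
  ultimately show ?thesis using int F'm by blast
qed

section \<open>From grid squares to large ensembles\<close>

theorem theorem1p4:
  assumes reverse_square_function_estimate:
    "\<forall>p \<epsilon> :: real. 2 \<le> p \<and> p \<le> 3 \<and> \<epsilon> > 0 \<longrightarrow>
       (\<exists>C :: real. \<forall>R :: real. \<forall>c :: real^3. \<forall>F :: real^2 \<Rightarrow> complex.
          R \<ge> 1 \<and> sqrt R \<in> \<nat> \<and> F absolutely_integrable_on unit_square \<longrightarrow>
          Lp_norm_on p (cball c R) (extension unit_square F)
            \<le> C * R powr \<epsilon> * Lp_norm_weighted p (ball_weight c R) (square_function R F))"
  shows
    "\<forall>p \<epsilon> :: real. 2 \<le> p \<and> p \<le> 3 \<and> \<epsilon> > 0 \<longrightarrow>
       (\<exists>C' :: real. \<forall>R :: real. \<forall>c :: real^3. \<forall>N :: nat. \<forall>S :: nat \<Rightarrow> (real^2) set.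
          \<forall>F :: real^2 \<Rightarrow> complex.
          R \<ge> 1 \<and> sqrt R \<in> \<nat> \<and> ensemble_partition R N S \<and>
          F absolutely_integrable_on unit_square \<longrightarrow>
          Lp_norm_on p (cball c R) (extension unit_square F)
            \<le> C' * R powr \<epsilon> *
              sqrt (\<Sum>i=1..N. (Lp_norm_weighted p (ball_weight c R) (extension (S i) F))\<^sup>2))"
proof (intro allI impI, elim conjE)
  fix p \<epsilon> :: real assume p: "2 \<le> p" "p \<le> 3" and \<epsilon>: "\<epsilon> > 0"
  have p0: "p > 0" and q: "p / 2 \<ge> 1" using p by auto
  obtain C0 :: real where "\<And>R c (F :: real^2 \<Rightarrow> complex). R \<ge> 1 \<Longrightarrow> sqrt R \<in> \<nat> \<Longrightarrow> F absolutely_integrable_on unit_square \<Longrightarrow>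
          Lp_norm_on p (cball c R) (extension unit_square F)
            \<le> C0 * R powr \<epsilon> * Lp_norm_weighted p (ball_weight c R) (square_function R F)"
    using reverse_square_function_estimate p \<epsilon> by meson
  from reverse_square_functionI[OF p0 this] obtain D where D: "D > 0" "reverse_square_function p (\<epsilon> * p) D"
    by blast
  obtain b where b: "spline_pair 102 b" using spline_pair_exists[of 102] by auto
  have p1: "p \<ge> 1" and L0: "(0::real) \<le> 102" and L1: "(1::nat) \<le> 102" using p by auto
  obtain C1 where C1: "C1 > 0" "\<forall>R r c F. sqrt R = real r \<and> r \<ge> 1 \<and> integrable lborel F \<and> (\<forall>\<xi>. F \<xi> \<noteq> 0 \<longrightarrow> \<xi> \<in> unit_square) \<longrightarrow>
     (\<integral>\<^sup>+x. indicator (cball c R) x * ennreal (norm (extension_op F x) powr p) \<partial>lborel)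
       \<le> ennreal (C1 * R powr (\<epsilon> * p)) * (\<integral>\<^sup>+x. ennreal ((\<Sum>k\<in>spline_indices 102 r.
            (norm (extension_op (\<lambda>\<xi>. spline_tensor b (real (102 * r)) k \<xi> * F \<xi>) x))\<^sup>2) powr (p / 2) * ball_weight c R x) \<partial>lborel)"
    using smooth_reverse_square_function[OF p1 D(2,1) b L1] by (elim exE conjE) (rule that)
  obtain C2 where C2: "C2 > 0" "\<forall>(I :: nat set) f N K s R c. finite I \<and> I \<noteq> {} \<and> finite K \<and>
      R > 0 \<and> \<bar>s\<bar> \<le> 102 * R \<and>
      (\<forall>i\<in>I. integrable lborel (f i) \<and> 0 \<le> N i \<and>
        (\<integral>\<^sup>+x. ennreal ((norm (extension_op (f i) x))\<^sup>2 powr (p / 2) * ball_weight c R x) \<partial>lborel) \<le> ennreal (N i powr (p / 2))) \<longrightarrow>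
     (\<integral>\<^sup>+x. ennreal ((\<Sum>i\<in>I. \<Sum>k\<in>K. (norm (extension_op (\<lambda>\<xi>. spline_tensor b s k \<xi> * f i \<xi>) x))\<^sup>2) powr (p / 2)
        * ball_weight c R x) \<partial>lborel) \<le> ennreal ((C2 * (\<Sum>i\<in>I. N i)) powr (p / 2))"
    using spline_square_function_weighted[OF b L0 q] by (elim exE conjE) (rule that)
  define C' where "C' = (C1 * (4 * C2) powr (p / 2)) powr (1 / p)"
  show "\<exists>C' :: real. \<forall>R :: real. \<forall>c :: real^3. \<forall>N :: nat. \<forall>S :: nat \<Rightarrow> (real^2) set.
          \<forall>F :: real^2 \<Rightarrow> complex.
          R \<ge> 1 \<and> sqrt R \<in> \<nat> \<and> ensemble_partition R N S \<and>
          F absolutely_integrable_on unit_square \<longrightarrow>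
          Lp_norm_on p (cball c R) (extension unit_square F)
            \<le> C' * R powr \<epsilon> *
              sqrt (\<Sum>i=1..N. (Lp_norm_weighted p (ball_weight c R) (extension (S i) F))\<^sup>2)"
  proof (intro exI[of _ C'] allI impI, elim conjE)
    fix R :: real and c :: "real^3" and N :: nat and S :: "nat \<Rightarrow> (real^2) set" and F :: "real^2 \<Rightarrow> complex"
    assume R: "R \<ge> 1" "sqrt R \<in> \<nat>" and S: "ensemble_partition R N S" and F: "F absolutely_integrable_on unit_square"
    obtain r :: nat where r: "sqrt R = real r" using R(2) by (auto simp: Nats_def)
    have r1: "r \<ge> 1" using R(1) r real_sqrt_ge_1_iff[of R] by (cases r) auto
    obtain F' where F': "integrable lborel F'" "F' \<in> borel_measurable borel" "\<forall>\<xi>. F' \<xi> \<noteq> 0 \<longrightarrow> \<xi> \<in> unit_square"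
      and ext: "\<And>S. S \<in> sets borel \<Longrightarrow> S \<subseteq> unit_square \<Longrightarrow> extension S F = extension_op (\<lambda>\<xi>. indicator S \<xi> * F' \<xi>)"
      using borel_representative[OF F] by blast
    note [measurable] = F'(2)
    have Si: "S i \<in> sets borel" "S i \<subseteq> unit_square" if "i \<in> {1..N}" for i
      using S that ensemble_measurable[OF _ r r1] by (auto simp: ensemble_partition_def)
    have N: "{1..N} \<noteq> {}"
    proof
      assume "{1..N} = {}"
      then have "unit_square = {}" using S by (simp add: ensemble_partition_def)
      moreover have "0 \<in> unit_square" by (simp add: unit_square_def)
      ultimately show False by simp
    qed
    have "(\<lambda>\<xi>. indicator unit_square \<xi> * F' \<xi>) = F'"
      using F'(3) by (auto simp: indicator_def fun_eq_iff)
    then have ext_unit: "extension unit_square F = extension_op F'" using ext[of unit_square] by simp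
    define f where "f i = (\<lambda>\<xi>. indicator (S i) \<xi> * F' \<xi>)" for i
    have f_int: "integrable lborel (f i)" if "i \<in> {1..N}" for i
      unfolding f_def using Si(1)[OF that] by (intro integrable_times_bounded F') (auto simp: indicator_def)
    have ext_f: "extension (S i) F = extension_op (f i)" if "i \<in> {1..N}" for i
      unfolding f_def using ext Si[OF that] by simp
    define n where "n i = Lp_norm_weighted p (ball_weight c R) (extension (S i) F)" for i
    have n0: "n i \<ge> 0" for i by (simp add: n_def Lp_norm_weighted_def)
    have f_le: "(\<integral>\<^sup>+x. ennreal ((norm (extension_op (f i) x))\<^sup>2 powr (p / 2) * ball_weight c R x) \<partial>lborel) \<le> ennreal ((n i)\<^sup>2 powr (p / 2))"
      if i: "i \<in> {1..N}" for i
    proof -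
      have sq: "(y\<^sup>2) powr (p / 2) = y powr p" if "y \<ge> 0" for y :: real
        using that p0 by (cases "y = 0") (auto simp: powr_powr simp flip: powr_numeral)
      have [measurable]: "f i \<in> borel_measurable borel" using f_int[OF i] by auto
      have "(\<integral>\<^sup>+x. ennreal (norm (extension_op (f i) x) powr p * ball_weight c R x) \<partial>lborel) = ennreal (n i powr p)"
        unfolding n_def ext_f[OF i]
        by (rule Lp_norm_weighted_eq_nn_integral[OF _ norm_extension_op_le p0]) (use R in auto)
      then show ?thesis by (simp add: sq n0)
    qed
    let ?s = "real (102 * r)"
    let ?T = "\<Sum>i=1..N. (n i)\<^sup>2"
    have T0: "?T \<ge> 0" by (intro sum_nonneg) auto
    \<comment> \<open>The averages act at scale \<open>\<surd>R\<close>, and \<open>\<surd>R \<le> R\<close> because \<open>R \<ge> 1\<close>.\<close>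
    have s_le: "\<bar>?s\<bar> \<le> 102 * R"
    proof -
      have "real r \<le> real r * real r" using r1 by (simp add: mult_left_mono)
      also have "\<dots> = R" using r R(1) by (metis abs_of_nonneg order_trans real_sqrt_mult_self zero_le_one)
      finally show ?thesis by simp
    qed
    have "ennreal (Lp_norm_on p (cball c R) (extension_op F') powr p)
        = (\<integral>\<^sup>+x. indicator (cball c R) x * ennreal (norm (extension_op F' x) powr p) \<partial>lborel)"
      by (rule Lp_norm_on_eq_nn_integral[OF _ norm_extension_op_le p0, symmetric]) measurable
    also have "\<dots> \<le> ennreal (C1 * R powr (\<epsilon> * p)) * (\<integral>\<^sup>+x. ennreal ((\<Sum>k\<in>spline_indices 102 r.
            (norm (extension_op (\<lambda>\<xi>. spline_tensor b ?s k \<xi> * F' \<xi>) x))\<^sup>2) powr (p / 2) * ball_weight c R x) \<partial>lborel)"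
      by (rule C1(2)[rule_format]) (use r r1 F'(1,3) in blast)
    also have "\<dots> \<le> ennreal (C1 * R powr (\<epsilon> * p)) * (ennreal (4 powr (p / 2)) * (\<integral>\<^sup>+x. ennreal ((\<Sum>i=1..N. \<Sum>k\<in>spline_indices 102 r.
            (norm (extension_op (\<lambda>\<xi>. spline_tensor b ?s k \<xi> * f i \<xi>) x))\<^sup>2) powr (p / 2) * ball_weight c R x) \<partial>lborel))"
    proof (rule mult_left_mono)
      let ?U = "\<lambda>x. \<Sum>i=1..N. \<Sum>k\<in>spline_indices 102 r. (norm (extension_op (\<lambda>\<xi>. spline_tensor b ?s k \<xi> * f i \<xi>) x))\<^sup>2"
      have U0: "?U x \<ge> 0" for x by (intro sum_nonneg) auto
      have [measurable]: "extension_op (\<lambda>\<xi>. spline_tensor b ?s k \<xi> * f i \<xi>) \<in> borel_measurable borel" if "i \<in> {1..N}" for i k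
        using f_int[OF that] spline_tensor_measurable[OF b, of ?s k]
        by (intro extension_op_measurable borel_measurable_times) auto
      have "(\<integral>\<^sup>+x. ennreal ((\<Sum>k\<in>spline_indices 102 r.
            (norm (extension_op (\<lambda>\<xi>. spline_tensor b ?s k \<xi> * F' \<xi>) x))\<^sup>2) powr (p / 2) * ball_weight c R x) \<partial>lborel)
         \<le> (\<integral>\<^sup>+x. ennreal (4 powr (p / 2)) * ennreal (?U x powr (p / 2) * ball_weight c R x) \<partial>lborel)"
      proof (rule nn_integral_mono)
        fix x
        have "(\<Sum>k\<in>spline_indices 102 r. (norm (extension_op (\<lambda>\<xi>. spline_tensor b ?s k \<xi> * F' \<xi>) x))\<^sup>2)
          \<le> (\<Sum>k\<in>spline_indices 102 r. 4 * (\<Sum>i=1..N. (norm (extension_op (\<lambda>\<xi>. spline_tensor b ?s k \<xi> * f i \<xi>) x))\<^sup>2))"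
          unfolding f_def by (intro sum_mono spline_piece_ensemble_bound[OF r r1 _ b S F'(1,3)]) simp
        also have "\<dots> = 4 * ?U x"
          unfolding sum_distrib_left[symmetric] by (subst sum.swap) simp
        finally have "(\<Sum>k\<in>spline_indices 102 r. (norm (extension_op (\<lambda>\<xi>. spline_tensor b ?s k \<xi> * F' \<xi>) x))\<^sup>2) powr (p / 2)
          \<le> (4 * ?U x) powr (p / 2)"
          using p0 by (intro powr_mono2) (auto intro!: sum_nonneg)
        also have "\<dots> = 4 powr (p / 2) * ?U x powr (p / 2)" using U0 by (simp add: powr_mult)
        finally have "(\<Sum>k\<in>spline_indices 102 r. (norm (extension_op (\<lambda>\<xi>. spline_tensor b ?s k \<xi> * F' \<xi>) x))\<^sup>2) powr (p / 2) * ball_weight c R x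
          \<le> (4 powr (p / 2) * ?U x powr (p / 2)) * ball_weight c R x"
          by (rule mult_right_mono) simp
        then show "ennreal ((\<Sum>k\<in>spline_indices 102 r. (norm (extension_op (\<lambda>\<xi>. spline_tensor b ?s k \<xi> * F' \<xi>) x))\<^sup>2) powr (p / 2) * ball_weight c R x)
          \<le> ennreal (4 powr (p / 2)) * ennreal (?U x powr (p / 2) * ball_weight c R x)"
          by (simp only: ennreal_mult'[OF powr_ge_zero, symmetric] mult.assoc ennreal_leI)
      qed
      also have "\<dots> = ennreal (4 powr (p / 2)) * (\<integral>\<^sup>+x. ennreal (?U x powr (p / 2) * ball_weight c R x) \<partial>lborel)"
        by (rule nn_integral_cmult) measurable
      finally show "(\<integral>\<^sup>+x. ennreal ((\<Sum>k\<in>spline_indices 102 r.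
            (norm (extension_op (\<lambda>\<xi>. spline_tensor b ?s k \<xi> * F' \<xi>) x))\<^sup>2) powr (p / 2) * ball_weight c R x) \<partial>lborel) \<le> \<dots>" .
    qed simp
    also have "\<dots> \<le> ennreal (C1 * R powr (\<epsilon> * p)) * (ennreal (4 powr (p / 2)) * ennreal ((C2 * ?T) powr (p / 2)))"
    proof (intro mult_left_mono)
      show "(\<integral>\<^sup>+x. ennreal ((\<Sum>i=1..N. \<Sum>k\<in>spline_indices 102 r.
            (norm (extension_op (\<lambda>\<xi>. spline_tensor b ?s k \<xi> * f i \<xi>) x))\<^sup>2) powr (p / 2) * ball_weight c R x) \<partial>lborel)
        \<le> ennreal ((C2 * ?T) powr (p / 2))"
      proof (rule C2(2)[rule_format], intro conjI ballI)
        show "\<bar>?s\<bar> \<le> 102 * R" by (rule s_le)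
        show "integrable lborel (f i)" if "i \<in> {1..N}" for i by (rule f_int[OF that])
        show "(\<integral>\<^sup>+x. ennreal ((norm (extension_op (f i) x))\<^sup>2 powr (p / 2) * ball_weight c R x) \<partial>lborel) \<le> ennreal ((n i)\<^sup>2 powr (p / 2))"
          if "i \<in> {1..N}" for i by (rule f_le[OF that])
      qed (use N R in auto)
    qed auto
    also have "\<dots> = ennreal (C1 * R powr (\<epsilon> * p) * (4 powr (p / 2) * (C2 * ?T) powr (p / 2)))"
      using C1(1) by (simp add: ennreal_mult')
    also have "C1 * R powr (\<epsilon> * p) * (4 powr (p / 2) * (C2 * ?T) powr (p / 2)) = (C' * R powr \<epsilon> * sqrt ?T) powr p"
    proof -
      have "C' powr p = C1 * (4 * C2) powr (p / 2)"
        using p0 C1(1) by (simp add: C'_def powr_powr)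
      moreover have "(R powr \<epsilon>) powr p = R powr (\<epsilon> * p)" by (simp add: powr_powr)
      moreover have "sqrt ?T powr p = ?T powr (p / 2)"
        using T0 by (simp add: powr_half_sqrt[symmetric] powr_powr)
      moreover have "C' \<ge> 0" by (simp add: C'_def)
      ultimately show ?thesis using T0 C2(1) by (simp add: powr_mult mult_ac)
    qed
    finally have le: "Lp_norm_on p (cball c R) (extension_op F') powr p \<le> (C' * R powr \<epsilon> * sqrt ?T) powr p"
      by simp
    have "Lp_norm_on p (cball c R) (extension_op F') \<le> C' * R powr \<epsilon> * sqrt ?T"
    proof (rule ccontr)
      assume "\<not> ?thesis"
      moreover have "0 \<le> C' * R powr \<epsilon> * sqrt ?T" using T0 by (simp add: C'_def)
      ultimately have "(C' * R powr \<epsilon> * sqrt ?T) powr p < Lp_norm_on p (cball c R) (extension_op F') powr p"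
        using p0 by (intro powr_less_mono2) auto
      with le show False by simp
    qed
    then show "Lp_norm_on p (cball c R) (extension unit_square F)
            \<le> C' * R powr \<epsilon> * sqrt (\<Sum>i=1..N. (Lp_norm_weighted p (ball_weight c R) (extension (S i) F))\<^sup>2)"
      by (simp add: ext_unit n_def)
  qed
qed

end
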